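(* Consider either the one-dimensional or the two-dimensional setting described in the context. For each $\varepsilon\in(0,1]$ let the exact solution of the corresponding multiscale parity decomposition system be given (with $\rho\in H^1(\mathcal{T}\times\mathcal{D})$ and the remaining components in $H^1(\mathcal{T}\times\mathcal{D}\times\Omega^+)$), together with neural network approximations, and let $\mathcal{R}^\varepsilon_{\mathrm{APNN}}$ be the corresponding physics-informed loss, based on the residual of the multiscale parity decomposition system, and $\mathcal{R}^\varepsilon_{\mathrm{total}}$ the corresponding squared error between the numerical solution and the exact solution. Then $$\mathcal{R}_{\mathrm{total}}^\varepsilon=\mathcal{O}\Big(\sqrt[3]{\big(\mathcal{R}^\varepsilon_{\mathrm{APNN}}\big)^{2}}\Big),\quad\text{uniformly in }\varepsilon,$$ i.e. there are constants $C,\delta>0$ independent of $\varepsilon$ such that $\mathcal{R}_{\mathrm{total}}^\varepsilon\le C\,(\mathcal{R}^\varepsilon_{\mathrm{APNN}})^{2/3}$ whenever $\mathcal{R}^\varepsilon_{\mathrm{APNN}}\le\delta$.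
   Context: Common notation. $\mathcal{T}=(0,T)$ is a bounded time interval, $\lambda_1,\dots,\lambda_4>0$ are fixed penalty weights, $\varepsilon$ is the Knudsen number. A subscript $\theta$ denotes neural network approximations (smooth functions of the same variables as the approximated quantity, depending on trainable parameters $\theta$). Subscripts $\mathrm{IC}$ and $\mathrm{BC}$ denote the initial data (values at $t=0$) and boundary data (values on $\partial\mathcal{D}$) of the exact solution. $|\cdot|$ of a set is its measure. Exact solutions and networks may depend on $\varepsilon$. ONE-DIMENSIONAL SETTING. $\mathcal{D}=(x_L,x_R)$, $\Omega^+=[0,1]$, $\langle g\rangle=\int_0^1 g\,\mathrm{d}v$. The radiative transfer equation is $\varepsilon\partial_t f+v\partial_x f=\frac1\varepsilon(\frac12\int_{-1}^1 f\,\mathrm{d}v'-f)$, $v\in[-1,1]$, with periodic boundary condition $f(t,x_L,v)=f(t,x_R,v)$ and initial condition $f(0,x,v)=f_{\mathrm{IC}}(x,v)$. For $v\in\Omega^+$ set $r=\frac12[f(v)+f(-v)]$, $j=\frac1{2\varepsilon}[f(v)-f(-v)]$, $\rho=\langle r\rangle$, $r=\rho+\varepsilon^2 w$, so $f=\rho+\varepsilon j+\varepsilon^2w$ on $\Omega^+$. The multiscale parity decomposition system for $\rho(t,x),j(t,x,v),w(t,x,v)$ is $$\partial_t\rho+\langle v\partial_xj\rangle=0,\quad \varepsilon^2\partial_tj+v\partial_x\rho+\varepsilon^2v\partial_xw+j=0,\quad \varepsilon^2\partial_tw+w+v\partial_xj-\langle v\partial_xj\rangle=0,$$ with $\langle w\rangle=0$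 and periodicity in $x$. For approximations $\rho_\theta,j_\theta,w_\theta$ put $f_\theta=\rho_\theta+\varepsilon j_\theta+\varepsilon^2w_\theta$ and $d^{(1)}_\theta=\partial_t\rho_\theta+\langle v\partial_xj_\theta\rangle$, $d^{(2)}_\theta=\varepsilon^2\partial_tj_\theta+v\partial_x\rho_\theta+\varepsilon^2v\partial_xw_\theta+j_\theta$, $d^{(3)}_\theta=\varepsilon^2\partial_tw_\theta+w_\theta+v\partial_xj_\theta-\langle v\partial_xj_\theta\rangle$. Then $\mathcal{R}^\varepsilon_{\mathrm{APNN}}=\mathcal{R}^\varepsilon_{\mathrm{residual}}+\mathcal{R}^\varepsilon_{\mathrm{initial}}+\mathcal{R}^\varepsilon_{\mathrm{boundary}}$ with $$\mathcal{R}^\varepsilon_{\mathrm{residual}}=\tfrac{1}{|\mathcal{T}\times\mathcal{D}|}\int_{\mathcal{T}}\int_{\mathcal{D}}|d^{(1)}_\theta|^2\,\mathrm{d}x\mathrm{d}t+\tfrac{1}{|\mathcal{T}\times\mathcal{D}\times\Omega^+|}\int_{\mathcal{T}}\int_{\mathcal{D}}\int_{\Omega^+}(|d^{(2)}_\theta|^2+|d^{(3)}_\theta|^2)\,\mathrm{d}v\mathrm{d}x\mathrm{d}t,$$ $$\mathcal{R}^\varepsilon_{\mathrm{initial}}=\tfrac{\lambda_1}{|\mathcal{D}|}\int_{\mathcal{D}}|\rho_\theta-\rho_{\mathrm{IC}}|^2\mathrm{d}x+\tfrac{\lambda_2}{|\mathcal{D}\times\Omega^+|}\int_{\mathcal{D}}\int_{\Omega^+}\big(\varepsilon^2|j_\theta-j_{\mathrm{IC}}|^2+\varepsilon^4|w_\theta-w_{\mathrm{IC}}|^2\big)\mathrm{d}v\mathrm{d}x\quad(\text{at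 }t=0),$$ $$\mathcal{R}^\varepsilon_{\mathrm{boundary}}=\tfrac{\lambda_3}{|\mathcal{T}\times\partial\mathcal{D}|}\int_{\mathcal{T}}\int_{\partial\mathcal{D}}|\rho_\theta-\rho_{\mathrm{BC}}|^2\mathrm{d}s\mathrm{d}t+\tfrac{\lambda_4}{|\mathcal{T}\times\partial\mathcal{D}\times\Omega^+|}\int_{\mathcal{T}}\int_{\partial\mathcal{D}}\int_{\Omega^+}\big(|w_\theta-w_{\mathrm{BC}}|^2+|j_\theta-j_{\mathrm{BC}}|^2\big)\mathrm{d}v\mathrm{d}s\mathrm{d}t,$$ where $\mathrm{d}s$ on $\partial\mathcal{D}=\{x_L,x_R\}$ is counting measure. Finally $\mathcal{R}^\varepsilon_{\mathrm{total}}=\|f-f_\theta\|^2_{L^2(\mathcal{T}\times\mathcal{D}\times\Omega^+)}$. TWO-DIMENSIONAL SETTING. $\mathcal{D}\subset\mathbb{R}^2$ is a bounded rectangle (period cell), $\boldsymbol{x}=(x,y)\in\mathcal{D}$, $\boldsymbol{v}=(\xi,\eta)$, $\Omega^+=\{(\xi,\eta):\xi>0,\eta>0,\xi^2+\eta^2=1\}$ with arc length measure, $\langle g\rangle=\frac2\pi\int_{\Omega^+}g\,\mathrm{d}\boldsymbol{v}$. The radiative transfer equation is $\varepsilon\partial_tf+\boldsymbol{v}\cdot\nabla_{\boldsymbol{x}}f=\frac1\varepsilon(\frac1{2\pi}\int_{|\boldsymbol{v}'|=1}f\,\mathrm{d}\boldsymbol{v}'-f)$, $|\boldsymbol{v}|=1$,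 with periodic boundary condition in $\boldsymbol{x}$ and initial data $f_{\mathrm{IC}}$. On $\Omega^+$ set $r_1=\frac12[f(\xi,-\eta)+f(-\xi,\eta)]$, $r_2=\frac12[f(\xi,\eta)+f(-\xi,-\eta)]$, $j_1=\frac1{2\varepsilon}[f(\xi,-\eta)-f(-\xi,\eta)]$, $j_2=\frac1{2\varepsilon}[f(\xi,\eta)-f(-\xi,-\eta)]$, $\rho=\langle\frac{r_1+r_2}2\rangle$, $\frac{r_1+r_2}2=\rho+\varepsilon^2w$, $\varphi=r_2-r_1$; so on $\Omega^+$, $f=\rho+\frac\varphi2+\varepsilon(\frac{j_2+j_1}2+\frac{j_2-j_1}2)+\varepsilon^2w$. Write $A=\xi\partial_x(j_1+j_2)+\eta\partial_y(j_2-j_1)$. The multiscale parity decomposition system is $$2\partial_t\rho+\langle A\rangle=0,\qquad 2\varepsilon^2\partial_tw+A-\langle A\rangle+2w=0,$$ $$\varepsilon^2\partial_t\varphi+\varepsilon^2\xi\partial_x(j_2-j_1)+\varepsilon^2\eta\partial_y(j_1+j_2)+\varphi=0,$$ $$\varepsilon^2\partial_t(j_1+j_2)+(j_1+j_2)+2\xi\partial_x(\rho+\varepsilon^2w)+\eta\partial_y\varphi=0,$$ $$\varepsilon^2\partial_t(j_2-j_1)+(j_2-j_1)+\xi\partial_x\varphi+2\eta\partial_y(\rho+\varepsilon^2w)=0,$$ with $\langle w\rangle=0$ and periodicity in $\boldsymbol{x}$. For approximations $\rho_\theta,\varphi_\theta,j_{1,\theta},j_{2,\theta},w_\theta$ put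 $f_\theta=\rho_\theta+\frac{\varphi_\theta}2+\varepsilon(\frac{j_{2,\theta}+j_{1,\theta}}2+\frac{j_{2,\theta}-j_{1,\theta}}2)+\varepsilon^2w_\theta$, $A_\theta=\xi\partial_x(j_{1,\theta}+j_{2,\theta})+\eta\partial_y(j_{2,\theta}-j_{1,\theta})$, and $d^{(1)}_\theta=2\partial_t\rho_\theta+\langle A_\theta\rangle$, $d^{(2)}_\theta=2\varepsilon^2\partial_tw_\theta+A_\theta-\langle A_\theta\rangle+2w_\theta$, $d^{(3)}_\theta=\partial_t\varphi_\theta+\xi\partial_x(j_{2,\theta}-j_{1,\theta})+\eta\partial_y(j_{1,\theta}+j_{2,\theta})+\frac1{\varepsilon^2}\varphi_\theta$, $d^{(4)}_\theta=\varepsilon^2\partial_t(j_{1,\theta}+j_{2,\theta})+(j_{1,\theta}+j_{2,\theta})+2\xi\partial_x(\rho_\theta+\varepsilon^2w_\theta)+\eta\partial_y\varphi_\theta$, $d^{(5)}_\theta=\varepsilon^2\partial_t(j_{2,\theta}-j_{1,\theta})+(j_{2,\theta}-j_{1,\theta})+\xi\partial_x\varphi_\theta+2\eta\partial_y(\rho_\theta+\varepsilon^2w_\theta)$. Then $\mathcal{R}^\varepsilon_{\mathrm{APNN}}=\mathcal{R}^\varepsilon_{\mathrm{residual}}+\mathcal{R}^\varepsilon_{\mathrm{initial}}+\mathcal{R}^\varepsilon_{\mathrm{boundary}}$ with $$\mathcal{R}^\varepsilon_{\mathrm{residual}}=\tfrac1{|\mathcal{T}\times\mathcal{D}|}\int_{\mathcal{T}}\int_{\mathcal{D}}|d^{(1)}_\theta|^2\mathrm{d}\boldsymbol{x}\mathrm{d}t+\tfrac1{|\mathcal{T}\times\mathcal{D}\times\Omega^+|}\sum_{k=2}^5\int_{\mathcal{T}}\int_{\mathcal{D}}\int_{\Omega^+}|d^{(k)}_\theta|^2\mathrm{d}\boldsymbol{v}\mathrm{d}\boldsymbol{x}\mathrm{d}t,$$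 $$\mathcal{R}^\varepsilon_{\mathrm{initial}}=\tfrac{\lambda_1}{|\mathcal{D}|}\int_{\mathcal{D}}|\rho_\theta-\rho_{\mathrm{IC}}|^2\mathrm{d}\boldsymbol{x}+\tfrac{\lambda_2}{|\mathcal{D}\times\Omega^+|}\int_{\mathcal{D}}\int_{\Omega^+}\big(\varepsilon^4|w_\theta-w_{\mathrm{IC}}|^2+|\varphi_\theta-\varphi_{\mathrm{IC}}|^2+\varepsilon^2|(j_{1,\theta}+j_{2,\theta})-(j_{1,\mathrm{IC}}+j_{2,\mathrm{IC}})|^2+\varepsilon^2|(j_{2,\theta}-j_{1,\theta})-(j_{2,\mathrm{IC}}-j_{1,\mathrm{IC}})|^2\big)\mathrm{d}\boldsymbol{v}\mathrm{d}\boldsymbol{x}\quad(\text{at }t=0),$$ $$\mathcal{R}^\varepsilon_{\mathrm{boundary}}=\tfrac{\lambda_3}{|\mathcal{T}\times\partial\mathcal{D}|}\int_{\mathcal{T}}\int_{\partial\mathcal{D}}|\rho_\theta-\rho_{\mathrm{BC}}|^2\mathrm{d}s\mathrm{d}t+\tfrac{\lambda_4}{|\mathcal{T}\times\partial\mathcal{D}\times\Omega^+|}\int_{\mathcal{T}}\int_{\partial\mathcal{D}}\int_{\Omega^+}\big(|w_\theta-w_{\mathrm{BC}}|^2+|\varphi_\theta-\varphi_{\mathrm{BC}}|^2+|(j_{1,\theta}+j_{2,\theta})-(j_{1,\mathrm{BC}}+j_{2,\mathrm{BC}})|^2+|(j_{2,\theta}-j_{1,\theta})-(j_{2,\mathrm{BC}}-j_{1,\mathrm{BC}})|^2\big)\mathrm{d}\boldsymbol{v}\mathrm{d}s\mathrm{d}t.$$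 Finally $\mathcal{R}^\varepsilon_{\mathrm{total}}=\|f-f_\theta\|^2_{L^2(\mathcal{T}\times\mathcal{D}\times\Omega^+)}$. *)

theory Defs
  imports "HOL-Analysis.Analysis"
begin

section \<open>Smooth functions, \<open>H\<^sup>1\<close> and traces\<close>

text \<open>\<open>Ck k f\<close>: all partial derivatives of \<open>f\<close> of order at most \<open>k\<close> exist and are continuous.\<close>

abbreviation pd :: "'a::euclidean_space \<Rightarrow> ('a \<Rightarrow> real) \<Rightarrow> 'a \<Rightarrow> real" where
  "pd h f p \<equiv> frechet_derivative f (at p) h"

primrec Ck :: "nat \<Rightarrow> ('a::euclidean_space \<Rightarrow> real) \<Rightarrow> bool" where
  "Ck 0 = (\<lambda>f. continuous_on UNIV f)"
| "Ck (Suc k) = (\<lambda>f. (\<forall>p. f differentiable (at p)) \<and> (\<forall>h\<in>Basis. Ck k (pd h f)))"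

definition smooth :: "('a::euclidean_space \<Rightarrow> real) \<Rightarrow> bool" where
  "smooth f \<longleftrightarrow> (\<forall>k. Ck k f)"

definition test_function :: "'a::euclidean_space set \<Rightarrow> ('a \<Rightarrow> real) \<Rightarrow> bool" where
  "test_function U \<phi> \<longleftrightarrow> smooth \<phi> \<and>
     compact (closure {p. \<phi> p \<noteq> 0}) \<and> closure {p. \<phi> p \<noteq> 0} \<subseteq> U"

text \<open>Elements of \<open>L\<^sup>2\<close> are represented by Borel functions; values outside \<open>U\<close> are irrelevant.\<close>

definition L2 :: "'a::euclidean_space set \<Rightarrow> ('a \<Rightarrow> real) \<Rightarrow> bool" where
  "L2 U u \<longleftrightarrow> set_borel_measurable lborel U u \<and> set_integrable lborel U (\<lambda>p. (u p)\<^sup>2)"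

definition has_weak_deriv ::
  "'a::euclidean_space set \<Rightarrow> 'a \<Rightarrow> ('a \<Rightarrow> real) \<Rightarrow> ('a \<Rightarrow> real) \<Rightarrow> bool" where
  "has_weak_deriv U h u g \<longleftrightarrow> L2 U g \<and>
     (\<forall>\<phi>. test_function U \<phi> \<longrightarrow>
        (LINT p:U|lborel. u p * pd h \<phi> p) = - (LINT p:U|lborel. g p * \<phi> p))"

definition H1 :: "'a::euclidean_space set \<Rightarrow> ('a \<Rightarrow> real) \<Rightarrow> bool" where
  "H1 U u \<longleftrightarrow> L2 U u \<and> (\<forall>h\<in>Basis. \<exists>g. has_weak_deriv U h u g)"

text \<open>A representative of the weak derivative, which is unique up to null sets.\<close>

definition weak_pd :: "'a::euclidean_space set \<Rightarrow> 'a \<Rightarrow> ('a \<Rightarrow> real) \<Rightarrow> 'a \<Rightarrow> real" where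
  "weak_pd U h u = (SOME g. has_weak_deriv U h u g)"

text \<open>
  \<open>has_trace U u S \<gamma> g\<close>: the trace of \<open>u \<in> H\<^sup>1(U)\<close> on the face of \<open>U\<close> parametrised isometrically by
  \<open>\<gamma>\<close> on \<open>S\<close> is \<open>g\<close>, the trace operator being the continuous extension to \<open>H\<^sup>1(U)\<close> of the restriction
  of functions that are smooth up to the boundary.
\<close>

definition has_trace ::
  "'a::euclidean_space set \<Rightarrow> ('a \<Rightarrow> real) \<Rightarrow>
   'b::euclidean_space set \<Rightarrow> ('b \<Rightarrow> 'a) \<Rightarrow> ('b \<Rightarrow> real) \<Rightarrow> bool" where
  "has_trace U u S \<gamma> g \<longleftrightarrow> L2 S g \<and>
     (\<exists>un. (\<forall>n::nat. smooth (un n)) \<and>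
        (\<lambda>n. LINT p:U|lborel. (un n p - u p)\<^sup>2) \<longlonglongrightarrow> 0 \<and>
        (\<forall>h\<in>Basis. (\<lambda>n. LINT p:U|lborel. (pd h (un n) p - weak_pd U h u p)\<^sup>2) \<longlonglongrightarrow> 0) \<and>
        (\<lambda>n. LINT s:S|lborel. (un n (\<gamma> s) - g s)\<^sup>2) \<longlonglongrightarrow> 0)"


section \<open>One space dimension\<close>

text \<open>
  Arguments are ordered \<open>(t, x)\<close> for \<open>\<rho>\<close> and \<open>(t, x, v)\<close> for \<open>j\<close> and \<open>w\<close>. The same record is used for
  exact solutions, networks, and boundary data; for the latter only \<open>x \<in> {xL, xR}\<close> matters.
\<close>

record state1 =
  rho1 :: "real \<times> real \<Rightarrow> real"
  j1d :: "real \<times> real \<times> real \<Rightarrow> real"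
  w1d :: "real \<times> real \<times> real \<Rightarrow> real"

record init1 =
  rho1_IC :: "real \<Rightarrow> real"
  j1d_IC :: "real \<times> real \<Rightarrow> real"
  w1d_IC :: "real \<times> real \<Rightarrow> real"

definition avg1 :: "(real \<Rightarrow> real) \<Rightarrow> real" where
  "avg1 g = (LINT v:{0..1}|lborel. g v)"

definition solves1 :: "real \<Rightarrow> real \<Rightarrow> real \<Rightarrow> real \<Rightarrow> state1 \<Rightarrow> bool" where
  "solves1 T xL xR \<epsilon> s \<longleftrightarrow>
    (let U = {0<..<T} \<times> {xL<..<xR};
         V = {0<..<T} \<times> {xL<..<xR} \<times> {0<..<1};
         \<rho>t = weak_pd U (1, 0) (rho1 s);
         \<rho>x = weak_pd U (0, 1) (rho1 s);
         jt = weak_pd V (1, 0, 0) (j1d s);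
         jx = weak_pd V (0, 1, 0) (j1d s);
         wt = weak_pd V (1, 0, 0) (w1d s);
         wx = weak_pd V (0, 1, 0) (w1d s)
     in H1 U (rho1 s) \<and> H1 V (j1d s) \<and> H1 V (w1d s) \<and>
        (AE (t, x) in lborel. (t, x) \<in> U \<longrightarrow>
           \<rho>t (t, x) + avg1 (\<lambda>v. v * jx (t, x, v)) = 0) \<and>
        (AE (t, x, v) in lborel. (t, x, v) \<in> V \<longrightarrow>
           \<epsilon>\<^sup>2 * jt (t, x, v) + v * \<rho>x (t, x) + \<epsilon>\<^sup>2 * v * wx (t, x, v) + j1d s (t, x, v) = 0) \<and>
        (AE (t, x, v) in lborel. (t, x, v) \<in> V \<longrightarrow>
           \<epsilon>\<^sup>2 * wt (t, x, v) + w1d s (t, x, v) + v * jx (t, x, v)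
             - avg1 (\<lambda>v'. v' * jx (t, x, v')) = 0) \<and>
        (AE (t, x) in lborel. (t, x) \<in> U \<longrightarrow> avg1 (\<lambda>v. w1d s (t, x, v)) = 0))"

definition initial_data1 :: "real \<Rightarrow> real \<Rightarrow> real \<Rightarrow> state1 \<Rightarrow> init1 \<Rightarrow> bool" where
  "initial_data1 T xL xR s ic \<longleftrightarrow>
    (let U = {0<..<T} \<times> {xL<..<xR};
         V = {0<..<T} \<times> {xL<..<xR} \<times> {0<..<1};
         S = {xL<..<xR} \<times> {0<..<1}
     in has_trace U (rho1 s) {xL<..<xR} (\<lambda>x. (0, x)) (rho1_IC ic) \<and>
        has_trace V (j1d s) S (\<lambda>(x, v). (0, x, v)) (j1d_IC ic) \<and>
        has_trace V (w1d s) S (\<lambda>(x, v). (0, x, v)) (w1d_IC ic))"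

definition boundary_data1 :: "real \<Rightarrow> real \<Rightarrow> real \<Rightarrow> state1 \<Rightarrow> state1 \<Rightarrow> bool" where
  "boundary_data1 T xL xR s bc \<longleftrightarrow>
    (let U = {0<..<T} \<times> {xL<..<xR};
         V = {0<..<T} \<times> {xL<..<xR} \<times> {0<..<1};
         S = {0<..<T} \<times> {0<..<1}
     in \<forall>x\<in>{xL, xR}.
        has_trace U (rho1 s) {0<..<T} (\<lambda>t. (t, x)) (\<lambda>t. rho1 bc (t, x)) \<and>
        has_trace V (j1d s) S (\<lambda>(t, v). (t, x, v)) (\<lambda>(t, v). j1d bc (t, x, v)) \<and>
        has_trace V (w1d s) S (\<lambda>(t, v). (t, x, v)) (\<lambda>(t, v). w1d bc (t, x, v)))"

definition periodic1 :: "real \<Rightarrow> real \<Rightarrow> real \<Rightarrow> state1 \<Rightarrow> bool" where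
  "periodic1 T xL xR bc \<longleftrightarrow>
    (AE t in lborel. t \<in> {0<..<T} \<longrightarrow> rho1 bc (t, xL) = rho1 bc (t, xR)) \<and>
    (AE (t, v) in lborel. (t, v) \<in> {0<..<T} \<times> {0<..<1} \<longrightarrow>
       j1d bc (t, xL, v) = j1d bc (t, xR, v) \<and> w1d bc (t, xL, v) = w1d bc (t, xR, v))"

definition exact_solution1 ::
  "real \<Rightarrow> real \<Rightarrow> real \<Rightarrow> real \<Rightarrow> state1 \<Rightarrow> init1 \<Rightarrow> state1 \<Rightarrow> bool" where
  "exact_solution1 T xL xR \<epsilon> s ic bc \<longleftrightarrow>
     solves1 T xL xR \<epsilon> s \<and> initial_data1 T xL xR s ic \<and>
     boundary_data1 T xL xR s bc \<and> periodic1 T xL xR bc"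

definition network1 :: "state1 \<Rightarrow> bool" where
  "network1 N \<longleftrightarrow> smooth (rho1 N) \<and> smooth (j1d N) \<and> smooth (w1d N)"

definition f1 :: "real \<Rightarrow> state1 \<Rightarrow> real \<times> real \<times> real \<Rightarrow> real" where
  "f1 \<epsilon> s = (\<lambda>(t, x, v). rho1 s (t, x) + \<epsilon> * j1d s (t, x, v) + \<epsilon>\<^sup>2 * w1d s (t, x, v))"

definition res1_1 :: "state1 \<Rightarrow> real \<Rightarrow> real \<Rightarrow> real" where
  "res1_1 N t x = pd (1, 0) (rho1 N) (t, x) + avg1 (\<lambda>v. v * pd (0, 1, 0) (j1d N) (t, x, v))"

definition res1_2 :: "real \<Rightarrow> state1 \<Rightarrow> real \<Rightarrow> real \<Rightarrow> real \<Rightarrow> real" where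
  "res1_2 \<epsilon> N t x v =
     \<epsilon>\<^sup>2 * pd (1, 0, 0) (j1d N) (t, x, v) + v * pd (0, 1) (rho1 N) (t, x)
     + \<epsilon>\<^sup>2 * v * pd (0, 1, 0) (w1d N) (t, x, v) + j1d N (t, x, v)"

definition res1_3 :: "real \<Rightarrow> state1 \<Rightarrow> real \<Rightarrow> real \<Rightarrow> real \<Rightarrow> real" where
  "res1_3 \<epsilon> N t x v =
     \<epsilon>\<^sup>2 * pd (1, 0, 0) (w1d N) (t, x, v) + w1d N (t, x, v)
     + v * pd (0, 1, 0) (j1d N) (t, x, v) - avg1 (\<lambda>v'. v' * pd (0, 1, 0) (j1d N) (t, x, v'))"

definition R_residual1 :: "real \<Rightarrow> real \<Rightarrow> real \<Rightarrow> real \<Rightarrow> state1 \<Rightarrow> real" where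
  "R_residual1 T xL xR \<epsilon> N =
     1 / measure lborel ({0<..<T} \<times> {xL<..<xR}) *
       (LINT t:{0<..<T}|lborel. LINT x:{xL<..<xR}|lborel. (res1_1 N t x)\<^sup>2)
   + 1 / measure lborel ({0<..<T} \<times> {xL<..<xR} \<times> {0..1::real}) *
       (LINT t:{0<..<T}|lborel. LINT x:{xL<..<xR}|lborel. LINT v:{0..1}|lborel.
          (res1_2 \<epsilon> N t x v)\<^sup>2 + (res1_3 \<epsilon> N t x v)\<^sup>2)"

definition R_initial1 ::
  "real \<Rightarrow> real \<Rightarrow> real \<Rightarrow> real \<Rightarrow> real \<Rightarrow> init1 \<Rightarrow> state1 \<Rightarrow> real" where
  "R_initial1 xL xR lam1 lam2 \<epsilon> ic N =
     lam1 / measure lborel {xL<..<xR} *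
       (LINT x:{xL<..<xR}|lborel. (rho1 N (0, x) - rho1_IC ic x)\<^sup>2)
   + lam2 / measure lborel ({xL<..<xR} \<times> {0..1::real}) *
       (LINT x:{xL<..<xR}|lborel. LINT v:{0..1}|lborel.
          \<epsilon>^2 * (j1d N (0, x, v) - j1d_IC ic (x, v))\<^sup>2
        + \<epsilon>^4 * (w1d N (0, x, v) - w1d_IC ic (x, v))\<^sup>2)"

text \<open>\<open>\<partial>D = {xL, xR}\<close> carries counting measure, so \<open>|T \<times> \<partial>D| = 2 |T|\<close>.\<close>

definition R_boundary1 ::
  "real \<Rightarrow> real \<Rightarrow> real \<Rightarrow> real \<Rightarrow> real \<Rightarrow> state1 \<Rightarrow> state1 \<Rightarrow> real" where
  "R_boundary1 T xL xR lam3 lam4 bc N =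
     lam3 / (measure lborel {0<..<T} * card {xL, xR}) *
       (LINT t:{0<..<T}|lborel. \<Sum>x\<in>{xL, xR}. (rho1 N (t, x) - rho1 bc (t, x))\<^sup>2)
   + lam4 / (measure lborel {0<..<T} * card {xL, xR} * measure lborel {0..1::real}) *
       (LINT t:{0<..<T}|lborel. \<Sum>x\<in>{xL, xR}. LINT v:{0..1}|lborel.
          (w1d N (t, x, v) - w1d bc (t, x, v))\<^sup>2 + (j1d N (t, x, v) - j1d bc (t, x, v))\<^sup>2)"

definition R_APNN1 ::
  "real \<Rightarrow> real \<Rightarrow> real \<Rightarrow> real \<Rightarrow> real \<Rightarrow> real \<Rightarrow> real \<Rightarrow> real
   \<Rightarrow> init1 \<Rightarrow> state1 \<Rightarrow> state1 \<Rightarrow> real" where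
  "R_APNN1 T xL xR lam1 lam2 lam3 lam4 \<epsilon> ic bc N =
     R_residual1 T xL xR \<epsilon> N + R_initial1 xL xR lam1 lam2 \<epsilon> ic N + R_boundary1 T xL xR lam3 lam4 bc N"

text \<open>
  The squared \<open>L\<^sup>2(T \<times> D \<times> \<Omega>\<^sup>+)\<close> norm. The null set \<open>v \<in> {0, 1}\<close> is left out because the components
  of an exact solution need not be measurable there.
\<close>

definition R_total1 :: "real \<Rightarrow> real \<Rightarrow> real \<Rightarrow> real \<Rightarrow> state1 \<Rightarrow> state1 \<Rightarrow> real" where
  "R_total1 T xL xR \<epsilon> s N =
     (LINT p:{0<..<T} \<times> {xL<..<xR} \<times> {0<..<1}|lborel. (f1 \<epsilon> s p - f1 \<epsilon> N p)\<^sup>2)"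


section \<open>Two space dimensions\<close>

text \<open>
  Arguments are ordered \<open>(t, (x, y))\<close> for \<open>\<rho>\<close> and \<open>(t, (x, y), (\<xi>, \<eta>))\<close> for the other components.
  The rectangle is \<open>D = (a, b) \<times> (c, d)\<close>. The open quarter circle \<open>\<Omega>\<^sup>+\<close> is parametrised by arc length,
  \<open>\<alpha> \<mapsto> (cos \<alpha>, sin \<alpha>)\<close> for \<open>0 < \<alpha> < \<pi>/2\<close>. Integrals over \<open>\<Omega>\<^sup>+\<close> and the space
  \<open>H\<^sup>1(T \<times> D \<times> \<Omega>\<^sup>+)\<close> are taken in this parametrisation; values off the arc play no role.
\<close>

record state2 =
  rho2 :: "real \<times> (real \<times> real) \<Rightarrow> real"
  phi2 :: "real \<times> (real \<times> real) \<times> (real \<times> real) \<Rightarrow> real"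
  j1 :: "real \<times> (real \<times> real) \<times> (real \<times> real) \<Rightarrow> real"
  j2 :: "real \<times> (real \<times> real) \<times> (real \<times> real) \<Rightarrow> real"
  w2d :: "real \<times> (real \<times> real) \<times> (real \<times> real) \<Rightarrow> real"

record init2 =
  rho2_IC :: "real \<times> real \<Rightarrow> real"
  phi2_IC :: "(real \<times> real) \<times> (real \<times> real) \<Rightarrow> real"
  j1_IC :: "(real \<times> real) \<times> (real \<times> real) \<Rightarrow> real"
  j2_IC :: "(real \<times> real) \<times> (real \<times> real) \<Rightarrow> real"
  w2d_IC :: "(real \<times> real) \<times> (real \<times> real) \<Rightarrow> real"

definition jplus :: "state2 \<Rightarrow> real \<times> (real \<times> real) \<times> (real \<times> real) \<Rightarrow> real" where
  "jplus s = (\<lambda>p. j1 s p + j2 s p)"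

definition jminus :: "state2 \<Rightarrow> real \<times> (real \<times> real) \<times> (real \<times> real) \<Rightarrow> real" where
  "jminus s = (\<lambda>p. j2 s p - j1 s p)"

definition arc :: "real \<Rightarrow> real \<times> real" where
  "arc \<alpha> = (cos \<alpha>, sin \<alpha>)"

definition arc_integral :: "(real \<times> real \<Rightarrow> real) \<Rightarrow> real" where
  "arc_integral g = (LINT \<alpha>:{0<..<pi/2}|lborel. g (arc \<alpha>))"

definition avg2 :: "(real \<times> real \<Rightarrow> real) \<Rightarrow> real" where
  "avg2 g = 2 / pi * arc_integral g"

definition on_arc ::
  "(real \<times> (real \<times> real) \<times> (real \<times> real) \<Rightarrow> real) \<Rightarrow> real \<times> (real \<times> real) \<times> real \<Rightarrow> real" where
  "on_arc u = (\<lambda>(t, x, \<alpha>). u (t, x, arc \<alpha>))"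

definition rect :: "real \<Rightarrow> real \<Rightarrow> real \<Rightarrow> real \<Rightarrow> (real \<times> real) set" where
  "rect a b c d = {a<..<b} \<times> {c<..<d}"

definition rect_boundary_integral ::
  "real \<Rightarrow> real \<Rightarrow> real \<Rightarrow> real \<Rightarrow> (real \<times> real \<Rightarrow> real) \<Rightarrow> real" where
  "rect_boundary_integral a b c d g =
     (\<Sum>y\<in>{c, d}. LINT x:{a<..<b}|lborel. g (x, y)) + (\<Sum>x\<in>{a, b}. LINT y:{c<..<d}|lborel. g (x, y))"

definition solves2 :: "real \<Rightarrow> real \<Rightarrow> real \<Rightarrow> real \<Rightarrow> real \<Rightarrow> real \<Rightarrow> state2 \<Rightarrow> bool" where
  "solves2 T a b c d \<epsilon> s \<longleftrightarrow>
    (let U = {0<..<T} \<times> rect a b c d;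
         V = {0<..<T} \<times> rect a b c d \<times> {0<..<pi/2};
         \<rho>t = weak_pd U (1, (0, 0)) (rho2 s);
         \<rho>x = weak_pd U (0, (1, 0)) (rho2 s);
         \<rho>y = weak_pd U (0, (0, 1)) (rho2 s);
         Dt = (\<lambda>u. weak_pd V (1, (0, 0), 0) (on_arc u));
         Dx = (\<lambda>u. weak_pd V (0, (1, 0), 0) (on_arc u));
         Dy = (\<lambda>u. weak_pd V (0, (0, 1), 0) (on_arc u));
         A = (\<lambda>(t, x, \<alpha>). cos \<alpha> * Dx (jplus s) (t, x, \<alpha>) + sin \<alpha> * Dy (jminus s) (t, x, \<alpha>));
         avgA = (\<lambda>(t, x). 2 / pi * (LINT \<alpha>:{0<..<pi/2}|lborel. A (t, x, \<alpha>)))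
     in H1 U (rho2 s) \<and> H1 V (on_arc (phi2 s)) \<and> H1 V (on_arc (j1 s)) \<and>
        H1 V (on_arc (j2 s)) \<and> H1 V (on_arc (w2d s)) \<and>
        (AE (t, x) in lborel. (t, x) \<in> U \<longrightarrow> 2 * \<rho>t (t, x) + avgA (t, x) = 0) \<and>
        (AE (t, x, \<alpha>) in lborel. (t, x, \<alpha>) \<in> V \<longrightarrow>
           2 * \<epsilon>\<^sup>2 * Dt (w2d s) (t, x, \<alpha>) + A (t, x, \<alpha>) - avgA (t, x)
             + 2 * w2d s (t, x, arc \<alpha>) = 0) \<and>
        (AE (t, x, \<alpha>) in lborel. (t, x, \<alpha>) \<in> V \<longrightarrow>
           \<epsilon>\<^sup>2 * Dt (phi2 s) (t, x, \<alpha>) + \<epsilon>\<^sup>2 * cos \<alpha> * Dx (jminus s) (t, x, \<alpha>)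
             + \<epsilon>\<^sup>2 * sin \<alpha> * Dy (jplus s) (t, x, \<alpha>) + phi2 s (t, x, arc \<alpha>) = 0) \<and>
        (AE (t, x, \<alpha>) in lborel. (t, x, \<alpha>) \<in> V \<longrightarrow>
           \<epsilon>\<^sup>2 * Dt (jplus s) (t, x, \<alpha>) + jplus s (t, x, arc \<alpha>)
             + 2 * cos \<alpha> * (\<rho>x (t, x) + \<epsilon>\<^sup>2 * Dx (w2d s) (t, x, \<alpha>))
             + sin \<alpha> * Dy (phi2 s) (t, x, \<alpha>) = 0) \<and>
        (AE (t, x, \<alpha>) in lborel. (t, x, \<alpha>) \<in> V \<longrightarrow>
           \<epsilon>\<^sup>2 * Dt (jminus s) (t, x, \<alpha>) + jminus s (t, x, arc \<alpha>)
             + cos \<alpha> * Dx (phi2 s) (t, x, \<alpha>)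
             + 2 * sin \<alpha> * (\<rho>y (t, x) + \<epsilon>\<^sup>2 * Dy (w2d s) (t, x, \<alpha>)) = 0) \<and>
        (AE (t, x) in lborel. (t, x) \<in> U \<longrightarrow> avg2 (\<lambda>v. w2d s (t, x, v)) = 0))"

definition initial_data2 ::
  "real \<Rightarrow> real \<Rightarrow> real \<Rightarrow> real \<Rightarrow> real \<Rightarrow> state2 \<Rightarrow> init2 \<Rightarrow> bool" where
  "initial_data2 T a b c d s ic \<longleftrightarrow>
    (let U = {0<..<T} \<times> rect a b c d;
         V = {0<..<T} \<times> rect a b c d \<times> {0<..<pi/2};
         tr = (\<lambda>u g. has_trace V (on_arc u) (rect a b c d \<times> {0<..<pi/2})
                       (\<lambda>(x, \<alpha>). (0, x, \<alpha>)) (\<lambda>(x, \<alpha>). g (x, arc \<alpha>)))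
     in has_trace U (rho2 s) (rect a b c d) (\<lambda>x. (0, x)) (rho2_IC ic) \<and>
        tr (phi2 s) (phi2_IC ic) \<and> tr (j1 s) (j1_IC ic) \<and>
        tr (j2 s) (j2_IC ic) \<and> tr (w2d s) (w2d_IC ic))"

text \<open>
  Traces on the lateral boundary are taken side by side: the vertical sides \<open>x \<in> {a, b}\<close> and the
  horizontal sides \<open>y \<in> {c, d}\<close>.
\<close>

definition boundary_data2 ::
  "real \<Rightarrow> real \<Rightarrow> real \<Rightarrow> real \<Rightarrow> real \<Rightarrow> state2 \<Rightarrow> state2 \<Rightarrow> bool" where
  "boundary_data2 T a b c d s bc \<longleftrightarrow>
    (let U = {0<..<T} \<times> rect a b c d;
         V = {0<..<T} \<times> rect a b c d \<times> {0<..<pi/2};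
         trU = (\<lambda>u g.
           (\<forall>x\<in>{a, b}. has_trace U u ({0<..<T} \<times> {c<..<d})
              (\<lambda>(t, y). (t, (x, y))) (\<lambda>(t, y). g (t, (x, y)))) \<and>
           (\<forall>y\<in>{c, d}. has_trace U u ({0<..<T} \<times> {a<..<b})
              (\<lambda>(t, x). (t, (x, y))) (\<lambda>(t, x). g (t, (x, y)))));
         trV = (\<lambda>u g.
           (\<forall>x\<in>{a, b}. has_trace V (on_arc u) ({0<..<T} \<times> {c<..<d} \<times> {0<..<pi/2})
              (\<lambda>(t, y, \<alpha>). (t, (x, y), \<alpha>)) (\<lambda>(t, y, \<alpha>). g (t, (x, y), arc \<alpha>))) \<and>
           (\<forall>y\<in>{c, d}. has_trace V (on_arc u) ({0<..<T} \<times> {a<..<b} \<times> {0<..<pi/2})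
              (\<lambda>(t, x, \<alpha>). (t, (x, y), \<alpha>)) (\<lambda>(t, x, \<alpha>). g (t, (x, y), arc \<alpha>))))
     in trU (rho2 s) (rho2 bc) \<and> trV (phi2 s) (phi2 bc) \<and>
        trV (j1 s) (j1 bc) \<and> trV (j2 s) (j2 bc) \<and> trV (w2d s) (w2d bc))"

definition periodic2 :: "real \<Rightarrow> real \<Rightarrow> real \<Rightarrow> real \<Rightarrow> real \<Rightarrow> state2 \<Rightarrow> bool" where
  "periodic2 T a b c d bc \<longleftrightarrow>
    (AE (t, y) in lborel. (t, y) \<in> {0<..<T} \<times> {c<..<d} \<longrightarrow>
       rho2 bc (t, (a, y)) = rho2 bc (t, (b, y))) \<and>
    (AE (t, x) in lborel. (t, x) \<in> {0<..<T} \<times> {a<..<b} \<longrightarrow>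
       rho2 bc (t, (x, c)) = rho2 bc (t, (x, d))) \<and>
    (\<forall>u\<in>{phi2 bc, j1 bc, j2 bc, w2d bc}.
       (AE (t, y, \<alpha>) in lborel. (t, y, \<alpha>) \<in> {0<..<T} \<times> {c<..<d} \<times> {0<..<pi/2} \<longrightarrow>
          u (t, (a, y), arc \<alpha>) = u (t, (b, y), arc \<alpha>)) \<and>
       (AE (t, x, \<alpha>) in lborel. (t, x, \<alpha>) \<in> {0<..<T} \<times> {a<..<b} \<times> {0<..<pi/2} \<longrightarrow>
          u (t, (x, c), arc \<alpha>) = u (t, (x, d), arc \<alpha>)))"

definition exact_solution2 ::
  "real \<Rightarrow> real \<Rightarrow> real \<Rightarrow> real \<Rightarrow> real \<Rightarrow> real \<Rightarrow> state2 \<Rightarrow> init2 \<Rightarrow> state2 \<Rightarrow> bool" where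
  "exact_solution2 T a b c d \<epsilon> s ic bc \<longleftrightarrow>
     solves2 T a b c d \<epsilon> s \<and> initial_data2 T a b c d s ic \<and>
     boundary_data2 T a b c d s bc \<and> periodic2 T a b c d bc"

definition network2 :: "state2 \<Rightarrow> bool" where
  "network2 N \<longleftrightarrow> smooth (rho2 N) \<and> smooth (phi2 N) \<and> smooth (j1 N) \<and> smooth (j2 N) \<and> smooth (w2d N)"

definition f2 :: "real \<Rightarrow> state2 \<Rightarrow> real \<times> (real \<times> real) \<times> (real \<times> real) \<Rightarrow> real" where
  "f2 \<epsilon> s = (\<lambda>(t, x, v). rho2 s (t, x) + phi2 s (t, x, v) / 2
     + \<epsilon> * ((j2 s (t, x, v) + j1 s (t, x, v)) / 2 + (j2 s (t, x, v) - j1 s (t, x, v)) / 2)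
     + \<epsilon>\<^sup>2 * w2d s (t, x, v))"

abbreviation dt2 :: "(real \<times> (real \<times> real) \<times> (real \<times> real) \<Rightarrow> real) \<Rightarrow> _" where
  "dt2 \<equiv> pd (1, (0, 0), (0, 0))"
abbreviation dx2 :: "(real \<times> (real \<times> real) \<times> (real \<times> real) \<Rightarrow> real) \<Rightarrow> _" where
  "dx2 \<equiv> pd (0, (1, 0), (0, 0))"
abbreviation dy2 :: "(real \<times> (real \<times> real) \<times> (real \<times> real) \<Rightarrow> real) \<Rightarrow> _" where
  "dy2 \<equiv> pd (0, (0, 1), (0, 0))"

definition A2 :: "state2 \<Rightarrow> real \<Rightarrow> real \<times> real \<Rightarrow> real \<times> real \<Rightarrow> real" where
  "A2 N t x v = fst v * dx2 (jplus N) (t, x, v) + snd v * dy2 (jminus N) (t, x, v)"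

definition res2_1 :: "state2 \<Rightarrow> real \<Rightarrow> real \<times> real \<Rightarrow> real" where
  "res2_1 N t x = 2 * pd (1, (0, 0)) (rho2 N) (t, x) + avg2 (A2 N t x)"

definition res2_2 :: "real \<Rightarrow> state2 \<Rightarrow> real \<Rightarrow> real \<times> real \<Rightarrow> real \<times> real \<Rightarrow> real" where
  "res2_2 \<epsilon> N t x v =
     2 * \<epsilon>\<^sup>2 * dt2 (w2d N) (t, x, v) + A2 N t x v - avg2 (A2 N t x) + 2 * w2d N (t, x, v)"

definition res2_3 :: "real \<Rightarrow> state2 \<Rightarrow> real \<Rightarrow> real \<times> real \<Rightarrow> real \<times> real \<Rightarrow> real" where
  "res2_3 \<epsilon> N t x v =
     dt2 (phi2 N) (t, x, v) + fst v * dx2 (jminus N) (t, x, v)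
     + snd v * dy2 (jplus N) (t, x, v) + 1 / \<epsilon>\<^sup>2 * phi2 N (t, x, v)"

definition res2_4 :: "real \<Rightarrow> state2 \<Rightarrow> real \<Rightarrow> real \<times> real \<Rightarrow> real \<times> real \<Rightarrow> real" where
  "res2_4 \<epsilon> N t x v =
     \<epsilon>\<^sup>2 * dt2 (jplus N) (t, x, v) + jplus N (t, x, v)
     + 2 * fst v * (pd (0, (1, 0)) (rho2 N) (t, x) + \<epsilon>\<^sup>2 * dx2 (w2d N) (t, x, v))
     + snd v * dy2 (phi2 N) (t, x, v)"

definition res2_5 :: "real \<Rightarrow> state2 \<Rightarrow> real \<Rightarrow> real \<times> real \<Rightarrow> real \<times> real \<Rightarrow> real" where
  "res2_5 \<epsilon> N t x v =
     \<epsilon>\<^sup>2 * dt2 (jminus N) (t, x, v) + jminus N (t, x, v)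
     + fst v * dx2 (phi2 N) (t, x, v)
     + 2 * snd v * (pd (0, (0, 1)) (rho2 N) (t, x) + \<epsilon>\<^sup>2 * dy2 (w2d N) (t, x, v))"

text \<open>The arc length of \<open>\<Omega>\<^sup>+\<close> is \<open>pi / 2\<close>, and the perimeter of \<open>D\<close> is \<open>2 (b - a) + 2 (d - c)\<close>.\<close>

definition R_residual2 ::
  "real \<Rightarrow> real \<Rightarrow> real \<Rightarrow> real \<Rightarrow> real \<Rightarrow> real \<Rightarrow> state2 \<Rightarrow> real" where
  "R_residual2 T a b c d \<epsilon> N =
     1 / measure lborel ({0<..<T} \<times> rect a b c d) *
       (LINT t:{0<..<T}|lborel. LINT x:rect a b c d|lborel. (res2_1 N t x)\<^sup>2)
   + 1 / (measure lborel ({0<..<T} \<times> rect a b c d) * (pi / 2)) *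
       (\<Sum>r\<leftarrow>[res2_2, res2_3, res2_4, res2_5].
          LINT t:{0<..<T}|lborel. LINT x:rect a b c d|lborel. arc_integral (\<lambda>v. (r \<epsilon> N t x v)\<^sup>2))"

definition R_initial2 ::
  "real \<Rightarrow> real \<Rightarrow> real \<Rightarrow> real \<Rightarrow> real \<Rightarrow> real \<Rightarrow> real \<Rightarrow> init2 \<Rightarrow> state2 \<Rightarrow> real" where
  "R_initial2 a b c d lam1 lam2 \<epsilon> ic N =
     lam1 / measure lborel (rect a b c d) *
       (LINT x:rect a b c d|lborel. (rho2 N (0, x) - rho2_IC ic x)\<^sup>2)
   + lam2 / (measure lborel (rect a b c d) * (pi / 2)) *
       (LINT x:rect a b c d|lborel. arc_integral (\<lambda>v.
          \<epsilon>^4 * (w2d N (0, x, v) - w2d_IC ic (x, v))\<^sup>2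
        + (phi2 N (0, x, v) - phi2_IC ic (x, v))\<^sup>2
        + \<epsilon>^2 * ((j1 N (0, x, v) + j2 N (0, x, v)) - (j1_IC ic (x, v) + j2_IC ic (x, v)))\<^sup>2
        + \<epsilon>^2 * ((j2 N (0, x, v) - j1 N (0, x, v)) - (j2_IC ic (x, v) - j1_IC ic (x, v)))\<^sup>2))"

definition R_boundary2 ::
  "real \<Rightarrow> real \<Rightarrow> real \<Rightarrow> real \<Rightarrow> real \<Rightarrow> real \<Rightarrow> real \<Rightarrow> state2 \<Rightarrow> state2 \<Rightarrow> real" where
  "R_boundary2 T a b c d lam3 lam4 bc N =
     lam3 / (measure lborel {0<..<T} * (2 * (b - a) + 2 * (d - c))) *
       (LINT t:{0<..<T}|lborel. rect_boundary_integral a b c d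
          (\<lambda>x. (rho2 N (t, x) - rho2 bc (t, x))\<^sup>2))
   + lam4 / (measure lborel {0<..<T} * (2 * (b - a) + 2 * (d - c)) * (pi / 2)) *
       (LINT t:{0<..<T}|lborel. rect_boundary_integral a b c d (\<lambda>x. arc_integral (\<lambda>v.
          (w2d N (t, x, v) - w2d bc (t, x, v))\<^sup>2
        + (phi2 N (t, x, v) - phi2 bc (t, x, v))\<^sup>2
        + (jplus N (t, x, v) - jplus bc (t, x, v))\<^sup>2
        + (jminus N (t, x, v) - jminus bc (t, x, v))\<^sup>2)))"

definition R_APNN2 ::
  "real \<Rightarrow> real \<Rightarrow> real \<Rightarrow> real \<Rightarrow> real \<Rightarrow> real \<Rightarrow> real \<Rightarrow> real \<Rightarrow> real \<Rightarrow> real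
   \<Rightarrow> init2 \<Rightarrow> state2 \<Rightarrow> state2 \<Rightarrow> real" where
  "R_APNN2 T a b c d lam1 lam2 lam3 lam4 \<epsilon> ic bc N =
     R_residual2 T a b c d \<epsilon> N + R_initial2 a b c d lam1 lam2 \<epsilon> ic N
     + R_boundary2 T a b c d lam3 lam4 bc N"

definition R_total2 ::
  "real \<Rightarrow> real \<Rightarrow> real \<Rightarrow> real \<Rightarrow> real \<Rightarrow> real \<Rightarrow> state2 \<Rightarrow> state2 \<Rightarrow> real" where
  "R_total2 T a b c d \<epsilon> s N =
     (LINT (t, x, \<alpha>):{0<..<T} \<times> rect a b c d \<times> {0<..<pi/2}|lborel.
        (f2 \<epsilon> s (t, x, arc \<alpha>) - f2 \<epsilon> N (t, x, arc \<alpha>))\<^sup>2)"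

end

theory Submission
  imports Defs "HOL-Computational_Algebra.Polynomial"
begin

text \<open>
  The errors of the network satisfy the parity system with the residuals as right-hand sides. In
  terms of \<open>r = \<rho> + \<epsilon>\<^sup>2 w\<close> this is a symmetric hyperbolic system with relaxation, and testing it with
  the errors themselves bounds \<open>\<parallel>f - f\<^sub>\<theta>\<parallel>\<^sup>2\<close> by the residuals, the initial errors and the boundary
  terms of Green's formula, all of which are controlled quadratically by the loss. The only term
  without a sign is the product of \<open>r\<close> with the velocity average \<open>W\<close> of the error in \<open>w\<close>. It obeys
  \<open>\<epsilon>\<^sup>2 \<partial>\<^sub>t W + W = \<langle>residual\<rangle>\<close>, but its initial value is only of size \<open>\<epsilon>\<^sup>-\<^sup>2\<close> times the square root of
  the loss, so that \<open>W\<close> is uniformly small in \<open>L\<^sup>1\<close> but not in \<open>L\<^sup>2\<close> in time. A time weight of bounded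
  mass that is large in the initial layer \<open>t \<lesssim> \<epsilon>\<^sup>2\<close> absorbs it. The resulting bound is even linear in
  the loss, which is stronger than the power \<open>2/3\<close> for small values of the loss.
\<close>

section \<open>Lebesgue measure on subdomains\<close>

text \<open>The fluctuation \<open>w - W\<close> is orthogonal to functions independent of velocity,
  so against \<rho> + \<epsilon>^2 W + \<epsilon>^2 (w - W) it leaves a nonnegative square; this is
  why only \<open>W\<close> is dangerous. Let \<psi> be the time weight and k = -\<psi>'. The energy
  identity produces k r^2, and Young's inequality splits \<psi> r W into a share of it and a
  multiple of (\<psi>^2/k) W^2. Testing the equation of \<open>W\<close> with (\<psi>/k) W bounds
  this by (\<psi>(0)/k(0)) \<epsilon>^2 W(0)^2 up to residuals, and k(0) \<ge> 1/\<epsilon>^2 makes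
  it \<epsilon>^4 W(0)^2, the power that the initial loss controls. The technical obstacle is that
  each face comes with its own approximating sequence and that no trace is given at the final time.
  Green's formula is therefore stated with a weight that vanishes on the opposite face: the time
  weight vanishes at T, and in space 1 is written as a sum of two affine weights. One estimate
  serves both settings: doubling the one-dimensional equations gives the two-dimensional form with
  \<phi> = 0, j2 - j1 = 0 and 2 j in place of j1 + j2.\<close>

abbreviation lb :: "'a::euclidean_space set \<Rightarrow> 'a measure" where
  "lb A \<equiv> restrict_space lborel A"

lemma sets_lb_prod:
  assumes "A \<in> sets borel" "B \<in> sets borel"
  shows "sets (lb A \<Otimes>\<^sub>M lb B) = sets (lb (A \<times> B))"
proof -
  have AB: "A \<times> B \<in> sets (borel :: ('a \<times> 'b) measure)"
    using assms by (simp add: borel_prod[symmetric])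
  show ?thesis
  proof
    show "sets (lb A \<Otimes>\<^sub>M lb B) \<subseteq> sets (lb (A \<times> B))"
      unfolding sets_pair_measure
    proof (rule sets.sigma_sets_subset')
      show "{a \<times> b |a b. a \<in> sets (lb A) \<and> b \<in> sets (lb B)} \<subseteq> sets (lb (A \<times> B))"
        using assms AB by (auto simp: sets_restrict_space_iff borel_prod[symmetric])
      show "space (lb A) \<times> space (lb B) \<in> sets (lb (A \<times> B))"
        using assms AB by (auto simp: sets_restrict_space_iff)
    qed
    show "sets (lb (A \<times> B)) \<subseteq> sets (lb A \<Otimes>\<^sub>M lb B)"
    proof
      fix S assume "S \<in> sets (lb (A \<times> B))"
      then have S: "S \<in> sets borel" "S \<subseteq> A \<times> B"
        using AB by (auto simp: sets_restrict_space_iff)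
      have "fst \<in> (lb A \<Otimes>\<^sub>M lb B) \<rightarrow>\<^sub>M borel" "snd \<in> (lb A \<Otimes>\<^sub>M lb B) \<rightarrow>\<^sub>M borel"
        by (auto intro!: measurable_compose[OF measurable_fst] measurable_compose[OF measurable_snd]
              measurable_restrict_space1)
      then have "(\<lambda>x. (fst x, snd x)) \<in> (lb A \<Otimes>\<^sub>M lb B) \<rightarrow>\<^sub>M borel"
        unfolding borel_prod[symmetric] by measurable
      then have "(\<lambda>x. (fst x, snd x)) -` S \<inter> space (lb A \<Otimes>\<^sub>M lb B) \<in> sets (lb A \<Otimes>\<^sub>M lb B)"
        using S(1) by (rule measurable_sets)
      moreover have "(\<lambda>x. (fst x, snd x)) -` S \<inter> space (lb A \<Otimes>\<^sub>M lb B) = S"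
        using S(2) assms by (auto simp: space_pair_measure)
      ultimately show "S \<in> sets (lb A \<Otimes>\<^sub>M lb B)" by simp
    qed
  qed
qed

lemma sigma_finite_lb: "A \<in> sets borel \<Longrightarrow> sigma_finite_measure (lb A)"
  by (intro sigma_finite_measure_restrict_space sigma_finite_lborel) simp

text \<open>Product measures of sigma-finite factors are determined by rectangles. This makes
  Fubini's theorem available on subdomains without carrying indicator functions along.\<close>

lemma lb_prod:
  assumes "A \<in> sets borel" "B \<in> sets borel"
  shows "lb A \<Otimes>\<^sub>M lb B = lb (A \<times> B)"
proof (rule pair_measure_eqI)
  have AB: "A \<times> B \<in> sets (borel :: ('a \<times> 'b) measure)"
    using assms by (simp add: borel_prod[symmetric])
  fix a b assume "a \<in> sets (lb A)" "b \<in> sets (lb B)"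
  then have ab: "a \<in> sets borel" "a \<subseteq> A" "b \<in> sets borel" "b \<subseteq> B"
    using assms by (auto simp: sets_restrict_space_iff)
  have "emeasure (lb (A \<times> B)) (a \<times> b) = emeasure (lborel \<Otimes>\<^sub>M lborel) (a \<times> b)"
    using ab AB by (subst emeasure_restrict_space) (auto simp: lborel_prod)
  also have "\<dots> = emeasure lborel a * emeasure lborel b"
    using ab by (intro lborel.emeasure_pair_measure_Times) auto
  finally show "emeasure (lb A) a * emeasure (lb B) b = emeasure (lb (A \<times> B)) (a \<times> b)"
    using ab assms by (simp add: emeasure_restrict_space)
qed (use assms in \<open>simp_all add: sigma_finite_lb sets_lb_prod\<close>)

lemma finite_measure_lb: "bounded A \<Longrightarrow> A \<in> sets borel \<Longrightarrow> finite_measure (lb A)"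
  using emeasure_bounded_finite[of A]
  by (intro finite_measureI) (simp add: emeasure_restrict_space less_top[symmetric])

lemma set_integral_lb: "A \<in> sets borel \<Longrightarrow> (LINT x:A|lborel. f x) = integral\<^sup>L (lb A) f"
  for f :: "_ \<Rightarrow> real"
  by (simp add: set_lebesgue_integral_def integral_restrict_space)

lemma continuous_on_UNIV_borel_lb:
  "continuous_on UNIV f \<Longrightarrow> f \<in> borel_measurable (lb A)"
  for f :: "_ \<Rightarrow> _::euclidean_space"
  by (intro measurable_restrict_space1) (auto intro: borel_measurable_continuous_onI)

text \<open>Continuity is required on the whole space, so the compact closure of \<open>A\<close>
  can be used although \<open>A\<close> itself is open in the applications.\<close>

lemma continuous_bounded_on:
  fixes f :: "'a::euclidean_space \<Rightarrow> real"
  assumes "continuous_on UNIV f" "bounded A"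
  obtains K where "K \<ge> 0" "\<And>x. x \<in> A \<Longrightarrow> \<bar>f x\<bar> \<le> K"
proof -
  have "compact (f ` closure A)"
    using assms by (intro compact_continuous_image) (auto intro: continuous_on_subset)
  then have "bounded (f ` closure A)" by (rule compact_imp_bounded)
  then obtain K where "\<And>x. x \<in> closure A \<Longrightarrow> norm (f x) \<le> K"
    unfolding bounded_iff by auto
  then show ?thesis
    using that[of "max K 0"] closure_subset[of A] by (fastforce simp: le_max_iff_disj)
qed

lemma integrable_continuous_lb:
  fixes f :: "'a::euclidean_space \<Rightarrow> real"
  assumes "continuous_on UNIV f" "bounded A" "A \<in> sets borel"
  shows "integrable (lb A) f"
proof -
  obtain K where K: "\<And>x. x \<in> A \<Longrightarrow> \<bar>f x\<bar> \<le> K"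
    using continuous_bounded_on[OF assms(1,2)] by blast
  show ?thesis
    using assms K
    by (intro finite_measure.integrable_const_bound[where B=K] finite_measure_lb continuous_on_UNIV_borel_lb
        AE_I2) auto
qed

section \<open>Square integrable functions\<close>

text \<open>Counterpart of \<open>L2\<close> for an arbitrary measure. Measurability is a separate
  clause because it does not follow from measurability of the square.\<close>

definition sqint :: "'a measure \<Rightarrow> ('a \<Rightarrow> real) \<Rightarrow> bool" where
  "sqint M f \<longleftrightarrow> f \<in> borel_measurable M \<and> integrable M (\<lambda>x. (f x)\<^sup>2)"

lemma sqint_measurable: "sqint M f \<Longrightarrow> f \<in> borel_measurable M"
  by (simp add: sqint_def)

lemma sqint_integrable_sq: "sqint M f \<Longrightarrow> integrable M (\<lambda>x. (f x)\<^sup>2)"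
  by (simp add: sqint_def)

lemma sqint_mult_integrable:
  assumes "sqint M f" "sqint M g"
  shows "integrable M (\<lambda>x. f x * g x)"
proof (rule Bochner_Integration.integrable_bound)
  show "integrable M (\<lambda>x. (f x)\<^sup>2 + (g x)\<^sup>2)"
    using assms by (auto simp: sqint_def)
  show "(\<lambda>x. f x * g x) \<in> borel_measurable M"
    using assms by (auto simp: sqint_def)
  have "\<bar>f x * g x\<bar> \<le> (f x)\<^sup>2 + (g x)\<^sup>2" for x
  proof -
    have "2 * (\<bar>f x\<bar> * \<bar>g x\<bar>) \<le> \<bar>f x\<bar>\<^sup>2 + \<bar>g x\<bar>\<^sup>2"
      using sum_squares_bound[of "\<bar>f x\<bar>" "\<bar>g x\<bar>"] by simp
    moreover have "0 \<le> \<bar>f x\<bar> * \<bar>g x\<bar>" by simp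
    ultimately show ?thesis unfolding abs_mult power2_abs by linarith
  qed
  then show "AE x in M. norm (f x * g x) \<le> norm ((f x)\<^sup>2 + (g x)\<^sup>2)" by simp
qed

lemma sqint_add:
  assumes "sqint M f" "sqint M g"
  shows "sqint M (\<lambda>x. f x + g x)"
proof -
  have "integrable M (\<lambda>x. (f x)\<^sup>2 + (g x)\<^sup>2 + 2 * (f x * g x))"
    using assms sqint_mult_integrable[OF assms] by (simp add: sqint_def)
  moreover have "(\<lambda>x. f x + g x) \<in> borel_measurable M"
    using assms by (intro borel_measurable_add sqint_measurable)
  ultimately show ?thesis by (simp add: sqint_def power2_sum mult.assoc)
qed

lemma sqint_cmult: "sqint M f \<Longrightarrow> sqint M (\<lambda>x. c * f x)"
  by (auto simp: sqint_def power_mult_distrib)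

lemma sqint_diff: "sqint M f \<Longrightarrow> sqint M g \<Longrightarrow> sqint M (\<lambda>x. f x - g x)"
  using sqint_add[of M f "\<lambda>x. (-1) * g x"] sqint_cmult[of M g "-1"] by simp

lemma sqint_zero [simp]: "sqint M (\<lambda>x. 0)"
  by (simp add: sqint_def)

lemma sqint_bounded_mult:
  assumes "m \<in> borel_measurable M" "\<And>x. x \<in> space M \<Longrightarrow> \<bar>m x\<bar> \<le> K" "sqint M f"
  shows "sqint M (\<lambda>x. m x * f x)"
  unfolding sqint_def
proof
  show "(\<lambda>x. m x * f x) \<in> borel_measurable M" using assms by (auto simp: sqint_def)
  show "integrable M (\<lambda>x. (m x * f x)\<^sup>2)"
  proof (rule Bochner_Integration.integrable_bound)
    show "integrable M (\<lambda>x. K\<^sup>2 * (f x)\<^sup>2)" using assms by (auto simp: sqint_def)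
    show "(\<lambda>x. (m x * f x)\<^sup>2) \<in> borel_measurable M" using assms by (auto simp: sqint_def)
    show "AE x in M. norm ((m x * f x)\<^sup>2) \<le> norm (K\<^sup>2 * (f x)\<^sup>2)"
    proof (rule AE_I2)
      fix x assume "x \<in> space M"
      then have "\<bar>m x\<bar>\<^sup>2 \<le> K\<^sup>2" by (intro power_mono assms) auto
      then show "norm ((m x * f x)\<^sup>2) \<le> norm (K\<^sup>2 * (f x)\<^sup>2)"
        by (simp add: power_mult_distrib mult_right_mono abs_mult)
    qed
  qed
qed

lemma sqint_cong_AE:
  assumes "sqint M f" "g \<in> borel_measurable M" "AE x in M. f x = g x"
  shows "sqint M g"
proof -
  have "AE x in M. (f x)\<^sup>2 = (g x)\<^sup>2" using assms(3) by eventually_elim simp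
  then show ?thesis
    using assms integrable_cong_AE[of "\<lambda>x. (f x)\<^sup>2" M "\<lambda>x. (g x)\<^sup>2"] by (auto simp: sqint_def)
qed

lemma sqint_imp_integrable:
  assumes "finite_measure M" "sqint M f" shows "integrable M f"
proof -
  interpret finite_measure M by fact
  have "sqint M (\<lambda>_. 1)" by (simp add: sqint_def)
  from sqint_mult_integrable[OF assms(2) this] show ?thesis by simp
qed

lemma sqint_continuous_lb:
  fixes f :: "'a::euclidean_space \<Rightarrow> real"
  assumes "continuous_on UNIV f" "bounded A" "A \<in> sets borel"
  shows "sqint (lb A) f"
proof -
  have "continuous_on UNIV (\<lambda>x. (f x)\<^sup>2)" using assms(1) by (intro continuous_intros)
  then show ?thesis
    using assms by (simp add: sqint_def continuous_on_UNIV_borel_lb integrable_continuous_lb)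
qed

text \<open>The quadratic form s^2 a - 2 s t b + t^2 c is nonnegative for all s and t. If c is
  nonzero, s = c and t = b give the claim. If c = 0, the form is affine in t, which forces b = 0;
  the value t = (a + 1)/(2 b) would make it -1.\<close>

lemma Cauchy_Schwarz_integral:
  assumes "sqint M f" "sqint M g"
  shows "(\<integral>x. f x * g x \<partial>M)\<^sup>2 \<le> (\<integral>x. (f x)\<^sup>2 \<partial>M) * (\<integral>x. (g x)\<^sup>2 \<partial>M)"
proof -
  define a b c where "a = (\<integral>x. (f x)\<^sup>2 \<partial>M)" and "b = (\<integral>x. f x * g x \<partial>M)" and "c = (\<integral>x. (g x)\<^sup>2 \<partial>M)"
  have i: "integrable M (\<lambda>x. (f x)\<^sup>2)" "integrable M (\<lambda>x. f x * g x)" "integrable M (\<lambda>x. (g x)\<^sup>2)"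
    using assms sqint_mult_integrable by (auto simp: sqint_def)
  have quad: "0 \<le> s\<^sup>2 * a - 2 * s * t * b + t\<^sup>2 * c" for s t
  proof -
    have "0 \<le> (\<integral>x. (s * f x - t * g x)\<^sup>2 \<partial>M)" by simp
    also have "\<dots> = (\<integral>x. s\<^sup>2 * (f x)\<^sup>2 - 2 * s * t * (f x * g x) + t\<^sup>2 * (g x)\<^sup>2 \<partial>M)"
      by (intro Bochner_Integration.integral_cong) (auto simp: power2_eq_square algebra_simps)
    also have "\<dots> = s\<^sup>2 * a - 2 * s * t * b + t\<^sup>2 * c"
      using i by (simp add: a_def b_def c_def)
    finally show ?thesis .
  qed
  have "a \<ge> 0" "c \<ge> 0" by (auto simp: a_def c_def)
  have "b\<^sup>2 \<le> a * c"
  proof (cases "c = 0")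
    case False
    have "0 \<le> c\<^sup>2 * a - 2 * c * b * b + b\<^sup>2 * c" by (rule quad)
    then have "0 \<le> c * (a * c - b\<^sup>2)" by (simp add: power2_eq_square algebra_simps)
    then show ?thesis using False \<open>c \<ge> 0\<close> by (simp add: zero_le_mult_iff)
  next
    case True
    have "0 \<le> 1\<^sup>2 * a - 2 * 1 * ((a + 1) * b) * b + ((a+1)*b)\<^sup>2 * c" by (rule quad)
    then have "2 * (a + 1) * b\<^sup>2 \<le> a" using True by (simp add: power2_eq_square algebra_simps)
    moreover have "b = 0"
    proof (rule ccontr)
      assume "b \<noteq> 0"
      have "0 \<le> 1\<^sup>2 * a - 2 * 1 * ((a + 1) / (2*b)) * b + ((a+1)/(2*b))\<^sup>2 * c" by (rule quad)
      then show False using True \<open>b \<noteq> 0\<close> by simp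
    qed
    ultimately show ?thesis using True by simp
  qed
  then show ?thesis by (simp add: a_def b_def c_def)
qed

section \<open>Mean square convergence\<close>

definition L2lim :: "'a measure \<Rightarrow> (nat \<Rightarrow> 'a \<Rightarrow> real) \<Rightarrow> ('a \<Rightarrow> real) \<Rightarrow> bool" where
  "L2lim M un u \<longleftrightarrow> (\<forall>n. sqint M (un n)) \<and> sqint M u \<and> (\<lambda>n. \<integral>x. (un n x - u x)\<^sup>2 \<partial>M) \<longlonglongrightarrow> 0"

lemma L2lim_sqint: "L2lim M un u \<Longrightarrow> sqint M (un n)" "L2lim M un u \<Longrightarrow> sqint M u"
  by (auto simp: L2lim_def)

lemma L2lim_const: "sqint M u \<Longrightarrow> L2lim M (\<lambda>_. u) u"
  by (simp add: L2lim_def)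

text \<open>Common pattern for operations that are bounded in L^2: multiplication by bounded
  functions, lifting from the base and averaging over velocity.\<close>

lemma L2lim_bound:
  assumes "L2lim M un u" "\<And>n. sqint M' (vn n)" "sqint M' v"
    and "\<And>n. (\<integral>x. (vn n x - v x)\<^sup>2 \<partial>M') \<le> K * (\<integral>x. (un n x - u x)\<^sup>2 \<partial>M)"
  shows "L2lim M' vn v"
proof -
  have "(\<lambda>n. K * (\<integral>x. (un n x - u x)\<^sup>2 \<partial>M)) \<longlonglongrightarrow> K * 0"
    using assms(1) unfolding L2lim_def by (intro tendsto_mult_left) blast
  then have lim: "(\<lambda>n. K * (\<integral>x. (un n x - u x)\<^sup>2 \<partial>M)) \<longlonglongrightarrow> 0" by simp
  have "(\<lambda>n. \<integral>x. (vn n x - v x)\<^sup>2 \<partial>M') \<longlonglongrightarrow> 0"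
    by (rule tendsto_sandwich[OF _ _ tendsto_const lim]) (auto simp: assms(4))
  then show ?thesis using assms(2,3) by (simp add: L2lim_def)
qed

lemma L2lim_add:
  assumes "L2lim M un u" "L2lim M vn v"
  shows "L2lim M (\<lambda>n x. un n x + vn n x) (\<lambda>x. u x + v x)"
proof -
  note s = L2lim_sqint[OF assms(1)] L2lim_sqint[OF assms(2)]
  have "(\<lambda>n. 2 * (\<integral>x. (un n x - u x)\<^sup>2 \<partial>M) + 2 * (\<integral>x. (vn n x - v x)\<^sup>2 \<partial>M)) \<longlonglongrightarrow> 2 * 0 + 2 * 0"
    using assms by (intro tendsto_intros) (auto simp: L2lim_def)
  then have lim: "(\<lambda>n. 2 * (\<integral>x. (un n x - u x)\<^sup>2 \<partial>M) + 2 * (\<integral>x. (vn n x - v x)\<^sup>2 \<partial>M)) \<longlonglongrightarrow> 0" by simp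
  have le: "(\<integral>x. (un n x + vn n x - (u x + v x))\<^sup>2 \<partial>M)
      \<le> 2 * (\<integral>x. (un n x - u x)\<^sup>2 \<partial>M) + 2 * (\<integral>x. (vn n x - v x)\<^sup>2 \<partial>M)" for n
  proof -
    have i: "integrable M (\<lambda>x. (un n x - u x)\<^sup>2)" "integrable M (\<lambda>x. (vn n x - v x)\<^sup>2)"
      using s by (auto intro!: sqint_integrable_sq sqint_diff)
    have "(\<integral>x. (un n x + vn n x - (u x + v x))\<^sup>2 \<partial>M)
        \<le> (\<integral>x. 2 * (un n x - u x)\<^sup>2 + 2 * (vn n x - v x)\<^sup>2 \<partial>M)"
    proof (rule integral_mono)
      show "integrable M (\<lambda>x. (un n x + vn n x - (u x + v x))\<^sup>2)"
        using s by (intro sqint_integrable_sq sqint_diff sqint_add)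
      show "integrable M (\<lambda>x. 2 * (un n x - u x)\<^sup>2 + 2 * (vn n x - v x)\<^sup>2)" using i by simp
      fix x
      show "(un n x + vn n x - (u x + v x))\<^sup>2 \<le> 2 * (un n x - u x)\<^sup>2 + 2 * (vn n x - v x)\<^sup>2"
        using sum_squares_bound[of "un n x - u x" "vn n x - v x"]
        by (simp add: power2_eq_square algebra_simps)
    qed
    then show ?thesis using i by simp
  qed
  have "(\<lambda>n. \<integral>x. (un n x + vn n x - (u x + v x))\<^sup>2 \<partial>M) \<longlonglongrightarrow> 0"
    by (rule tendsto_sandwich[OF _ _ tendsto_const lim]) (auto simp: le)
  then show ?thesis using s by (auto simp: L2lim_def intro!: sqint_add)
qed

lemma L2lim_bounded_mult:
  assumes "L2lim M un u" "m \<in> borel_measurable M" "\<And>x. x \<in> space M \<Longrightarrow> \<bar>m x\<bar> \<le> K"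
  shows "L2lim M (\<lambda>n x. m x * un n x) (\<lambda>x. m x * u x)"
proof -
  note s = L2lim_sqint[OF assms(1)]
  have s': "sqint M (\<lambda>x. m x * un n x)" "sqint M (\<lambda>x. m x * u x)" for n
    using sqint_bounded_mult[OF assms(2,3)] s by auto
  have le: "(\<integral>x. (m x * un n x - m x * u x)\<^sup>2 \<partial>M) \<le> K\<^sup>2 * (\<integral>x. (un n x - u x)\<^sup>2 \<partial>M)" for n
  proof -
    have i: "integrable M (\<lambda>x. (un n x - u x)\<^sup>2)"
      using s by (auto intro!: sqint_integrable_sq sqint_diff)
    have "(\<integral>x. (m x * un n x - m x * u x)\<^sup>2 \<partial>M) \<le> (\<integral>x. K\<^sup>2 * (un n x - u x)\<^sup>2 \<partial>M)"
    proof (rule integral_mono)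
      show "integrable M (\<lambda>x. (m x * un n x - m x * u x)\<^sup>2)"
        using s' by (intro sqint_integrable_sq sqint_diff)
      show "integrable M (\<lambda>x. K\<^sup>2 * (un n x - u x)\<^sup>2)" using i by simp
      fix x assume "x \<in> space M"
      then have "\<bar>m x\<bar>\<^sup>2 \<le> K\<^sup>2" by (intro power_mono assms) auto
      then show "(m x * un n x - m x * u x)\<^sup>2 \<le> K\<^sup>2 * (un n x - u x)\<^sup>2"
        by (simp flip: right_diff_distrib add: power_mult_distrib mult_right_mono)
    qed
    then show ?thesis using i by simp
  qed
  show ?thesis by (rule L2lim_bound[OF assms(1) s' le])
qed

lemma L2lim_cmult: "L2lim M un u \<Longrightarrow> L2lim M (\<lambda>n x. c * un n x) (\<lambda>x. c * u x)"
  by (rule L2lim_bounded_mult[where K="\<bar>c\<bar>"]) auto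

lemma L2lim_cong_AE:
  assumes "L2lim M un u" "v \<in> borel_measurable M" "AE x in M. u x = v x"
  shows "L2lim M un v"
proof -
  have v: "sqint M v" using sqint_cong_AE[OF L2lim_sqint(2)[OF assms(1)] assms(2,3)] .
  have "(\<integral>x. (un n x - v x)\<^sup>2 \<partial>M) = (\<integral>x. (un n x - u x)\<^sup>2 \<partial>M)" for n
    using assms(2,3) sqint_measurable[OF L2lim_sqint(1)[OF assms(1)]]
      sqint_measurable[OF L2lim_sqint(2)[OF assms(1)]]
    by (intro integral_cong_AE) auto
  then show ?thesis using assms v by (auto simp: L2lim_def)
qed

text \<open>Splits un vn - u v into (un - u)(vn - v) + (un - u) v + u (vn - v); each of the three
  integrals vanishes in the limit by Cauchy-Schwarz.\<close>

lemma L2lim_mult: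
  assumes "L2lim M un u" "L2lim M vn v"
  shows "(\<lambda>n. \<integral>x. un n x * vn n x \<partial>M) \<longlonglongrightarrow> (\<integral>x. u x * v x \<partial>M)"
proof -
  note s = L2lim_sqint[OF assms(1)] L2lim_sqint[OF assms(2)]
  define a b where "a n = (\<integral>x. (un n x - u x) * (vn n x - v x) \<partial>M)"
    and "b n = (\<integral>x. (un n x - u x) * v x \<partial>M)" for n
  define c where "c n = (\<integral>x. u x * (vn n x - v x) \<partial>M)" for n
  have sq0: "f \<longlonglongrightarrow> 0" if "\<And>n. (f n)\<^sup>2 \<le> g n" "g \<longlonglongrightarrow> 0" for f g :: "nat \<Rightarrow> real"
  proof -
    have "(\<lambda>n. (f n)\<^sup>2) \<longlonglongrightarrow> 0"
      by (rule tendsto_sandwich[OF _ _ tendsto_const that(2)]) (auto simp: that)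
    then have "(\<lambda>n. sqrt ((f n)\<^sup>2)) \<longlonglongrightarrow> sqrt 0" by (rule tendsto_real_sqrt)
    then have "(\<lambda>n. \<bar>f n\<bar>) \<longlonglongrightarrow> 0" by simp
    then show ?thesis by (rule tendsto_rabs_zero_cancel)
  qed
  have "a \<longlonglongrightarrow> 0"
  proof (rule sq0)
    show "(a n)\<^sup>2 \<le> (\<integral>x. (un n x - u x)\<^sup>2 \<partial>M) * (\<integral>x. (vn n x - v x)\<^sup>2 \<partial>M)" for n
      unfolding a_def using s by (intro Cauchy_Schwarz_integral sqint_diff)
    show "(\<lambda>n. (\<integral>x. (un n x - u x)\<^sup>2 \<partial>M) * (\<integral>x. (vn n x - v x)\<^sup>2 \<partial>M)) \<longlonglongrightarrow> 0"
      using assms tendsto_mult[of _ "0::real" _ _ 0] by (auto simp: L2lim_def)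
  qed
  moreover have "b \<longlonglongrightarrow> 0"
  proof (rule sq0)
    show "(b n)\<^sup>2 \<le> (\<integral>x. (un n x - u x)\<^sup>2 \<partial>M) * (\<integral>x. (v x)\<^sup>2 \<partial>M)" for n
      unfolding b_def using s by (intro Cauchy_Schwarz_integral sqint_diff)
    show "(\<lambda>n. (\<integral>x. (un n x - u x)\<^sup>2 \<partial>M) * (\<integral>x. (v x)\<^sup>2 \<partial>M)) \<longlonglongrightarrow> 0"
      using assms by (intro tendsto_mult_left_zero) (auto simp: L2lim_def)
  qed
  moreover have "c \<longlonglongrightarrow> 0"
  proof (rule sq0)
    show "(c n)\<^sup>2 \<le> (\<integral>x. (u x)\<^sup>2 \<partial>M) * (\<integral>x. (vn n x - v x)\<^sup>2 \<partial>M)" for n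
      unfolding c_def using s by (intro Cauchy_Schwarz_integral sqint_diff)
    show "(\<lambda>n. (\<integral>x. (u x)\<^sup>2 \<partial>M) * (\<integral>x. (vn n x - v x)\<^sup>2 \<partial>M)) \<longlonglongrightarrow> 0"
      using assms by (intro tendsto_mult_right_zero) (auto simp: L2lim_def)
  qed
  ultimately have "(\<lambda>n. a n + b n + c n + (\<integral>x. u x * v x \<partial>M)) \<longlonglongrightarrow> 0 + 0 + 0 + (\<integral>x. u x * v x \<partial>M)"
    by (intro tendsto_intros)
  moreover have "a n + b n + c n + (\<integral>x. u x * v x \<partial>M) = (\<integral>x. un n x * vn n x \<partial>M)" for n
  proof -
    have i: "integrable M (\<lambda>x. (un n x - u x) * (vn n x - v x))" "integrable M (\<lambda>x. (un n x - u x) * v x)"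
      "integrable M (\<lambda>x. u x * (vn n x - v x))" "integrable M (\<lambda>x. u x * v x)"
      using s by (auto intro!: sqint_mult_integrable sqint_diff)
    have "a n + b n + c n + (\<integral>x. u x * v x \<partial>M)
       = (\<integral>x. ((un n x - u x) * (vn n x - v x) + (un n x - u x) * v x + u x * (vn n x - v x)) + u x * v x \<partial>M)"
      unfolding a_def b_def c_def using i by simp
    also have "\<dots> = (\<integral>x. un n x * vn n x \<partial>M)"
      by (intro Bochner_Integration.integral_cong) (auto simp: algebra_simps)
    finally show ?thesis .
  qed
  ultimately show ?thesis by simp
qed

section \<open>Coordinate permutations\<close>

text \<open>A reordering of Cartesian coordinates, possibly between differently nested product
  types. Mapping \<open>Basis\<close> onto \<open>Basis\<close> is what turns boxes into
  boxes.\<close>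

definition perm_iso :: "('a::euclidean_space \<Rightarrow> 'b::euclidean_space) \<Rightarrow> ('b \<Rightarrow> 'a) \<Rightarrow> bool" where
  "perm_iso F G \<longleftrightarrow> linear F \<and> linear G \<and> (\<forall>x. G (F x) = x) \<and> (\<forall>y. F (G y) = y) \<and>
     F ` Basis = Basis \<and> (\<forall>x y. F x \<bullet> F y = x \<bullet> y)"

lemma perm_iso_continuous:
  assumes "perm_iso F G"
  shows "continuous_on A F" "continuous_on B G"
  using assms by (auto simp: perm_iso_def linear_continuous_on linear_conv_bounded_linear)

text \<open>Lebesgue measure is characterised by the volumes of boxes. Since \<open>F\<close> is
  isometric, \<open>G\<close> is its adjoint, so the preimage of a box is again a box and its side
  lengths are the same up to order.\<close>

lemma perm_iso_distr_lborel:
  assumes "perm_iso F G"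
  shows "distr lborel lborel F = lborel"
proof (rule lborel_eqI[symmetric])
  have F: "linear F" and G: "linear G" and GF: "\<And>x. G (F x) = x" and FG: "\<And>y. F (G y) = y"
    and B: "F ` Basis = Basis" and inn: "\<And>x y. F x \<bullet> F y = x \<bullet> y"
    using assms by (auto simp: perm_iso_def)
  have Fm: "F \<in> borel_measurable borel"
    using perm_iso_continuous(1)[OF assms] by (rule borel_measurable_continuous_onI)
  have inj: "inj_on F Basis" by (metis GF inj_on_inverseI)
  have tr: "y \<bullet> F x = G y \<bullet> x" for x y using inn[of "G y" x] FG by simp
  show "sets (distr lborel lborel F) = sets borel" by simp
  fix l u :: 'b assume le: "\<And>b. b \<in> Basis \<Longrightarrow> l \<bullet> b \<le> u \<bullet> b"
  have le': "G l \<bullet> b \<le> G u \<bullet> b" if "b \<in> Basis" for b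
    using le[of "F b"] that B tr by auto
  have "F -` box l u = box (G l) (G u)"
  proof (rule set_eqI)
    fix x
    have "x \<in> F -` box l u \<longleftrightarrow> (\<forall>b\<in>Basis. l \<bullet> F b < F x \<bullet> F b \<and> F x \<bullet> F b < u \<bullet> F b)"
      by (simp add: mem_box B[symmetric])
    also have "\<dots> \<longleftrightarrow> x \<in> box (G l) (G u)"
      by (simp add: mem_box tr GF)
    finally show "x \<in> F -` box l u \<longleftrightarrow> x \<in> box (G l) (G u)" .
  qed
  then have "emeasure (distr lborel lborel F) (box l u) = emeasure lborel (box (G l) (G u))"
    using Fm by (simp add: emeasure_distr)
  also have "\<dots> = (\<Prod>b\<in>Basis. (G u - G l) \<bullet> b)"
    using le' by (simp add: emeasure_lborel_box)
  also have "(\<Prod>b\<in>Basis. (G u - G l) \<bullet> b) = (\<Prod>b\<in>Basis. (u - l) \<bullet> F b)"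
    by (intro prod.cong) (simp_all only: tr linear_diff[OF G])
  also have "\<dots> = (\<Prod>b\<in>F ` Basis. (u - l) \<bullet> b)"
    using inj by (simp add: prod.reindex)
  finally show "emeasure (distr lborel lborel F) (box l u) = (\<Prod>b\<in>Basis. (u - l) \<bullet> b)"
    by (simp add: B)
qed

lemma perm_iso_distr_lb:
  assumes "perm_iso F G" "W \<in> sets borel" "F -` V = W"
  shows "V \<in> sets borel" "F \<in> lb W \<rightarrow>\<^sub>M lb V" "distr (lb W) (lb V) F = lb V"
proof -
  have Fm: "F \<in> borel_measurable borel" and Gm: "G \<in> borel_measurable borel"
    using perm_iso_continuous[OF assms(1)] by (auto intro: borel_measurable_continuous_onI)
  have FG: "\<And>y. F (G y) = y" using assms by (auto simp: perm_iso_def)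
  have "V = G -` W" using assms(3) FG by auto
  then show V: "V \<in> sets borel" using measurable_sets_borel[OF Gm assms(2)] by simp
  show m: "F \<in> lb W \<rightarrow>\<^sub>M lb V"
    using assms V Fm by (auto intro!: measurable_restrict_space3)
  show "distr (lb W) (lb V) F = lb V"
  proof (rule measure_eqI)
    fix S assume "S \<in> sets (distr (lb W) (lb V) F)"
    then have S: "S \<in> sets borel" "S \<subseteq> V" using V by (auto simp: sets_restrict_space_iff)
    have "F -` S \<subseteq> W" using S assms by auto
    moreover have "F -` S \<in> sets borel" using measurable_sets_borel[OF Fm S(1)] .
    ultimately have "emeasure (distr (lb W) (lb V) F) S = emeasure (distr lborel lborel F) S"
      using m S V assms Fm
      by (simp add: emeasure_distr emeasure_restrict_space sets_restrict_space_iff Int_absorb2)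
    then show "emeasure (distr (lb W) (lb V) F) S = emeasure (lb V) S"
      using S V by (simp add: perm_iso_distr_lborel[OF assms(1)] emeasure_restrict_space)
  qed simp
qed

lemma perm_iso_sym:
  assumes "perm_iso F G" shows "perm_iso G F"
proof -
  have GF: "\<And>x. G (F x) = x" and FG: "\<And>y. F (G y) = y" and B: "F ` Basis = Basis"
    and inn: "\<And>x y. F x \<bullet> F y = x \<bullet> y"
    using assms by (auto simp: perm_iso_def)
  have "G ` Basis = (G \<circ> F) ` Basis" unfolding B[symmetric] by (simp only: image_comp)
  then have *: "G ` Basis = Basis" by (simp add: GF)
  have "G x \<bullet> G y = x \<bullet> y" for x y
    using inn[of "G x" "G y"] by (simp add: FG)
  with * assms show ?thesis by (simp add: perm_iso_def)
qed

section \<open>Change of variables\<close>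

lemma perm_isoD:
  assumes "perm_iso F G"
  shows "linear F" "linear G" "G (F x) = x" "F (G y) = y"
  using assms unfolding perm_iso_def by blast+

context
  fixes F :: "'a::euclidean_space \<Rightarrow> 'b::euclidean_space" and G W V
  assumes iso: "perm_iso F G" and W: "W \<in> sets borel" and FW: "F -` V = W"
begin

private lemma inv: "G (F x) = x" "F (G y) = y"
  using perm_isoD[OF iso] by blast+

private lemma GV: "G -` W = V"
  unfolding FW[symmetric] by (auto simp: inv)

lemma perm_iso_measurable_iff:
  "f \<in> borel_measurable (lb V) \<longleftrightarrow> (\<lambda>x. f (F x)) \<in> borel_measurable (lb W)" for f :: "'b \<Rightarrow> real"
proof
  assume "f \<in> borel_measurable (lb V)"
  then show "(\<lambda>x. f (F x)) \<in> borel_measurable (lb W)"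
    using perm_iso_distr_lb(2)[OF iso W FW] by (rule measurable_compose[rotated])
next
  have V: "V \<in> sets borel" by (rule perm_iso_distr_lb(1)[OF iso W FW])
  assume "(\<lambda>x. f (F x)) \<in> borel_measurable (lb W)"
  then have "(\<lambda>y. f (F (G y))) \<in> borel_measurable (lb V)"
    using perm_iso_distr_lb(2)[OF perm_iso_sym[OF iso] V GV]
    by (rule measurable_compose[rotated])
  then show "f \<in> borel_measurable (lb V)" by (simp add: inv)
qed

lemma perm_iso_integral:
  fixes f :: "'b \<Rightarrow> real"
  assumes "f \<in> borel_measurable (lb V)"
  shows "integral\<^sup>L (lb V) f = (\<integral>x. f (F x) \<partial>lb W)"
  using integral_distr[OF perm_iso_distr_lb(2)[OF iso W FW] assms]
  by (simp add: perm_iso_distr_lb(3)[OF iso W FW])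

lemma perm_iso_integrable_iff:
  fixes f :: "'b \<Rightarrow> real"
  assumes "f \<in> borel_measurable (lb V)"
  shows "integrable (lb V) f \<longleftrightarrow> integrable (lb W) (\<lambda>x. f (F x))"
  using integrable_distr_eq[OF perm_iso_distr_lb(2)[OF iso W FW] assms]
  by (simp add: perm_iso_distr_lb(3)[OF iso W FW])

lemma perm_iso_AE:
  assumes "AE x in lb W. P (F x)" shows "AE y in lb V. P y"
proof -
  have V: "V \<in> sets borel" by (rule perm_iso_distr_lb(1)[OF iso W FW])
  have "AE x in distr (lb V) (lb W) G. P (F x)"
    unfolding perm_iso_distr_lb(3)[OF perm_iso_sym[OF iso] V GV] by (rule assms)
  then have "AE y in lb V. P (F (G y))"
    by (rule AE_distrD[OF perm_iso_distr_lb(2)[OF perm_iso_sym[OF iso] V GV]])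
  then show ?thesis by (simp add: inv)
qed

end

section \<open>Functions continuously differentiable in one direction\<close>

text \<open>Continuous differentiability along the single direction \<open>h\<close>. The derivative
  is required only at parameter 0 because the base point is arbitrary; \<open>cdiff_line\<close>
  moves it along the line.\<close>

definition cdiff :: "'a::euclidean_space \<Rightarrow> ('a \<Rightarrow> real) \<Rightarrow> ('a \<Rightarrow> real) \<Rightarrow> bool" where
  "cdiff h F F' \<longleftrightarrow> continuous_on UNIV F \<and> continuous_on UNIV F' \<and>
     (\<forall>p. ((\<lambda>s. F (p + s *\<^sub>R h)) has_real_derivative F' p) (at 0))"

lemma cdiff_line:
  assumes "cdiff h F F'"
  shows "((\<lambda>s. F (p + s *\<^sub>R h)) has_real_derivative F' (p + s *\<^sub>R h)) (at s)"
proof -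
  have "((\<lambda>x. F ((p + s *\<^sub>R h) + x *\<^sub>R h)) has_real_derivative F' (p + s *\<^sub>R h)) (at 0)"
    using assms by (simp add: cdiff_def)
  then have "((\<lambda>x. F (p + (x + s) *\<^sub>R h)) has_real_derivative F' (p + s *\<^sub>R h)) (at 0)"
    by (simp add: scaleR_add_left add_ac)
  then show ?thesis
    using DERIV_shift[of "\<lambda>x. F (p + x *\<^sub>R h)" "F' (p + s *\<^sub>R h)" 0 s] by simp
qed

lemma cdiff_add:
  "cdiff h F F' \<Longrightarrow> cdiff h G G' \<Longrightarrow> cdiff h (\<lambda>p. F p + G p) (\<lambda>p. F' p + G' p)"
  by (auto simp: cdiff_def intro!: continuous_intros DERIV_add)

lemma cdiff_mult:
  "cdiff h F F' \<Longrightarrow> cdiff h G G' \<Longrightarrow> cdiff h (\<lambda>p. F p * G p) (\<lambda>p. F' p * G p + F p * G' p)"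
  unfolding cdiff_def
proof (intro conjI allI)
  fix p
  assume "continuous_on UNIV F \<and> continuous_on UNIV F' \<and> (\<forall>p. ((\<lambda>s. F (p + s *\<^sub>R h)) has_real_derivative F' p) (at 0))"
     "continuous_on UNIV G \<and> continuous_on UNIV G' \<and> (\<forall>p. ((\<lambda>s. G (p + s *\<^sub>R h)) has_real_derivative G' p) (at 0))"
  then show "((\<lambda>s. F (p + s *\<^sub>R h) * G (p + s *\<^sub>R h)) has_real_derivative F' p * G p + F p * G' p) (at 0)"
    using DERIV_mult[of "\<lambda>s. F (p + s *\<^sub>R h)" "F' p" 0 UNIV "\<lambda>s. G (p + s *\<^sub>R h)" "G' p"]
    by (simp add: algebra_simps)
qed (auto intro!: continuous_intros)

lemma cdiff_invariant:
  "continuous_on UNIV m \<Longrightarrow> (\<And>p s. m (p + s *\<^sub>R h) = m p) \<Longrightarrow> cdiff h m (\<lambda>_. 0)"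
  by (simp add: cdiff_def)

lemma cdiff_cmult: "cdiff h F F' \<Longrightarrow> cdiff h (\<lambda>p. c * F p) (\<lambda>p. c * F' p)"
  using cdiff_mult[OF cdiff_invariant[of "\<lambda>_. c" h]] by simp

text \<open>The map \<pi> carries lines in direction \<open>h'\<close> to lines in direction
  \<open>h\<close> at equal speed. This covers projections, the parametrisation of the arc, and
  weights depending on time alone.\<close>

lemma cdiff_compose:
  assumes "cdiff h F F'" "continuous_on UNIV \<pi>" "\<And>p s. \<pi> (p + s *\<^sub>R h') = \<pi> p + s *\<^sub>R h"
  shows "cdiff h' (\<lambda>p. F (\<pi> p)) (\<lambda>p. F' (\<pi> p))"
  using assms unfolding cdiff_def
  by (auto intro: continuous_on_compose2[of UNIV _ UNIV \<pi>])

lemma cdiff_real: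
  assumes "\<And>x. (q has_real_derivative q' x) (at x)" "continuous_on UNIV q'"
  shows "cdiff (1::real) q q'"
proof -
  have "continuous_on UNIV q"
    using assms(1) by (meson DERIV_continuous continuous_at_imp_continuous_on)
  moreover have "((\<lambda>s. q (p + s)) has_real_derivative q' p) (at 0)" for p
    using DERIV_shift[of q "q' p" 0 p] assms(1)[of p] by (simp add: add.commute)
  ultimately show ?thesis using assms(2) by (simp add: cdiff_def)
qed

section \<open>Functions with a weak directional derivative and a trace\<close>

text \<open>
  \<open>trV V h S \<gamma> u u' g\<close>: \<open>u'\<close> is the strong derivative of \<open>u\<close> in direction \<open>h\<close> only, and \<open>g\<close> is the trace on the
  face \<open>\<gamma> ` S\<close>. The approximating functions are merely \<open>C\<^sup>1\<close> along \<open>h\<close>, which makes the notion stable under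
  velocity averages and under composition with the parametrisation of the arc.
\<close>

definition trV :: "'v::euclidean_space set \<Rightarrow> 'v \<Rightarrow> 's::euclidean_space set \<Rightarrow> ('s \<Rightarrow> 'v) \<Rightarrow>
    ('v \<Rightarrow> real) \<Rightarrow> ('v \<Rightarrow> real) \<Rightarrow> ('s \<Rightarrow> real) \<Rightarrow> bool" where
  "trV V h S \<gamma> u u' g \<longleftrightarrow> (\<exists>un un'. (\<forall>n. cdiff h (un n) (un' n)) \<and>
     L2lim (lb V) un u \<and> L2lim (lb V) un' u' \<and> L2lim (lb S) (\<lambda>n s. un n (\<gamma> s)) g)"

lemma trV_sqint:
  assumes "trV V h S \<gamma> u u' g"
  shows "sqint (lb V) u" "sqint (lb V) u'" "sqint (lb S) g"
  using assms by (auto simp: trV_def L2lim_def)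

lemma trV_add:
  assumes "trV V h S \<gamma> u u' g" "trV V h S \<gamma> v v' k"
  shows "trV V h S \<gamma> (\<lambda>p. u p + v p) (\<lambda>p. u' p + v' p) (\<lambda>s. g s + k s)"
proof -
  obtain un un' where u: "\<And>n. cdiff h (un n) (un' n)" "L2lim (lb V) un u" "L2lim (lb V) un' u'"
    "L2lim (lb S) (\<lambda>n s. un n (\<gamma> s)) g" using assms(1) by (auto simp: trV_def)
  obtain vn vn' where v: "\<And>n. cdiff h (vn n) (vn' n)" "L2lim (lb V) vn v" "L2lim (lb V) vn' v'"
    "L2lim (lb S) (\<lambda>n s. vn n (\<gamma> s)) k" using assms(2) by (auto simp: trV_def)
  show ?thesis unfolding trV_def
    by (intro exI[of _ "\<lambda>n p. un n p + vn n p"] exI[of _ "\<lambda>n p. un' n p + vn' n p"] conjI allI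
        cdiff_add L2lim_add u v)
qed

lemma trV_cmult:
  assumes "trV V h S \<gamma> u u' g"
  shows "trV V h S \<gamma> (\<lambda>p. c * u p) (\<lambda>p. c * u' p) (\<lambda>s. c * g s)"
proof -
  obtain un un' where u: "\<And>n. cdiff h (un n) (un' n)" "L2lim (lb V) un u" "L2lim (lb V) un' u'"
    "L2lim (lb S) (\<lambda>n s. un n (\<gamma> s)) g" using assms(1) by (auto simp: trV_def)
  show ?thesis unfolding trV_def
    by (intro exI[of _ "\<lambda>n p. c * un n p"] exI[of _ "\<lambda>n p. c * un' n p"] conjI allI
        cdiff_cmult L2lim_cmult u)
qed

lemma trV_diff:
  assumes "trV V h S \<gamma> u u' g" "trV V h S \<gamma> v v' k"
  shows "trV V h S \<gamma> (\<lambda>p. u p - v p) (\<lambda>p. u' p - v' p) (\<lambda>s. g s - k s)"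
  using trV_add[OF assms(1) trV_cmult[OF assms(2), of "-1"]] by simp

lemma trV_cong_AE:
  assumes "trV V h S \<gamma> u u' g" "v' \<in> borel_measurable (lb V)" "AE p in lb V. u' p = v' p"
  shows "trV V h S \<gamma> u v' g"
  using assms L2lim_cong_AE unfolding trV_def by blast

lemma trV_cdiff:
  assumes "cdiff h F F'" "continuous_on UNIV \<gamma>" "bounded V" "V \<in> sets borel" "bounded S" "S \<in> sets borel"
  shows "trV V h S \<gamma> F F' (\<lambda>s. F (\<gamma> s))"
proof -
  have "continuous_on UNIV F" "continuous_on UNIV F'" "continuous_on UNIV (\<lambda>s. F (\<gamma> s))"
    using assms continuous_on_compose2[of UNIV F UNIV \<gamma>] by (auto simp: cdiff_def)
  then show ?thesis unfolding trV_def
    using assms by (intro exI[of _ "\<lambda>_. F"] exI[of _ "\<lambda>_. F'"]) (auto intro!: L2lim_const sqint_continuous_lb)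
qed

text \<open>\<open>\<gamma>'\<close> parametrises the face opposite to \<open>\<gamma>\<close>, and \<open>c = \<plusminus>1\<close> is the component along \<open>h\<close> of the outer normal at \<open>\<gamma>\<close>.\<close>

definition face :: "'v::euclidean_space set \<Rightarrow> 'v \<Rightarrow> 's::euclidean_space set \<Rightarrow> ('s \<Rightarrow> 'v) \<Rightarrow> ('s \<Rightarrow> 'v) \<Rightarrow> real \<Rightarrow> bool" where
  "face V h S \<gamma> \<gamma>' c \<longleftrightarrow> bounded V \<and> V \<in> sets borel \<and> bounded S \<and> S \<in> sets borel \<and>
     continuous_on UNIV \<gamma> \<and>
     (\<forall>F F'. cdiff h F F' \<longrightarrow> (\<forall>s. F (\<gamma>' s) = 0) \<longrightarrow>
        (\<integral>p. F' p \<partial>lb V) = c * (\<integral>s. F (\<gamma> s) \<partial>lb S))"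

text \<open>For approximating functions this is the divergence theorem contained in
  \<open>face\<close>, applied to the product q u v. Every term is bilinear in sequences that
  converge in mean square, so the limit can be taken. The weight has to vanish on the opposite face
  because nothing is known there about the sequences that realise the traces on \<gamma>.\<close>

lemma green:
  assumes f: "face V h S \<gamma> \<gamma>' c" and u: "trV V h S \<gamma> u u' g" and v: "trV V h S \<gamma> v v' k"
    and q: "cdiff h q q'" "\<And>s. q (\<gamma>' s) = 0"
  shows "(\<integral>p. q p * (u p * v' p + u' p * v p) + q' p * (u p * v p) \<partial>lb V)
       = c * (\<integral>s. q (\<gamma> s) * (g s * k s) \<partial>lb S)" (is "integral\<^sup>L _ ?L = _")
proof -
  have V: "bounded V" "V \<in> sets borel" and S: "bounded S" "S \<in> sets borel" and \<gamma>: "continuous_on UNIV \<gamma>"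
    and stokes: "\<And>F F'. cdiff h F F' \<Longrightarrow> (\<And>s. F (\<gamma>' s) = 0) \<Longrightarrow>
        (\<integral>p. F' p \<partial>lb V) = c * (\<integral>s. F (\<gamma> s) \<partial>lb S)"
    using f by (auto simp: face_def)
  obtain un un' where u: "\<And>n. cdiff h (un n) (un' n)" "L2lim (lb V) un u" "L2lim (lb V) un' u'"
    "L2lim (lb S) (\<lambda>n s. un n (\<gamma> s)) g" using u by (auto simp: trV_def)
  obtain vn vn' where v: "\<And>n. cdiff h (vn n) (vn' n)" "L2lim (lb V) vn v" "L2lim (lb V) vn' v'"
    "L2lim (lb S) (\<lambda>n s. vn n (\<gamma> s)) k" using v by (auto simp: trV_def)
  have c: "continuous_on UNIV q" "continuous_on UNIV q'" "continuous_on UNIV (\<lambda>s. q (\<gamma> s))"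
    using q(1) \<gamma> continuous_on_compose2[of UNIV q UNIV \<gamma>] by (auto simp: cdiff_def)
  have bm: "L2lim (lb A) (\<lambda>n x. m x * wn n x) (\<lambda>x. m x * w x)"
    if m: "continuous_on UNIV m" and A: "bounded A" "A \<in> sets borel" and w: "L2lim (lb A) wn w"
    for m :: "'x::euclidean_space \<Rightarrow> real" and A wn w
  proof -
    obtain K where "\<And>x. x \<in> A \<Longrightarrow> \<bar>m x\<bar> \<le> K"
      using continuous_bounded_on[OF m A(1)] by blast
    then show ?thesis
      using w A m by (intro L2lim_bounded_mult[where K=K] continuous_on_UNIV_borel_lb) auto
  qed
  note u1 = bm[OF c(1) V u(2)] note u1' = bm[OF c(1) V u(3)] note u2 = bm[OF c(2) V u(2)]
  note g1 = bm[OF c(3) S u(4)]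
  have "(\<lambda>n. (\<integral>p. q p * un n p * vn' n p \<partial>lb V) + (\<integral>p. q p * un' n p * vn n p \<partial>lb V)
          + (\<integral>p. q' p * un n p * vn n p \<partial>lb V))
      \<longlonglongrightarrow> (\<integral>p. q p * u p * v' p \<partial>lb V) + (\<integral>p. q p * u' p * v p \<partial>lb V)
          + (\<integral>p. q' p * u p * v p \<partial>lb V)"
    by (intro tendsto_add L2lim_mult u1 u1' u2 v)
  moreover have "(\<integral>p. q p * u p * v' p \<partial>lb V) + (\<integral>p. q p * u' p * v p \<partial>lb V)
          + (\<integral>p. q' p * u p * v p \<partial>lb V) = integral\<^sup>L (lb V) ?L"
  proof -
    have "integrable (lb V) (\<lambda>p. q p * u p * v' p)" "integrable (lb V) (\<lambda>p. q p * u' p * v p)"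
      "integrable (lb V) (\<lambda>p. q' p * u p * v p)"
      using u1 u1' u2 v by (auto intro!: sqint_mult_integrable dest: L2lim_sqint(2))
    then show ?thesis
      by (subst Bochner_Integration.integral_add[symmetric], simp_all add: algebra_simps)+
  qed
  moreover have "(\<integral>p. q p * un n p * vn' n p \<partial>lb V) + (\<integral>p. q p * un' n p * vn n p \<partial>lb V)
          + (\<integral>p. q' p * un n p * vn n p \<partial>lb V) = c * (\<integral>s. q (\<gamma> s) * un n (\<gamma> s) * vn n (\<gamma> s) \<partial>lb S)" for n
  proof -
    have "integrable (lb V) (\<lambda>p. q p * un n p * vn' n p)" "integrable (lb V) (\<lambda>p. q p * un' n p * vn n p)"
      "integrable (lb V) (\<lambda>p. q' p * un n p * vn n p)"
      using u1 u1' u2 v by (auto intro!: sqint_mult_integrable dest: L2lim_sqint(1))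
    then have "(\<integral>p. q p * un n p * vn' n p \<partial>lb V) + (\<integral>p. q p * un' n p * vn n p \<partial>lb V)
          + (\<integral>p. q' p * un n p * vn n p \<partial>lb V)
        = (\<integral>p. q' p * (un n p * vn n p) + q p * (un' n p * vn n p + un n p * vn' n p) \<partial>lb V)"
      by (subst Bochner_Integration.integral_add[symmetric], simp_all add: algebra_simps)+
    also have "\<dots> = c * (\<integral>s. q (\<gamma> s) * (un n (\<gamma> s) * vn n (\<gamma> s)) \<partial>lb S)"
      by (rule stokes) (auto intro!: cdiff_mult u v q simp: q(2))
    finally show ?thesis by (simp add: mult.assoc)
  qed
  moreover have "(\<lambda>n. c * (\<integral>s. q (\<gamma> s) * un n (\<gamma> s) * vn n (\<gamma> s) \<partial>lb S))
      \<longlonglongrightarrow> c * (\<integral>s. q (\<gamma> s) * g s * k s \<partial>lb S)"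
    by (intro tendsto_mult_left L2lim_mult g1 v)
  ultimately show ?thesis
    using LIMSEQ_unique by (fastforce simp: mult.assoc)
qed

text \<open>In the coordinates of \<Phi> the direction of differentiation is the first axis.
  Fubini's theorem reduces the claim to lines parallel to it, where it is the fundamental theorem of
  calculus.\<close>

lemma integral_cdiff_slab:
  assumes iso: "perm_iso \<Phi> \<Psi>" and V: "\<Phi> -` V = {l<..<r::real} \<times> S" and lr: "l < r"
    and S: "bounded S" "S \<in> sets borel" and F: "cdiff (\<Phi> (1, 0)) F F'"
  shows "(\<integral>p. F' p \<partial>lb V) = (\<integral>s. F (\<Phi> (r, s)) - F (\<Phi> (l, s)) \<partial>lb S)"
proof -
  let ?I = "{l<..<r}"
  have c: "continuous_on A \<Phi>" for A by (rule perm_iso_continuous[OF iso])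
  note lin = perm_isoD(1)[OF iso]
  have IS: "?I \<times> S \<in> sets borel" "bounded (?I \<times> S)"
    using S by (auto simp: borel_prod[symmetric] intro: bounded_Times)
  have cF': "continuous_on UNIV (\<lambda>x. F' (\<Phi> x))"
    using F c by (auto simp: cdiff_def intro: continuous_on_compose2[of UNIV F'])
  have m: "F' \<in> borel_measurable (lb V)"
    using F by (auto simp: cdiff_def intro: continuous_on_UNIV_borel_lb)
  interpret pair_sigma_finite "lb ?I" "lb S"
    using S by (auto simp: pair_sigma_finite_def intro!: sigma_finite_lb)
  have "(\<integral>p. F' p \<partial>lb V) = (\<integral>x. F' (\<Phi> x) \<partial>(lb ?I \<Otimes>\<^sub>M lb S))"
    using perm_iso_integral[OF iso IS(1) V m] S by (simp add: lb_prod)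
  also have "\<dots> = (\<integral>s. (\<integral>x. F' (\<Phi> (x, s)) \<partial>lb ?I) \<partial>lb S)"
  proof -
    have "integrable (lb ?I \<Otimes>\<^sub>M lb S) (\<lambda>(x, s). F' (\<Phi> (x, s)))"
      using integrable_continuous_lb[OF cF' IS(2,1)] S by (simp add: lb_prod case_prod_beta')
    from integral_snd[OF this] show ?thesis by (simp add: case_prod_beta')
  qed
  also have "\<dots> = (\<integral>s. F (\<Phi> (r, s)) - F (\<Phi> (l, s)) \<partial>lb S)"
  proof (rule Bochner_Integration.integral_cong)
    fix s
    have d: "((\<lambda>x. F (\<Phi> (x, s))) has_real_derivative F' (\<Phi> (x, s))) (at x)" for x
    proof -
      have "\<Phi> (0, s) + x *\<^sub>R \<Phi> (1, 0) = \<Phi> (x, s)" for x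
        using linear_add[OF lin, of "(0, s)" "x *\<^sub>R (1, 0)"] linear_scale[OF lin, of x "(1, 0)"] by simp
      then show ?thesis using cdiff_line[OF F, of "\<Phi> (0, s)" x] by (simp only:)
    qed
    have cs: "continuous_on UNIV (\<lambda>x. F' (\<Phi> (x, s)))"
      using cF' by (rule continuous_on_compose2) (auto intro!: continuous_intros)
    \<comment> \<open>The fundamental theorem of calculus is applied on the closed interval; the two
      added end points are a null set.\<close>
    have "(\<integral>x. F' (\<Phi> (x, s)) \<partial>lb ?I) = (\<integral>x. F' (\<Phi> (x, s)) * indicator {l..r} x \<partial>lborel)"
      unfolding integral_restrict_space[of ?I lborel, simplified] using cs
      by (intro integral_cong_AE borel_measurable_times borel_measurable_scaleR)
        (auto intro!: borel_measurable_continuous_onI AE_I[where N="{l,r}"] emeasure_lborel_countable simp: indicator_def split: if_splits)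
    also have "\<dots> = F (\<Phi> (r, s)) - F (\<Phi> (l, s))"
      using lr d cs by (intro integral_FTC_Icc_real) (auto simp: continuous_on_eq_continuous_at)
    finally show "(\<integral>x. F' (\<Phi> (x, s)) \<partial>lb ?I) = F (\<Phi> (r, s)) - F (\<Phi> (l, s))" .
  qed simp
  finally show ?thesis .
qed

lemma slab_bounded_borel:
  assumes iso: "perm_iso \<Phi> \<Psi>" and V: "\<Phi> -` V = W" and "bounded W" "W \<in> sets borel"
  shows "bounded V" "V \<in> sets borel"
proof -
  have "V = \<Phi> ` W" using iso V unfolding perm_iso_def by (metis surj_def surj_image_vimage_eq)
  then show "bounded V"
    using assms by (auto simp: perm_iso_def intro!: bounded_linear_image linear_conv_bounded_linear[THEN iffD1])
  show "V \<in> sets borel" by (rule perm_iso_distr_lb(1)[OF iso assms(4) V])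
qed

lemma face_slab:
  assumes iso: "perm_iso \<Phi> \<Psi>" and V: "\<Phi> -` V = {l<..<r::real} \<times> S" and lr: "l < r"
    and S: "bounded S" "S \<in> sets borel"
  shows "face V (\<Phi> (1, 0)) S (\<lambda>s. \<Phi> (l, s)) (\<lambda>s. \<Phi> (r, s)) (-1)"
    and "face V (\<Phi> (1, 0)) S (\<lambda>s. \<Phi> (r, s)) (\<lambda>s. \<Phi> (l, s)) 1"
proof -
  have IS: "{l<..<r} \<times> S \<in> sets borel" "bounded ({l<..<r} \<times> S)"
    using S by (auto simp: borel_prod[symmetric] intro: bounded_Times)
  have c: "continuous_on UNIV (\<lambda>s. \<Phi> (x, s))" for x
    by (rule continuous_on_compose2[OF perm_iso_continuous(1)[OF iso]]) (auto intro!: continuous_intros)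
  show "face V (\<Phi> (1, 0)) S (\<lambda>s. \<Phi> (l, s)) (\<lambda>s. \<Phi> (r, s)) (-1)"
    "face V (\<Phi> (1, 0)) S (\<lambda>s. \<Phi> (r, s)) (\<lambda>s. \<Phi> (l, s)) 1"
    unfolding face_def
    using slab_bounded_borel[OF iso V IS(2,1)] S c
    by (auto simp: integral_cdiff_slab[OF iso V lr S])
qed

text \<open>The traces on the two faces are realised by different sequences, so one application of
  \<open>green\<close> cannot give both. With \<open>e\<close> the coordinate along
  \<open>h\<close>, 1 = (r - e)/d + (e - l)/d splits the integral into two parts whose weights
  vanish on one face each. The terms with the derivatives -1/d and 1/d of these weights cancel in
  the sum.\<close>

lemma green_slab:
  assumes iso: "perm_iso \<Phi> \<Psi>" and V: "\<Phi> -` V = {l<..<r::real} \<times> S" and lr: "l < r"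
    and S: "bounded S" "S \<in> sets borel" and h: "h = \<Phi> (1, 0)"
    and ul: "trV V h S (\<lambda>s. \<Phi> (l, s)) u u' gl" and vl: "trV V h S (\<lambda>s. \<Phi> (l, s)) v v' kl"
    and ur: "trV V h S (\<lambda>s. \<Phi> (r, s)) u u' gr" and vr: "trV V h S (\<lambda>s. \<Phi> (r, s)) v v' kr"
    and m: "continuous_on UNIV m" "\<And>p s. m (p + s *\<^sub>R h) = m p"
  shows "(\<integral>p. m p * (u p * v' p + u' p * v p) \<partial>lb V)
    = (\<integral>s. m (\<Phi> (r, s)) * (gr s * kr s) \<partial>lb S) - (\<integral>s. m (\<Phi> (l, s)) * (gl s * kl s) \<partial>lb S)"
proof -
  define e where "e p = fst (\<Psi> p)" for p
  note lin = perm_isoD(2)[OF iso] and inv = perm_isoD(3)[OF iso]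
  have ce: "continuous_on UNIV e"
    unfolding e_def by (intro continuous_intros perm_iso_continuous[OF iso])
  have eh: "e (p + s *\<^sub>R h) = e p + s" for p s
    by (simp add: e_def h linear_add[OF lin] linear_scale[OF lin] inv)
  have cd: "cdiff h (\<lambda>p. m p * (A + B * e p)) (\<lambda>p. m p * B)" for A B
  proof -
    have "cdiff (1::real) (\<lambda>x. A + B * x) (\<lambda>_. B)"
      by (rule cdiff_real) (auto intro!: derivative_eq_intros)
    from cdiff_compose[OF this ce, of h] eh
    have "cdiff h (\<lambda>p. A + B * e p) (\<lambda>_. B)" by simp
    from cdiff_mult[OF cdiff_invariant[OF m] this] show ?thesis by simp
  qed
  have e\<Phi>: "e (\<Phi> (x, s)) = x" for x s by (simp add: e_def inv)
  have IS: "{l<..<r} \<times> S \<in> sets borel" "bounded ({l<..<r} \<times> S)"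
    using S by (auto simp: borel_prod[symmetric] intro: bounded_Times)
  note bV = slab_bounded_borel[OF iso V IS(2,1)]
  define d where "d = r - l"
  have d: "d > 0" using lr by (simp add: d_def)
  have int: "integrable (lb V) (\<lambda>p. w p * (u p * v' p + u' p * v p))"
    "integrable (lb V) (\<lambda>p. w p * (u p * v p))" if w: "continuous_on UNIV w" for w
  proof -
    obtain K where K: "\<And>x. x \<in> V \<Longrightarrow> \<bar>w x\<bar> \<le> K"
      using continuous_bounded_on[OF w bV(1)] by blast
    have "sqint (lb V) (\<lambda>p. w p * u p)" "sqint (lb V) (\<lambda>p. w p * u' p)"
      using K w bV trV_sqint[OF ul]
      by (auto intro!: sqint_bounded_mult[where K=K] continuous_on_UNIV_borel_lb)
    then have "integrable (lb V) (\<lambda>p. w p * u p * v' p + w p * u' p * v p)"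
      "integrable (lb V) (\<lambda>p. w p * u p * v p)"
      using trV_sqint[OF vl] by (auto intro!: Bochner_Integration.integrable_add sqint_mult_integrable)
    then show "integrable (lb V) (\<lambda>p. w p * (u p * v' p + u' p * v p))"
      "integrable (lb V) (\<lambda>p. w p * (u p * v p))" by (simp_all add: algebra_simps)
  qed
  have cw: "continuous_on UNIV (\<lambda>p. m p * (A + B * e p))" "continuous_on UNIV (\<lambda>p. m p * B)" for A B
    using m(1) ce by (auto intro!: continuous_intros)
  have L: "(\<integral>p. (m p * (r / d + (-1/d) * e p)) * (u p * v' p + u' p * v p) + (m p * (-1/d)) * (u p * v p) \<partial>lb V)
      = - (\<integral>s. m (\<Phi> (l, s)) * (gl s * kl s) \<partial>lb S)" (is "integral\<^sup>L _ ?L = _")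
    using green[OF face_slab(1)[OF iso V lr S, folded h] ul vl cd, of "r/d" "-1/d"] d
    by (simp add: e\<Phi> d_def flip: diff_divide_distrib)
  have R: "(\<integral>p. (m p * (-l / d + (1/d) * e p)) * (u p * v' p + u' p * v p) + (m p * (1/d)) * (u p * v p) \<partial>lb V)
      = (\<integral>s. m (\<Phi> (r, s)) * (gr s * kr s) \<partial>lb S)" (is "integral\<^sup>L _ ?R = _")
    using green[OF face_slab(2)[OF iso V lr S, folded h] ur vr cd, of "-l/d" "1/d"] d
    by (simp add: e\<Phi> d_def flip: diff_divide_distrib)
  have "integral\<^sup>L (lb V) ?L + integral\<^sup>L (lb V) ?R = (\<integral>p. ?L p + ?R p \<partial>lb V)"
    by (intro Bochner_Integration.integral_add[symmetric] Bochner_Integration.integrable_add int cw)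
  also have "\<dots> = (\<integral>p. m p * (u p * v' p + u' p * v p) \<partial>lb V)"
  proof (rule Bochner_Integration.integral_cong[OF refl])
    fix p
    have "r / d + (-1/d) * e p + (-l / d + (1/d) * e p) = 1"
    proof -
      have "r / d + (-1/d) * e p + (-l / d + (1/d) * e p) = (r - l) / d"
        by (simp add: diff_divide_distrib)
      then show ?thesis using d by (simp add: d_def)
    qed
    moreover have "?L p + ?R p = m p * ((r / d + (-1/d) * e p + (-l / d + (1/d) * e p)) * (u p * v' p + u' p * v p))"
      by (simp add: algebra_simps)
    ultimately show "?L p + ?R p = m p * (u p * v' p + u' p * v p)" by simp
  qed
  finally show ?thesis unfolding L R by simp
qed

section \<open>Averaging over the velocity variable\<close>

lemma integral_lb_const_interval: "0 < a \<Longrightarrow> (\<integral>x. c \<partial>lb {0<..<a::real}) = a * c" for c :: real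
  by (simp add: measure_restrict_space)

lemma finite_measure_lb_interval: "finite_measure (lb {0<..<a::real})"
  by (rule finite_measure_lb) auto

text \<open>Writes \<open>V\<close> as base times velocity interval, up to the order and nesting of
  coordinates, so that space-time domains and their faces share one theory of velocity
  averages.\<close>

locale fibration =
  fixes V :: "'v::euclidean_space set" and \<theta> :: "'b::euclidean_space \<times> real \<Rightarrow> 'v"
    and \<theta>' :: "'v \<Rightarrow> 'b \<times> real" and B :: "'b set" and a :: real
  assumes iso: "perm_iso \<theta> \<theta>'" and B: "B \<in> sets borel" "bounded B" and a: "0 < a"
    and V: "\<theta> -` V = B \<times> {0<..<a}"
begin

definition \<pi> :: "'v \<Rightarrow> 'b" where "\<pi> p = fst (\<theta>' p)"

definition avb :: "('v \<Rightarrow> real) \<Rightarrow> 'b \<Rightarrow> real" where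
  "avb g b = (\<integral>\<beta>. g (\<theta> (b, \<beta>)) \<partial>lb {0<..<a}) / a"

text \<open>The average pulled back to \<open>V\<close>, where it can stand under one integral with
  functions that depend on velocity.\<close>

definition av :: "('v \<Rightarrow> real) \<Rightarrow> 'v \<Rightarrow> real" where
  "av g p = avb g (\<pi> p)"

lemma \<pi>_\<theta> [simp]: "\<pi> (\<theta> (b, \<beta>)) = b"
  using perm_isoD(3)[OF iso] by (simp add: \<pi>_def)

lemma av_\<theta> [simp]: "av g (\<theta> (b, \<beta>)) = avb g b"
  by (simp add: av_def)

lemma W: "B \<times> {0<..<a} \<in> sets borel" "bounded (B \<times> {0<..<a})"
  using B by (auto simp: borel_prod[symmetric] intro: bounded_Times)

lemma V_dom: "V \<in> sets borel" "bounded V"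
  using slab_bounded_borel[OF iso V W(2,1)] by auto

lemma continuous_\<pi>: "continuous_on S \<pi>"
  unfolding \<pi>_def by (intro continuous_intros perm_iso_continuous[OF iso])

lemma prod_eq: "lb B \<Otimes>\<^sub>M lb {0<..<a} = lb (B \<times> {0<..<a})"
  using B by (intro lb_prod) auto

sublocale pair_sigma_finite "lb B" "lb {0<..<a}"
  unfolding pair_sigma_finite_def using B by (auto intro!: sigma_finite_lb)

lemma measurable_iff:
  "f \<in> borel_measurable (lb V) \<longleftrightarrow> (\<lambda>x. f (\<theta> x)) \<in> borel_measurable (lb B \<Otimes>\<^sub>M lb {0<..<a})"
  for f :: "'v \<Rightarrow> real"
  unfolding prod_eq by (rule perm_iso_measurable_iff[OF iso W(1) V])

lemma integrable_iff:
  fixes f :: "'v \<Rightarrow> real"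
  assumes "f \<in> borel_measurable (lb V)"
  shows "integrable (lb V) f \<longleftrightarrow> integrable (lb B \<Otimes>\<^sub>M lb {0<..<a}) (\<lambda>x. f (\<theta> x))"
  unfolding prod_eq by (rule perm_iso_integrable_iff[OF iso W(1) V assms])

lemma AE_transport: "AE x in lb B \<Otimes>\<^sub>M lb {0<..<a}. P (\<theta> x) \<Longrightarrow> AE p in lb V. P p"
  unfolding prod_eq by (rule perm_iso_AE[OF iso W(1) V])

lemma AE_transport':
  assumes "AE p in lb V. P p" shows "AE x in lb B \<Otimes>\<^sub>M lb {0<..<a}. P (\<theta> x)"
proof -
  have "AE x in lb (B \<times> {0<..<a}). P (\<theta> x)"
  proof (rule perm_iso_AE[OF perm_iso_sym[OF iso] V_dom(1)])
    show "\<theta>' -` (B \<times> {0<..<a}) = V"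
      unfolding V[symmetric] by (rule set_eqI) (simp add: perm_isoD(4)[OF iso])
    show "AE y in lb V. P (\<theta> (\<theta>' y))" using assms by (simp add: perm_isoD(4)[OF iso])
  qed
  then show ?thesis unfolding prod_eq .
qed

lemma
  fixes f :: "'v \<Rightarrow> real"
  assumes "integrable (lb V) f"
  shows AE_section: "AE b in lb B. integrable (lb {0<..<a}) (\<lambda>\<beta>. f (\<theta> (b, \<beta>)))"
    and integrable_inner: "integrable (lb B) (\<lambda>b. \<integral>\<beta>. f (\<theta> (b, \<beta>)) \<partial>lb {0<..<a})"
    and integral_fubini: "integral\<^sup>L (lb V) f = (\<integral>b. \<integral>\<beta>. f (\<theta> (b, \<beta>)) \<partial>lb {0<..<a} \<partial>lb B)"
proof -
  have m: "f \<in> borel_measurable (lb V)" using assms by simp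
  have i: "integrable (lb B \<Otimes>\<^sub>M lb {0<..<a}) (\<lambda>x. f (\<theta> x))"
    using assms integrable_iff[OF m] by simp
  from AE_integrable_fst'[OF i]
  show "AE b in lb B. integrable (lb {0<..<a}) (\<lambda>\<beta>. f (\<theta> (b, \<beta>)))" .
  from integrable_fst'[OF i]
  show "integrable (lb B) (\<lambda>b. \<integral>\<beta>. f (\<theta> (b, \<beta>)) \<partial>lb {0<..<a})" .
  show "integral\<^sup>L (lb V) f = (\<integral>b. \<integral>\<beta>. f (\<theta> (b, \<beta>)) \<partial>lb {0<..<a} \<partial>lb B)"
    using perm_iso_integral[OF iso W(1) V m] integral_fst'[OF i] by (simp add: prod_eq)
qed

lemma lift_measurable:
  fixes f :: "'b \<Rightarrow> real"
  assumes "f \<in> borel_measurable (lb B)" shows "(\<lambda>p. f (\<pi> p)) \<in> borel_measurable (lb V)"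
proof -
  have "(\<lambda>x. f (fst x)) \<in> borel_measurable (lb B \<Otimes>\<^sub>M lb {0<..<a})"
    using assms by (rule measurable_compose[OF measurable_fst])
  then show ?thesis unfolding measurable_iff by (simp add: \<pi>_def perm_isoD(3)[OF iso])
qed

lemma lift_AE:
  assumes "AE b in lb B. P b" shows "AE p in lb V. P (\<pi> p)"
proof (rule AE_transport)
  obtain N where N: "{b \<in> space (lb B). \<not> P b} \<subseteq> N" "emeasure (lb B) N = 0" "N \<in> sets (lb B)"
    using assms by (rule AE_E)
  have "AE x in lb B \<Otimes>\<^sub>M lb {0<..<a}. P (fst x)"
  proof (rule AE_I)
    show "{x \<in> space (lb B \<Otimes>\<^sub>M lb {0<..<a}). \<not> P (fst x)} \<subseteq> N \<times> space (lb {0<..<a})"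
      using N(1) by (auto simp: space_pair_measure)
    show "N \<times> space (lb {0<..<a}) \<in> sets (lb B \<Otimes>\<^sub>M lb {0<..<a})" using N(3) by (rule pair_measureI) (rule sets.top)
    show "emeasure (lb B \<Otimes>\<^sub>M lb {0<..<a}) (N \<times> space (lb {0<..<a})) = 0"
      using N by (subst M2.emeasure_pair_measure_Times) (auto simp: sets_restrict_space_iff)
  qed
  then show "AE x in lb B \<Otimes>\<^sub>M lb {0<..<a}. P (\<pi> (\<theta> x))"
    by (simp add: \<pi>_def perm_isoD(3)[OF iso])
qed

lemma
  fixes f :: "'b \<Rightarrow> real"
  assumes f: "integrable (lb B) f"
  shows lift_integrable: "integrable (lb V) (\<lambda>p. f (\<pi> p))"
    and lift_integral: "(\<integral>p. f (\<pi> p) \<partial>lb V) = a * (\<integral>b. f b \<partial>lb B)"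
proof -
  interpret A: finite_measure "lb {0<..<a}" by (rule finite_measure_lb_interval)
  have m: "(\<lambda>p. f (\<pi> p)) \<in> borel_measurable (lb V)"
    using f by (intro lift_measurable) simp
  have m': "(\<lambda>x. f (fst x)) \<in> borel_measurable (lb B \<Otimes>\<^sub>M lb {0<..<a})"
    using f by (intro measurable_compose[OF measurable_fst]) simp
  have "integrable (lb B \<Otimes>\<^sub>M lb {0<..<a}) (\<lambda>x. f (fst x))"
  proof (rule Fubini_integrable[OF m'])
    show "integrable (lb B) (\<lambda>x. \<integral>y. norm (f (fst (x, y))) \<partial>lb {0<..<a})"
      using f a by (simp add: integral_lb_const_interval del: integral_const lebesgue_integral_const)
  qed simp
  then show i: "integrable (lb V) (\<lambda>p. f (\<pi> p))"
    using integrable_iff[OF m] by (simp add: \<pi>_def perm_isoD(3)[OF iso])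
  show "(\<integral>p. f (\<pi> p) \<partial>lb V) = a * (\<integral>b. f b \<partial>lb B)"
    using integral_fubini[OF i] a by (simp add: integral_lb_const_interval del: integral_const lebesgue_integral_const)
qed

lemma lift_sqint: "sqint (lb B) f \<Longrightarrow> sqint (lb V) (\<lambda>p. f (\<pi> p))"
  using lift_measurable[of f] lift_integrable[of "\<lambda>b. (f b)\<^sup>2"] by (simp add: sqint_def)

lemma lift_L2lim:
  assumes L: "L2lim (lb B) un u" shows "L2lim (lb V) (\<lambda>n p. un n (\<pi> p)) (\<lambda>p. u (\<pi> p))"
proof (rule L2lim_bound[where K=a, OF L])
  note s = L2lim_sqint[OF L]
  show "sqint (lb V) (\<lambda>p. un n (\<pi> p))" "sqint (lb V) (\<lambda>p. u (\<pi> p))" for n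
    using s by (auto intro: lift_sqint)
  show "(\<integral>p. (un n (\<pi> p) - u (\<pi> p))\<^sup>2 \<partial>lb V) \<le> a * (\<integral>b. (un n b - u b)\<^sup>2 \<partial>lb B)" for n
    using s by (subst lift_integral) (auto intro!: sqint_integrable_sq sqint_diff)
qed

lemma avb_measurable:
  assumes "g \<in> borel_measurable (lb V)" shows "avb g \<in> borel_measurable (lb B)"
proof -
  have "(\<lambda>x. g (\<theta> x)) \<in> borel_measurable (lb B \<Otimes>\<^sub>M lb {0<..<a})"
    using assms measurable_iff by simp
  then have "(\<lambda>b. \<integral>\<beta>. g (\<theta> (b, \<beta>)) \<partial>lb {0<..<a}) \<in> borel_measurable (lb B)"
    by (intro M2.borel_measurable_lebesgue_integral) simp
  then show ?thesis unfolding avb_def[abs_def] by simp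
qed

text \<open>Cauchy-Schwarz against the constant 1 on almost every fibre, followed by integration
  over the base.\<close>

lemma
  assumes g: "sqint (lb V) g"
  shows avb_sqint: "sqint (lb B) (avb g)"
    and avb_bound: "a * (\<integral>b. (avb g b)\<^sup>2 \<partial>lb B) \<le> (\<integral>p. (g p)\<^sup>2 \<partial>lb V)"
proof -
  interpret A: finite_measure "lb {0<..<a}" by (rule finite_measure_lb_interval)
  define H where "H b = (\<integral>\<beta>. (g (\<theta> (b, \<beta>)))\<^sup>2 \<partial>lb {0<..<a})" for b
  have i2: "integrable (lb V) (\<lambda>p. (g p)\<^sup>2)" using g by (rule sqint_integrable_sq)
  have gm: "(\<lambda>x. g (\<theta> x)) \<in> borel_measurable (lb B \<Otimes>\<^sub>M lb {0<..<a})"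
    using sqint_measurable[OF g] measurable_iff by simp
  have H: "integrable (lb B) H" unfolding H_def by (rule integrable_inner[OF i2])
  have le: "AE b in lb B. (avb g b)\<^sup>2 \<le> H b / a"
    using AE_section[OF i2] AE_space
  proof eventually_elim
    fix b assume b: "integrable (lb {0<..<a}) (\<lambda>\<beta>. (g (\<theta> (b, \<beta>)))\<^sup>2)" "b \<in> space (lb B)"
    have "(\<lambda>\<beta>. g (\<theta> (b, \<beta>))) \<in> borel_measurable (lb {0<..<a})"
      using measurable_compose_Pair1[OF b(2) gm] .
    then have s: "sqint (lb {0<..<a}) (\<lambda>\<beta>. g (\<theta> (b, \<beta>)))" using b by (simp add: sqint_def)
    have "sqint (lb {0<..<a}) (\<lambda>_. 1)" by (simp add: sqint_def)
    from Cauchy_Schwarz_integral[OF this s]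
    have "(a * avb g b)\<^sup>2 \<le> a * H b"
      using a integral_lb_const_interval[OF a, of 1] by (simp add: avb_def H_def)
    then have "a * (a * (avb g b)\<^sup>2) \<le> a * H b" by (simp add: power2_eq_square algebra_simps)
    then show "(avb g b)\<^sup>2 \<le> H b / a" using a by (simp add: field_simps)
  qed
  have m: "avb g \<in> borel_measurable (lb B)" by (rule avb_measurable[OF sqint_measurable[OF g]])
  have i: "integrable (lb B) (\<lambda>b. (avb g b)\<^sup>2)"
  proof (rule Bochner_Integration.integrable_bound)
    show "integrable (lb B) (\<lambda>b. H b / a)" using H by simp
    show "(\<lambda>b. (avb g b)\<^sup>2) \<in> borel_measurable (lb B)" using m by simp
    show "AE b in lb B. norm ((avb g b)\<^sup>2) \<le> norm (H b / a)"
      using le by eventually_elim (metis abs_ge_self abs_power2 order_trans real_norm_def)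
  qed
  then show "sqint (lb B) (avb g)" using m by (simp add: sqint_def)
  have "(\<integral>b. (avb g b)\<^sup>2 \<partial>lb B) \<le> (\<integral>b. H b / a \<partial>lb B)"
    using le i H by (intro integral_mono_AE) auto
  then have "a * (\<integral>b. (avb g b)\<^sup>2 \<partial>lb B) \<le> (\<integral>b. H b \<partial>lb B)"
    using a by (simp add: field_simps)
  also have "\<dots> = (\<integral>p. (g p)\<^sup>2 \<partial>lb V)" unfolding H_def by (rule integral_fubini[OF i2, symmetric])
  finally show "a * (\<integral>b. (avb g b)\<^sup>2 \<partial>lb B) \<le> (\<integral>p. (g p)\<^sup>2 \<partial>lb V)" .
qed

lemma
  assumes g: "sqint (lb V) g"
  shows av_sqint: "sqint (lb V) (av g)"
    and av_bound: "(\<integral>p. (av g p)\<^sup>2 \<partial>lb V) \<le> (\<integral>p. (g p)\<^sup>2 \<partial>lb V)"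
  unfolding av_def
  using lift_sqint[OF avb_sqint[OF g]] lift_integral[OF sqint_integrable_sq[OF avb_sqint[OF g]]] avb_bound[OF g]
  by simp_all

lemma finite_V: "finite_measure (lb V)"
  using V_dom by (intro finite_measure_lb)

lemma avb_add_AE:
  assumes "integrable (lb V) f" "integrable (lb V) g"
  shows "AE b in lb B. avb (\<lambda>p. f p + g p) b = avb f b + avb g b"
  using AE_section[OF assms(1)] AE_section[OF assms(2)]
  by eventually_elim (simp add: avb_def add_divide_distrib)

lemma avb_cmult: "avb (\<lambda>p. c * f p) b = c * avb f b"
  by (simp add: avb_def)

lemma avb_diff_AE:
  assumes "integrable (lb V) f" "integrable (lb V) g"
  shows "AE b in lb B. avb (\<lambda>p. f p - g p) b = avb f b - avb g b"
  using AE_section[OF assms(1)] AE_section[OF assms(2)]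
  by eventually_elim (simp add: avb_def diff_divide_distrib)

lemma avb_cong_AE:
  assumes "AE p in lb V. f p = g p" "f \<in> borel_measurable (lb V)" "g \<in> borel_measurable (lb V)"
  shows "AE b in lb B. avb f b = avb g b"
proof -
  have m: "(\<lambda>x. f (\<theta> x)) \<in> borel_measurable (lb B \<Otimes>\<^sub>M lb {0<..<a})"
    "(\<lambda>x. g (\<theta> x)) \<in> borel_measurable (lb B \<Otimes>\<^sub>M lb {0<..<a})"
    using assms measurable_iff by auto
  have "AE b in lb B. AE \<beta> in lb {0<..<a}. f (\<theta> (b, \<beta>)) = g (\<theta> (b, \<beta>))"
    using AE_pair[OF AE_transport'[OF assms(1)]] .
  with AE_space show ?thesis
  proof eventually_elim
    fix b assume b: "b \<in> space (lb B)" "AE \<beta> in lb {0<..<a}. f (\<theta> (b, \<beta>)) = g (\<theta> (b, \<beta>))"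
    have "(\<integral>\<beta>. f (\<theta> (b, \<beta>)) \<partial>lb {0<..<a}) = (\<integral>\<beta>. g (\<theta> (b, \<beta>)) \<partial>lb {0<..<a})"
      using measurable_compose_Pair1[OF b(1) m(1)] measurable_compose_Pair1[OF b(1) m(2)] b(2)
      by (rule integral_cong_AE)
    then show "avb f b = avb g b" by (simp add: avb_def)
  qed
qed

lemma avb_lift: "avb (\<lambda>p. f (\<pi> p)) b = f b"
  unfolding avb_def \<pi>_\<theta> integral_lb_const_interval[OF a] using a by simp

text \<open>The second factor is constant on each fibre, and a function minus its mean integrates to
  0 there. This removes the product of the fluctuation of \<open>w\<close> with the
  velocity-independent part of \<open>r\<close>.\<close>

lemma integral_fluctuation_lift:
  assumes g: "sqint (lb V) g" and m: "sqint (lb B) m"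
  shows "(\<integral>p. (g p - av g p) * m (\<pi> p) \<partial>lb V) = 0"
proof -
  interpret A: finite_measure "lb {0<..<a}" by (rule finite_measure_lb_interval)
  have i: "integrable (lb V) (\<lambda>p. (g p - av g p) * m (\<pi> p))"
    using g m by (intro sqint_mult_integrable sqint_diff av_sqint lift_sqint)
  have "AE b in lb B. (\<integral>\<beta>. (g (\<theta> (b, \<beta>)) - av g (\<theta> (b, \<beta>))) * m (\<pi> (\<theta> (b, \<beta>))) \<partial>lb {0<..<a}) = 0"
    using AE_section[OF sqint_imp_integrable[OF finite_V g]]
  proof eventually_elim
    fix b assume "integrable (lb {0<..<a}) (\<lambda>\<beta>. g (\<theta> (b, \<beta>)))"
    then have "(\<integral>\<beta>. g (\<theta> (b, \<beta>)) - avb g b \<partial>lb {0<..<a}) = (\<integral>\<beta>. g (\<theta> (b, \<beta>)) \<partial>lb {0<..<a}) - a * avb g b"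
      using a integral_lb_const_interval[OF a, of "avb g b"] by simp
    then show "(\<integral>\<beta>. (g (\<theta> (b, \<beta>)) - av g (\<theta> (b, \<beta>))) * m (\<pi> (\<theta> (b, \<beta>))) \<partial>lb {0<..<a}) = 0"
      using a by (simp add: avb_def)
  qed
  then show ?thesis unfolding integral_fubini[OF i]
    by (rule integral_eq_zero_AE)
qed

end

text \<open>The approximating functions are composed with the projection. The last two hypotheses
  say that the projection maps the direction and the face of \<open>V\<close> to those of
  \<open>U\<close>.\<close>

lemma trV_lift:
  assumes V: "fibration V \<theta> \<theta>' U a" and S: "fibration S \<theta>S \<theta>S' SU a'"
    and u: "trV U hU SU \<gamma>U u u' g"
    and h: "\<And>p s. fst (\<theta>' (p + s *\<^sub>R h)) = fst (\<theta>' p) + s *\<^sub>R hU"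
    and \<gamma>: "\<And>s. fst (\<theta>' (\<gamma> s)) = \<gamma>U (fst (\<theta>S' s))"
  shows "trV V h S \<gamma> (\<lambda>p. u (fst (\<theta>' p))) (\<lambda>p. u' (fst (\<theta>' p))) (\<lambda>s. g (fst (\<theta>S' s)))"
proof -
  interpret V: fibration V \<theta> \<theta>' U a by fact
  interpret S: fibration S \<theta>S \<theta>S' SU a' by fact
  obtain un un' where u: "\<And>n. cdiff hU (un n) (un' n)" "L2lim (lb U) un u" "L2lim (lb U) un' u'"
    "L2lim (lb SU) (\<lambda>n s. un n (\<gamma>U s)) g" using u by (auto simp: trV_def)
  have "cdiff h (\<lambda>p. un n (fst (\<theta>' p))) (\<lambda>p. un' n (fst (\<theta>' p)))" for n
    using V.continuous_\<pi>[of UNIV] by (intro cdiff_compose[OF u(1)] h) (simp add: V.\<pi>_def)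
  moreover note V.lift_L2lim[OF u(2), unfolded V.\<pi>_def] V.lift_L2lim[OF u(3), unfolded V.\<pi>_def]
  moreover have "L2lim (lb S) (\<lambda>n s. un n (fst (\<theta>' (\<gamma> s)))) (\<lambda>s. g (fst (\<theta>S' s)))"
    using S.lift_L2lim[OF u(4)] by (simp add: S.\<pi>_def \<gamma>)
  ultimately show ?thesis unfolding trV_def
    by (intro exI[of _ "\<lambda>n p. un n (fst (\<theta>' p))"] exI[of _ "\<lambda>n p. un' n (fst (\<theta>' p))"] conjI allI)
qed

text \<open>Differentiation under the integral sign; the hypotheses on \<open>h\<close> say that it
  moves only the base point and leaves the averaged variable fixed.\<close>

lemma (in fibration) cdiff_av:
  assumes F: "cdiff h F F'"
    and h: "\<And>p s. \<pi> (p + s *\<^sub>R h) = \<pi> p + s *\<^sub>R hB"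
    and \<theta>h: "\<And>b \<beta> s. \<theta> (b + s *\<^sub>R hB, \<beta>) = \<theta> (b, \<beta>) + s *\<^sub>R h"
  shows "cdiff h (av F) (av F')"
proof -
  have ct: "continuous_on A (\<lambda>x. \<theta> (f x))" if "continuous_on A f" for A :: "'x::topological_space set" and f
    using perm_iso_continuous(1)[OF iso] that by (rule continuous_on_compose2) auto
  have c: "continuous_on UNIV F" "continuous_on UNIV F'" using F by (auto simp: cdiff_def)
  have cc: "continuous_on UNIV (\<lambda>\<beta>. G (\<theta> (b, \<beta>)))" if "continuous_on UNIV G" for G :: "'v \<Rightarrow> real" and b
    using that by (rule continuous_on_compose2) (auto intro!: ct continuous_intros)
  \<comment> \<open>The rules for integrals with parameters concern the gauge integral over a
    compact interval, so the Lebesgue integral over the open interval is rewritten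
    accordingly.\<close>
  have eq: "av G p = integral (cbox 0 a) (\<lambda>\<beta>. G (\<theta> (\<pi> p, \<beta>))) / a" if G: "continuous_on UNIV G" for G p
  proof -
    have si: "set_integrable lborel {0..a} (\<lambda>\<beta>. G (\<theta> (\<pi> p, \<beta>)))"
      using continuous_on_subset[OF cc[OF G]] by (intro borel_integrable_atLeastAtMost') auto
    have "(\<integral>\<beta>. G (\<theta> (\<pi> p, \<beta>)) \<partial>lb {0<..<a}) = (LINT \<beta>:{0<..<a}|lborel. G (\<theta> (\<pi> p, \<beta>)))"
      by (simp add: set_integral_lb)
    also have "\<dots> = (LINT \<beta>:{0..a}|lborel. G (\<theta> (\<pi> p, \<beta>)))"
      unfolding set_lebesgue_integral_def using cc[OF G]
      by (intro integral_cong_AE borel_measurable_scaleR)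
        (auto intro!: borel_measurable_continuous_onI AE_I[where N="{0,a}"] emeasure_lborel_countable
           simp: indicator_def split: if_splits)
    also have "\<dots> = integral {0..a} (\<lambda>\<beta>. G (\<theta> (\<pi> p, \<beta>)))"
      by (rule set_borel_integral_eq_integral(2)[OF si])
    finally show ?thesis by (simp add: av_def avb_def)
  qed
  have cav: "continuous_on UNIV (av G)" if G: "continuous_on UNIV G" for G
  proof -
    have "continuous_on UNIV (\<lambda>p. integral (cbox 0 a) (\<lambda>\<beta>. G (\<theta> (\<pi> p, \<beta>))))"
    proof (rule integral_continuous_on_param)
      show "continuous_on (UNIV \<times> cbox 0 a) (\<lambda>(p, \<beta>). G (\<theta> (\<pi> p, \<beta>)))"
        unfolding case_prod_beta'
        using G by (rule continuous_on_compose2)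
          (auto intro!: ct continuous_intros continuous_on_compose2[OF continuous_\<pi>[of UNIV]])
    qed
    then show ?thesis unfolding eq[OF G] using a by (intro continuous_intros) auto
  qed
  have "((\<lambda>s. av F (p + s *\<^sub>R h)) has_real_derivative av F' p) (at 0)" for p
  proof -
    have "((\<lambda>s. integral (cbox 0 a) (\<lambda>\<beta>. F (\<theta> (\<pi> p, \<beta>) + s *\<^sub>R h))) has_real_derivative
        integral (cbox 0 a) (\<lambda>\<beta>. F' (\<theta> (\<pi> p, \<beta>) + 0 *\<^sub>R h))) (at 0 within UNIV)"
    proof (rule leibniz_rule_field_derivative)
      fix s \<beta>
      show "((\<lambda>s. F (\<theta> (\<pi> p, \<beta>) + s *\<^sub>R h)) has_real_derivative F' (\<theta> (\<pi> p, \<beta>) + s *\<^sub>R h)) (at s within UNIV)"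
        using cdiff_line[OF F] by simp
      show "(\<lambda>\<beta>. F (\<theta> (\<pi> p, \<beta>) + s *\<^sub>R h)) integrable_on cbox 0 a"
        by (rule integrable_continuous, rule continuous_on_compose2[OF c(1)])
          (auto intro!: ct continuous_intros)
    next
      show "continuous_on (UNIV \<times> cbox 0 a) (\<lambda>(s, \<beta>). F' (\<theta> (\<pi> p, \<beta>) + s *\<^sub>R h))"
        unfolding case_prod_beta'
        using c(2) by (rule continuous_on_compose2) (auto intro!: ct continuous_intros)
    qed auto
    then have "((\<lambda>s. integral (cbox 0 a) (\<lambda>\<beta>. F (\<theta> (\<pi> p, \<beta>) + s *\<^sub>R h)) / a) has_real_derivative
        integral (cbox 0 a) (\<lambda>\<beta>. F' (\<theta> (\<pi> p, \<beta>))) / a) (at 0)"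
      by (intro DERIV_cdivide) simp
    then show ?thesis by (simp add: eq[OF c(1)] eq[OF c(2)] h \<theta>h)
  qed
  then show ?thesis using cav c by (simp add: cdiff_def)
qed

lemma (in fibration) av_L2lim:
  assumes "L2lim (lb V) un u" shows "L2lim (lb V) (\<lambda>n. av (un n)) (av u)"
proof (rule L2lim_bound[where K=1, OF assms])
  note s = L2lim_sqint[OF assms]
  show "sqint (lb V) (av (un n))" "sqint (lb V) (av u)" for n
    using s by (auto intro: av_sqint)
  fix n
  have d: "sqint (lb V) (\<lambda>p. un n p - u p)" using s by (intro sqint_diff)
  have "AE p in lb V. av (\<lambda>p. un n p - u p) p = av (un n) p - av u p"
    unfolding av_def by (rule lift_AE, rule avb_diff_AE) (auto intro!: sqint_imp_integrable finite_V s)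
  then have "(\<integral>p. (av (un n) p - av u p)\<^sup>2 \<partial>lb V) = (\<integral>p. (av (\<lambda>p. un n p - u p) p)\<^sup>2 \<partial>lb V)"
    using sqint_measurable[OF av_sqint[OF s(1)[of n]]] sqint_measurable[OF av_sqint[OF s(2)]]
      sqint_measurable[OF av_sqint[OF d]]
    by (intro integral_cong_AE) auto
  then show "(\<integral>p. (av (un n) p - av u p)\<^sup>2 \<partial>lb V) \<le> 1 * (\<integral>p. (un n p - u p)\<^sup>2 \<partial>lb V)"
    using av_bound[OF d] by simp
qed

text \<open>Averaging does not increase the L^2 norm and preserves differentiability along
  \<open>h\<close>. As \<gamma> maps fibres of the face to fibres of the domain, the trace of the
  average is the average of the trace.\<close>

lemma trV_av:
  assumes V: "fibration V \<theta> \<theta>' U a" and S: "fibration S \<theta>S \<theta>S' SU a"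
    and u: "trV V h S \<gamma> u u' g"
    and h: "\<And>p s. fst (\<theta>' (p + s *\<^sub>R h)) = fst (\<theta>' p) + s *\<^sub>R hU"
    and \<theta>h: "\<And>b \<beta> s. \<theta> (b + s *\<^sub>R hU, \<beta>) = \<theta> (b, \<beta>) + s *\<^sub>R h"
    and \<gamma>: "\<And>s \<beta>. \<theta> (fst (\<theta>' (\<gamma> s)), \<beta>) = \<gamma> (\<theta>S (fst (\<theta>S' s), \<beta>))"
  shows "trV V h S \<gamma> (fibration.av \<theta> \<theta>' a u) (fibration.av \<theta> \<theta>' a u') (fibration.av \<theta>S \<theta>S' a g)"
proof -
  interpret V: fibration V \<theta> \<theta>' U a by fact
  interpret S: fibration S \<theta>S \<theta>S' SU a by fact
  obtain un un' where u: "\<And>n. cdiff h (un n) (un' n)" "L2lim (lb V) un u" "L2lim (lb V) un' u'"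
    "L2lim (lb S) (\<lambda>n s. un n (\<gamma> s)) g" using u by (auto simp: trV_def)
  have "cdiff h (V.av (un n)) (V.av (un' n))" for n
    by (rule V.cdiff_av[where hB=hU, OF u(1)]) (simp_all add: V.\<pi>_def h \<theta>h)
  moreover note V.av_L2lim[OF u(2)] V.av_L2lim[OF u(3)]
  moreover have "V.av (un n) (\<gamma> s) = S.av (\<lambda>s. un n (\<gamma> s)) s" for n s
    by (simp add: V.av_def V.avb_def V.\<pi>_def S.av_def S.avb_def S.\<pi>_def \<gamma>)
  then have "L2lim (lb S) (\<lambda>n s. V.av (un n) (\<gamma> s)) (S.av g)"
    using S.av_L2lim[OF u(4)] by simp
  ultimately show ?thesis unfolding trV_def
    by (intro exI[of _ "\<lambda>n. V.av (un n)"] exI[of _ "\<lambda>n. V.av (un' n)"] conjI allI)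
qed

section \<open>The weighted energy estimate\<close>

text \<open>If \<psi>' = -k, each bracket is the time derivative of \<psi> times a square, so
  integration leaves only initial values. The coefficients 2, 1/2, \<epsilon>^2/2 correspond to
  testing the four equations with 2 r, \<phi>, p and m, the choice for which the spatial terms
  combine to 2 r A + \<phi> B + p C + m E, a sum of derivatives of products.\<close>

lemma energy_pointwise:
  fixes r :: real
  assumes eqs: "2 * r' + A + 2 * w = D1" "\<phi>' + B + \<phi> / \<epsilon>\<^sup>2 = d3"
      "\<epsilon>\<^sup>2 * p' + p + C = d4" "\<epsilon>\<^sup>2 * m' + m + E = d5"
    and \<psi>: "0 \<le> \<psi>" "\<psi> \<le> K" and k: "1 \<le> k" and \<epsilon>: "0 < \<epsilon>" "\<epsilon> \<le> 1"
  shows "(r + \<phi> / 2 + \<epsilon> * (p + m) / 2)\<^sup>2 / 3 \<le>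
      - 2 * (\<psi> * (r * r' + r' * r) + (-k) * (r * r))
      - 1/2 * (\<psi> * (\<phi> * \<phi>' + \<phi>' * \<phi>) + (-k) * (\<phi> * \<phi>))
      - \<epsilon>\<^sup>2/2 * (\<psi> * (p * p' + p' * p) + (-k) * (p * p))
      - \<epsilon>\<^sup>2/2 * (\<psi> * (m * m' + m' * m) + (-k) * (m * m))
      - \<psi> * (2 * r * A + \<phi> * B + p * C + m * E) - 4 * (\<psi> * ((w - W) * r))
      + 8 * K * (\<psi> / k * (W * W)) + 2 * K\<^sup>2 * D1\<^sup>2 + K/4 * d3\<^sup>2 + K/4 * d4\<^sup>2 + K/4 * d5\<^sup>2"
    (is "_ \<le> ?R")
proof -
  have A: "A = D1 - 2 * w - 2 * r'" and B: "B = d3 - \<phi>' - \<phi> / \<epsilon>\<^sup>2"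
    and C: "C = d4 - \<epsilon>\<^sup>2 * p' - p" and E: "E = d5 - \<epsilon>\<^sup>2 * m' - m"
    using eqs by auto
  \<comment> \<open>Substituting the equations cancels all time derivatives. What remains decouples
    into one expression for each of r, \<phi>, p and m.\<close>
  have R: "?R = (2 * k * r\<^sup>2 - 2 * \<psi> * r * D1 + 4 * \<psi> * W * r + 8 * K * (\<psi> / k * (W * W)) + 2 * K\<^sup>2 * D1\<^sup>2)
      + (k/2 * \<phi>\<^sup>2 + \<psi> * (\<phi>\<^sup>2 / \<epsilon>\<^sup>2) - \<psi> * \<phi> * d3 + K/4 * d3\<^sup>2)
      + (\<epsilon>\<^sup>2/2 * k * p\<^sup>2 + \<psi> * p\<^sup>2 - \<psi> * p * d4 + K/4 * d4\<^sup>2)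
      + (\<epsilon>\<^sup>2/2 * k * m\<^sup>2 + \<psi> * m\<^sup>2 - \<psi> * m * d5 + K/4 * d5\<^sup>2)"
    unfolding A B C E by (simp add: power2_eq_square algebra_simps)
  have K: "0 \<le> K" using \<psi> by simp
  have sq: "\<psi> * x\<^sup>2 - \<psi> * x * y + K/4 * y\<^sup>2 \<ge> 0" for x y
  proof -
    have "0 \<le> \<psi> * (x - y/2)\<^sup>2" using \<psi> by simp
    moreover have "0 \<le> (K - \<psi>) / 4 * y\<^sup>2" using \<psi> by simp
    ultimately show ?thesis by (simp add: power2_eq_square algebra_simps)
  qed
  \<comment> \<open>Young's inequality spends k/2 r^2 on the source and k/2 r^2 on \<open>W\<close>,
    so k r^2 of the available 2 k r^2 survives.\<close>
  have "k * r\<^sup>2 \<le> 2 * k * r\<^sup>2 - 2 * \<psi> * r * D1 + 4 * \<psi> * W * r + 8 * K * (\<psi> / k * (W * W)) + 2 * K\<^sup>2 * D1\<^sup>2"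
  proof -
    have 1: "2 * \<psi> * r * D1 \<le> k/2 * r\<^sup>2 + 2 * K\<^sup>2 * D1\<^sup>2"
    proof -
      have "0 \<le> (r - 2 * \<psi> * D1)\<^sup>2 / 2" by simp
      then have "2 * \<psi> * r * D1 \<le> 1/2 * r\<^sup>2 + 2 * (\<psi>\<^sup>2 * D1\<^sup>2)"
        by (simp add: power2_eq_square algebra_simps add_divide_distrib diff_divide_distrib)
      moreover have "\<psi>\<^sup>2 * D1\<^sup>2 \<le> K\<^sup>2 * D1\<^sup>2" using \<psi> by (intro mult_right_mono power_mono) auto
      moreover have "1 * r\<^sup>2 \<le> k * r\<^sup>2" using k by (intro mult_right_mono) auto
      ultimately show ?thesis by simp
    qed
    \<comment> \<open>The square is completed with \<open>k\<close> itself and not with its lower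
      bound 1. The result carries \<psi>^2/k, where 1/k is small in the initial layer; one factor
      \<psi> is then bounded by \<open>K\<close>.\<close>
    have 2: "- 4 * \<psi> * W * r \<le> k/2 * r\<^sup>2 + 8 * K * (\<psi> / k * (W * W))"
    proof -
      have k0: "k > 0" using k by simp
      have "0 \<le> (k * r + 4 * \<psi> * W)\<^sup>2 / (2 * k)" using k0 by simp
      also have "\<dots> = k/2 * r\<^sup>2 + 4 * \<psi> * W * r + 8 * \<psi> * (\<psi> / k * (W * W))"
        using k0 by (simp add: power2_eq_square field_simps)
      also have "\<dots> \<le> k/2 * r\<^sup>2 + 4 * \<psi> * W * r + 8 * K * (\<psi> / k * (W * W))"
        using \<psi> k0 by (intro add_left_mono mult_right_mono) auto
      finally show ?thesis by simp
    qed
    show ?thesis using 1 2 by simp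
  qed
  \<comment> \<open>Since \<epsilon> \<le> 1, the dissipation \<phi>^2/\<epsilon>^2 is at least
    \<phi>^2, which suffices to absorb the residual \<open>d3\<close> uniformly.\<close>
  moreover have "\<phi>\<^sup>2 / 2 \<le> k/2 * \<phi>\<^sup>2 + \<psi> * (\<phi>\<^sup>2 / \<epsilon>\<^sup>2) - \<psi> * \<phi> * d3 + K/4 * d3\<^sup>2"
  proof -
    have "\<phi>\<^sup>2 * \<epsilon>\<^sup>2 \<le> \<phi>\<^sup>2 * 1" using \<epsilon> by (intro mult_left_mono) (auto simp: power_le_one)
    then have "\<phi>\<^sup>2 \<le> \<phi>\<^sup>2 / \<epsilon>\<^sup>2" using \<epsilon> by (simp add: field_simps)
    then have "\<psi> * \<phi>\<^sup>2 \<le> \<psi> * (\<phi>\<^sup>2 / \<epsilon>\<^sup>2)" using \<psi> by (intro mult_left_mono)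
    moreover have "1 * \<phi>\<^sup>2 \<le> k * \<phi>\<^sup>2" using k by (intro mult_right_mono) auto
    ultimately show ?thesis using sq[of \<phi> d3] by simp
  qed
  moreover have "\<epsilon>\<^sup>2/2 * x\<^sup>2 \<le> \<epsilon>\<^sup>2/2 * k * x\<^sup>2 + \<psi> * x\<^sup>2 - \<psi> * x * y + K/4 * y\<^sup>2" for x y
  proof -
    have "\<epsilon>\<^sup>2/2 * (1 * x\<^sup>2) \<le> \<epsilon>\<^sup>2/2 * (k * x\<^sup>2)" using k by (intro mult_left_mono mult_right_mono) auto
    then show ?thesis using sq[of x y] by (simp add: mult.assoc)
  qed
  note this[of p d4] this[of m d5]
  moreover have "(r + \<phi> / 2 + \<epsilon> * (p + m) / 2)\<^sup>2 / 3 \<le> k * r\<^sup>2 + \<phi>\<^sup>2 / 2 + \<epsilon>\<^sup>2/2 * p\<^sup>2 + \<epsilon>\<^sup>2/2 * m\<^sup>2"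
  proof -
    \<comment> \<open>The divisor 3 in the claim is the price for separating the three summands of
      the error of f.\<close>
    have c: "(x + y + z)\<^sup>2 / 3 \<le> x\<^sup>2 + y\<^sup>2 + z\<^sup>2" for x y z :: real
    proof -
      have "0 \<le> ((x - y)\<^sup>2 + (y - z)\<^sup>2 + (x - z)\<^sup>2) / 3" by simp
      then show ?thesis by (simp add: power2_eq_square field_simps)
    qed
    have "(\<epsilon> * (p + m) / 2)\<^sup>2 \<le> \<epsilon>\<^sup>2/2 * p\<^sup>2 + \<epsilon>\<^sup>2/2 * m\<^sup>2"
    proof -
      have "0 \<le> \<epsilon>\<^sup>2 * (p - m)\<^sup>2 / 4" by simp
      then show ?thesis by (simp add: power2_eq_square field_simps)
    qed
    moreover have "(\<phi> / 2)\<^sup>2 \<le> \<phi>\<^sup>2 / 2" by (simp add: power_divide)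
    moreover have "1 * r\<^sup>2 \<le> k * r\<^sup>2" using k by (intro mult_right_mono) auto
    ultimately show ?thesis using c[of r "\<phi>/2" "\<epsilon> * (p + m) / 2"] by simp
  qed
  ultimately show ?thesis unfolding R by linarith
qed

text \<open>Testing with 4 q W, q = \<psi>/k, turns the relaxation term into 4 q W^2. The derivative
  of the weight costs 2 q W^2, because \<epsilon>^2 times the derivative \<omega>' of 1/k is at most
  1/k, and the source costs one more q W^2; thus q W^2 remains.\<close>

lemma average_pointwise:
  fixes W :: real
  assumes eq: "\<epsilon>\<^sup>2 * W' + W = D" and \<psi>: "0 \<le> \<psi>" "\<psi> \<le> K" and k: "1 \<le> k"
    and \<omega>': "\<epsilon>\<^sup>2 * \<omega>' \<le> 1 / k"
  shows "\<psi> / k * (W * W) \<le> - (2 * \<epsilon>\<^sup>2) * (\<psi> / k * (W * W' + W' * W) + (\<omega>' * \<psi> - 1) * (W * W)) + 4 * K * D\<^sup>2"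
proof -
  define q where "q = \<psi> / k"
  have q: "0 \<le> q" "q \<le> K"
  proof -
    show "0 \<le> q" using \<psi> k by (simp add: q_def)
    have "\<psi> / k \<le> \<psi> / 1" using \<psi> k by (intro divide_left_mono) auto
    then show "q \<le> K" using \<psi> by (simp add: q_def)
  qed
  have W': "\<epsilon>\<^sup>2 * W' = D - W" using eq by simp
  have WW: "W * W = W\<^sup>2" by (simp add: power2_eq_square)
  have "- (2 * \<epsilon>\<^sup>2) * (q * (W * W' + W' * W) + (\<omega>' * \<psi> - 1) * W\<^sup>2)
      = - 4 * (q * W * (\<epsilon>\<^sup>2 * W')) - 2 * ((\<epsilon>\<^sup>2 * \<omega>') * (\<psi> * W\<^sup>2)) + 2 * (\<epsilon>\<^sup>2 * W\<^sup>2)"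
    by (simp add: algebra_simps)
  moreover have "(\<epsilon>\<^sup>2 * \<omega>') * (\<psi> * W\<^sup>2) \<le> 1 / k * (\<psi> * W\<^sup>2)"
    using \<omega>' \<psi> by (intro mult_right_mono) auto
  moreover have "1 / k * (\<psi> * W\<^sup>2) = q * W\<^sup>2" by (simp add: q_def)
  moreover have "- 4 * (q * W * (\<epsilon>\<^sup>2 * W')) = 4 * (q * W\<^sup>2) - 4 * (q * W * D)"
    unfolding W' by (simp add: power2_eq_square algebra_simps)
  moreover have "4 * (q * W * D) \<le> q * W\<^sup>2 + 4 * (q * D\<^sup>2)"
  proof -
    have "0 \<le> q * (W - 2 * D)\<^sup>2" using q by simp
    then show ?thesis by (simp add: power2_eq_square algebra_simps)
  qed
  moreover have "q * D\<^sup>2 \<le> K * D\<^sup>2" using q by (intro mult_right_mono) auto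
  moreover have "0 \<le> \<epsilon>\<^sup>2 * W\<^sup>2" by simp
  ultimately show ?thesis unfolding q_def[symmetric] WW by linarith
qed

text \<open>
  \<open>time_weight T q t\<close> is the integral of \<open>layer_density q\<close> over \<open>(t, T)\<close>; it is at most \<open>T + 1\<close> for all \<open>q\<close>,
  although the density is of size \<open>1 / q\<close> for \<open>t \<le> q\<close>. \<open>layer_recip_deriv q\<close> is the derivative of
  \<open>1 / layer_density q\<close>.
\<close>

definition layer_density :: "real \<Rightarrow> real \<Rightarrow> real" where
  "layer_density q t = 1 + exp (- t / q) / q"

definition time_weight :: "real \<Rightarrow> real \<Rightarrow> real \<Rightarrow> real" where
  "time_weight T q t = T - t + exp (- t / q) - exp (- T / q)"

definition layer_recip_deriv :: "real \<Rightarrow> real \<Rightarrow> real" where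
  "layer_recip_deriv q t = exp (- t / q) / q\<^sup>2 / (layer_density q t)\<^sup>2"

lemma layer_density_ge_1: "0 < q \<Longrightarrow> 1 \<le> layer_density q t"
  by (simp add: layer_density_def)

lemma time_weight_T [simp]: "time_weight T q T = 0"
  by (simp add: time_weight_def)

lemma time_weight_bounds:
  assumes "0 < q" "0 \<le> t" "t \<le> T" shows "0 \<le> time_weight T q t" "time_weight T q t \<le> T + 1"
proof -
  have "exp (- T / q) \<le> exp (- t / q)" using assms by (simp add: field_simps)
  then show "0 \<le> time_weight T q t" using assms unfolding time_weight_def by linarith
  have "exp (- t / q) \<le> exp 0" using assms by (intro exp_mono) simp
  moreover have "0 < exp (- T / q)" by simp
  ultimately show "time_weight T q t \<le> T + 1" unfolding time_weight_def exp_zero using assms(2) by linarith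
qed

text \<open>The left-hand side is the exponential part of the density divided by the square of the
  density, and the density dominates that part. With q = \<epsilon>^2 this is the hypothesis on
  \<omega>' in \<open>average_pointwise\<close>.\<close>

lemma layer_recip_deriv_bound: "0 < q \<Longrightarrow> q * layer_recip_deriv q t \<le> 1 / layer_density q t"
proof -
  assume q: "0 < q"
  have k: "0 < layer_density q t" using layer_density_ge_1[OF q, of t] by simp
  have "q * layer_recip_deriv q t = (exp (- t / q) / q) / layer_density q t * (1 / layer_density q t)"
    using q k by (simp add: layer_recip_deriv_def power2_eq_square field_simps)
  also have "\<dots> \<le> 1 * (1 / layer_density q t)"
  proof (rule mult_right_mono)
    have "exp (- t / q) / q \<le> layer_density q t" by (simp add: layer_density_def)
    then show "(exp (- t / q) / q) / layer_density q t \<le> 1" using k by (simp only: divide_le_eq_1_pos)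
  qed (use k in simp)
  finally show ?thesis by simp
qed

lemma cdiff_time_weight: "0 < q \<Longrightarrow> cdiff (1::real) (time_weight T q) (\<lambda>t. - layer_density q t)"
  unfolding time_weight_def[abs_def] layer_density_def
  by (rule cdiff_real) (auto intro!: derivative_eq_intros continuous_intros simp: field_simps)

lemma continuous_layer_density: "0 < q \<Longrightarrow> continuous_on A (layer_density q)"
  unfolding layer_density_def[abs_def] by (auto intro!: continuous_intros)

lemma cdiff_time_weight_quotient:
  assumes q: "0 < q" shows "cdiff (1::real) (\<lambda>t. time_weight T q t / layer_density q t) (\<lambda>t. layer_recip_deriv q t * time_weight T q t - 1)"
proof (rule cdiff_real)
  fix t
  have k: "layer_density q t \<noteq> 0" for t using layer_density_ge_1[OF q, of t] by simp
  have dtime_weight: "(time_weight T q has_real_derivative - layer_density q t) (at t)"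
    unfolding time_weight_def[abs_def] layer_density_def using q by (auto intro!: derivative_eq_intros simp: field_simps)
  have dlayer_density: "(layer_density q has_real_derivative - (exp (- t / q) / q\<^sup>2)) (at t)"
    unfolding layer_density_def[abs_def] using q by (auto intro!: derivative_eq_intros simp: field_simps power2_eq_square)
  have "((\<lambda>t. time_weight T q t / layer_density q t) has_real_derivative
      (- layer_density q t * layer_density q t - time_weight T q t * - (exp (- t / q) / q\<^sup>2)) / (layer_density q t * layer_density q t)) (at t)"
    by (rule DERIV_divide[OF dtime_weight dlayer_density k])
  moreover have "(- layer_density q t * layer_density q t - time_weight T q t * - (exp (- t / q) / q\<^sup>2)) / (layer_density q t * layer_density q t) = layer_recip_deriv q t * time_weight T q t - 1"
    using k[of t] by (simp add: layer_recip_deriv_def power2_eq_square diff_divide_distrib add_divide_distrib)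
  ultimately show "((\<lambda>t. time_weight T q t / layer_density q t) has_real_derivative layer_recip_deriv q t * time_weight T q t - 1) (at t)" by simp
  show "continuous_on UNIV (\<lambda>t. layer_recip_deriv q t * time_weight T q t - 1)"
    unfolding layer_recip_deriv_def time_weight_def using q k continuous_layer_density[OF q]
    by (auto intro!: continuous_intros)
qed

lemma weighted_integrable:
  fixes m :: "'v::euclidean_space \<Rightarrow> real"
  assumes "continuous_on UNIV m" "bounded V" "V \<in> sets borel" "sqint (lb V) u" "sqint (lb V) v"
  shows "integrable (lb V) (\<lambda>p. m p * (u p * v p))"
proof -
  obtain K where K: "\<And>x. x \<in> V \<Longrightarrow> \<bar>m x\<bar> \<le> K"
    using continuous_bounded_on[OF assms(1,2)] by blast
  have "sqint (lb V) (\<lambda>p. m p * u p)"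
    using K assms by (intro sqint_bounded_mult[where K=K] continuous_on_UNIV_borel_lb) auto
  from sqint_mult_integrable[OF this assms(5)] show ?thesis by (simp add: mult.assoc)
qed

text \<open>Here \<tau> is the time coordinate. The weight vanishes where \<tau> = T, so only traces
  on the initial face enter. The sign of the fluctuation term (\<open>orth\<close>) and the lateral
  contribution (\<open>bdry\<close>) stay hypotheses, which keeps the argument independent of the
  space dimension.\<close>

theorem energy_estimate:
  fixes \<tau> :: "'v::euclidean_space \<Rightarrow> real" and S :: "'s::euclidean_space set"
  assumes face: "face V h S \<gamma> \<gamma>' (-1)"
    and \<tau>: "continuous_on UNIV \<tau>" "\<And>p s. \<tau> (p + s *\<^sub>R h) = \<tau> p + s" "\<And>s. \<tau> (\<gamma> s) = 0" "\<And>s. \<tau> (\<gamma>' s) = T"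
      "\<And>p. p \<in> V \<Longrightarrow> 0 \<le> \<tau> p \<and> \<tau> p \<le> T"
    and \<epsilon>: "0 < \<epsilon>" "\<epsilon> \<le> 1" and T: "0 < T"
    and r: "trV V h S \<gamma> r r' r0" and \<phi>: "trV V h S \<gamma> \<phi> \<phi>' \<phi>0"
    and p: "trV V h S \<gamma> p p' p0" and m: "trV V h S \<gamma> m m' m0" and W: "trV V h S \<gamma> W W' W0"
    and sq: "sqint (lb V) w" "sqint (lb V) A" "sqint (lb V) B" "sqint (lb V) C" "sqint (lb V) E"
      "sqint (lb V) D1" "sqint (lb V) d3" "sqint (lb V) d4" "sqint (lb V) d5" "sqint (lb V) D"
    and eqr: "AE z in lb V. 2 * r' z + A z + 2 * w z = D1 z"
    and eq\<phi>: "AE z in lb V. \<phi>' z + B z + \<phi> z / \<epsilon>\<^sup>2 = d3 z"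
    and eqp: "AE z in lb V. \<epsilon>\<^sup>2 * p' z + p z + C z = d4 z"
    and eqm: "AE z in lb V. \<epsilon>\<^sup>2 * m' z + m z + E z = d5 z"
    and eqW: "AE z in lb V. \<epsilon>\<^sup>2 * W' z + W z = D z"
    and orth: "0 \<le> (\<integral>z. time_weight T (\<epsilon>\<^sup>2) (\<tau> z) * ((w z - W z) * r z) \<partial>lb V)"
    and bdry: "- (\<integral>z. time_weight T (\<epsilon>\<^sup>2) (\<tau> z) * (2 * r z * A z + \<phi> z * B z + p z * C z + m z * E z) \<partial>lb V) \<le> \<beta>"
  shows "(\<integral>z. (r z + \<phi> z / 2 + \<epsilon> * (p z + m z) / 2)\<^sup>2 \<partial>lb V) \<le> 96 * (T + 1) ^ 3 *
     ((\<integral>s. (r0 s)\<^sup>2 \<partial>lb S) + (\<integral>s. (\<phi>0 s)\<^sup>2 \<partial>lb S) + \<epsilon>\<^sup>2 * (\<integral>s. (p0 s)\<^sup>2 \<partial>lb S) + \<epsilon>\<^sup>2 * (\<integral>s. (m0 s)\<^sup>2 \<partial>lb S)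
      + \<epsilon>^4 * (\<integral>s. (W0 s)\<^sup>2 \<partial>lb S) + (\<integral>z. (D1 z)\<^sup>2 \<partial>lb V) + (\<integral>z. (d3 z)\<^sup>2 \<partial>lb V) + (\<integral>z. (d4 z)\<^sup>2 \<partial>lb V)
      + (\<integral>z. (d5 z)\<^sup>2 \<partial>lb V) + (\<integral>z. (D z)\<^sup>2 \<partial>lb V)) + 3 * \<beta>"
proof -
  define q where "q = \<epsilon>\<^sup>2"
  have q: "0 < q" using \<epsilon> by (simp add: q_def)
  have V: "bounded V" "V \<in> sets borel" and S: "bounded S" "S \<in> sets borel" using face by (auto simp: face_def)
  define K where "K = T + 1"
  have K: "1 \<le> K" using T by (simp add: K_def)
  define P where "P z = time_weight T q (\<tau> z)" for z
  define k where "k z = layer_density q (\<tau> z)" for z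
  have P: "0 \<le> P z" "P z \<le> K" if "z \<in> V" for z
    using time_weight_bounds[OF q, of "\<tau> z" T] \<tau>(5)[OF that] by (auto simp: P_def K_def)
  have k1: "1 \<le> k z" for z using layer_density_ge_1[OF q] by (simp add: k_def)
  have cdP: "cdiff h P (\<lambda>z. - k z)"
    unfolding P_def k_def by (rule cdiff_compose[OF cdiff_time_weight[OF q] \<tau>(1)]) (simp add: \<tau>(2))
  have cdPk: "cdiff h (\<lambda>z. P z / k z) (\<lambda>z. layer_recip_deriv q (\<tau> z) * P z - 1)"
    unfolding P_def k_def by (rule cdiff_compose[OF cdiff_time_weight_quotient[OF q] \<tau>(1)]) (simp add: \<tau>(2))
  have cP: "continuous_on UNIV P" "continuous_on UNIV (\<lambda>z. - k z)" using cdP by (auto simp: cdiff_def)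
  have cPk: "continuous_on UNIV (\<lambda>z. P z / k z)" "continuous_on UNIV (\<lambda>z. layer_recip_deriv q (\<tau> z) * P z - 1)"
    using cdPk by (auto simp: cdiff_def)
  note wi = weighted_integrable[OF _ V]
  define P0 where "P0 = time_weight T q 0"
  have P0: "0 \<le> P0" "P0 \<le> K" using time_weight_bounds[OF q, of 0 T] T by (auto simp: P0_def K_def)
  define G where "G u u' z = P z * (u z * u' z + u' z * u z) + (- k z) * (u z * u z)" for u u' z
  have G: "integrable (lb V) (G u u')" "integral\<^sup>L (lb V) (G u u') = - P0 * (\<integral>s. (g s)\<^sup>2 \<partial>lb S)"
    if u: "trV V h S \<gamma> u u' g" for u u' g
  proof -
    note s = trV_sqint[OF u]
    have "integrable (lb V) (\<lambda>z. P z * (u z * u' z) + P z * (u' z * u z) + (- k z) * (u z * u z))"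
      by (intro Bochner_Integration.integrable_add wi cP s)
    then show "integrable (lb V) (G u u')" by (simp add: G_def[abs_def] algebra_simps)
    show "integral\<^sup>L (lb V) (G u u') = - P0 * (\<integral>s. (g s)\<^sup>2 \<partial>lb S)"
      unfolding G_def
      by (subst green[OF face u u cdP]) (simp_all add: P_def \<tau> P0_def power2_eq_square)
  qed
  define G2 where "G2 z = P z / k z * (W z * W' z + W' z * W z) + (layer_recip_deriv q (\<tau> z) * P z - 1) * (W z * W z)" for z
  have G2: "integrable (lb V) G2" "integral\<^sup>L (lb V) G2 = - (P0 / layer_density q 0) * (\<integral>s. (W0 s)\<^sup>2 \<partial>lb S)"
  proof -
    note s = trV_sqint[OF W]
    have "integrable (lb V) (\<lambda>z. P z / k z * (W z * W' z) + P z / k z * (W' z * W z)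
        + (layer_recip_deriv q (\<tau> z) * P z - 1) * (W z * W z))"
      by (intro Bochner_Integration.integrable_add wi cPk s)
    moreover have "(\<lambda>z. P z / k z * (W z * W' z) + P z / k z * (W' z * W z)
        + (layer_recip_deriv q (\<tau> z) * P z - 1) * (W z * W z)) = G2"
      by (rule ext) (simp only: G2_def distrib_left)
    ultimately show "integrable (lb V) G2" by simp
    show "integral\<^sup>L (lb V) G2 = - (P0 / layer_density q 0) * (\<integral>s. (W0 s)\<^sup>2 \<partial>lb S)"
      unfolding G2_def
      by (subst green[OF face W W cdPk]) (simp_all add: P_def k_def \<tau> P0_def power2_eq_square)
  qed
  define F where "F z = P z / k z * (W z * W z)" for z
  have iF: "integrable (lb V) F" unfolding F_def by (intro wi cPk trV_sqint[OF W])
  have iD: "integrable (lb V) (\<lambda>z. (D z)\<^sup>2)" using sq by (intro sqint_integrable_sq)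
  have Fle: "integral\<^sup>L (lb V) F \<le> 2 * K * (\<epsilon>^4 * (\<integral>s. (W0 s)\<^sup>2 \<partial>lb S)) + 4 * K * (\<integral>z. (D z)\<^sup>2 \<partial>lb V)"
  proof -
    have "integral\<^sup>L (lb V) F \<le> (\<integral>z. - (2 * \<epsilon>\<^sup>2) * G2 z + 4 * K * (D z)\<^sup>2 \<partial>lb V)"
    proof (rule integral_mono_AE[OF iF])
      show "integrable (lb V) (\<lambda>z. - (2 * \<epsilon>\<^sup>2) * G2 z + 4 * K * (D z)\<^sup>2)" using G2(1) iD by simp
      show "AE z in lb V. F z \<le> - (2 * \<epsilon>\<^sup>2) * G2 z + 4 * K * (D z)\<^sup>2"
        using eqW AE_space
      proof eventually_elim
        fix z assume e: "\<epsilon>\<^sup>2 * W' z + W z = D z" and "z \<in> space (lb V)"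
        then have "z \<in> V" using V by simp
        then show "F z \<le> - (2 * \<epsilon>\<^sup>2) * G2 z + 4 * K * (D z)\<^sup>2"
          unfolding F_def G2_def using P[of z] k1[of z] layer_recip_deriv_bound[OF q, of "\<tau> z"]
          by (intro average_pointwise[OF e]) (simp_all add: k_def q_def)
      qed
    qed
    also have "\<dots> = 2 * \<epsilon>\<^sup>2 * (P0 / layer_density q 0) * (\<integral>s. (W0 s)\<^sup>2 \<partial>lb S) + 4 * K * (\<integral>z. (D z)\<^sup>2 \<partial>lb V)"
      using G2 iD by simp
    also have "\<dots> \<le> 2 * K * (\<epsilon>^4 * (\<integral>s. (W0 s)\<^sup>2 \<partial>lb S)) + 4 * K * (\<integral>z. (D z)\<^sup>2 \<partial>lb V)"
    proof -
      \<comment> \<open>The density at time 0 is 1 + 1/q. Its reciprocal supplies the second factor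
        \<epsilon>^2 in \<epsilon>^4 W0^2.\<close>
      have "1 / layer_density q 0 \<le> q" using q by (simp add: layer_density_def field_simps)
      then have "P0 * (1 / layer_density q 0) \<le> K * q"
        using P0 q K layer_density_ge_1[OF q, of 0] by (intro mult_mono) auto
      then have "2 * \<epsilon>\<^sup>2 * (P0 / layer_density q 0) * (\<integral>s. (W0 s)\<^sup>2 \<partial>lb S) \<le> 2 * \<epsilon>\<^sup>2 * (K * q) * (\<integral>s. (W0 s)\<^sup>2 \<partial>lb S)"
        by (intro mult_right_mono mult_left_mono) auto
      also have "\<dots> = 2 * K * (\<epsilon>^4 * (\<integral>s. (W0 s)\<^sup>2 \<partial>lb S))"
        by (simp add: q_def power4_eq_xxxx power2_eq_square algebra_simps)
      finally show ?thesis by simp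
    qed
    finally show ?thesis .
  qed
  define H where "H z = P z * (2 * r z * A z + \<phi> z * B z + p z * C z + m z * E z)" for z
  define J where "J z = P z * ((w z - W z) * r z)" for z
  note sr = trV_sqint[OF r] and s\<phi> = trV_sqint[OF \<phi>] and sp = trV_sqint[OF p] and sm = trV_sqint[OF m] and sW = trV_sqint[OF W]
  have iH: "integrable (lb V) H"
  proof -
    have "integrable (lb V) (\<lambda>z. 2 * (P z * (r z * A z)) + P z * (\<phi> z * B z) + P z * (p z * C z) + P z * (m z * E z))"
      by (intro Bochner_Integration.integrable_add integrable_mult_right wi cP sr s\<phi> sp sm sq)
    then show ?thesis by (simp add: H_def[abs_def] algebra_simps)
  qed
  have iJ: "integrable (lb V) J" unfolding J_def by (intro wi cP sqint_diff sq sW sr)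
  have i: "integrable (lb V) (\<lambda>z. (D1 z)\<^sup>2)" "integrable (lb V) (\<lambda>z. (d3 z)\<^sup>2)" "integrable (lb V) (\<lambda>z. (d4 z)\<^sup>2)"
    "integrable (lb V) (\<lambda>z. (d5 z)\<^sup>2)"
    using sq by (auto intro: sqint_integrable_sq)
  have if2: "integrable (lb V) (\<lambda>z. (r z + \<phi> z / 2 + \<epsilon> * (p z + m z) / 2)\<^sup>2)"
  proof -
    have "sqint (lb V) (\<lambda>z. r z + 1/2 * \<phi> z + \<epsilon>/2 * (p z + m z))"
      by (intro sqint_add sqint_cmult sr s\<phi> sp sm)
    then show ?thesis by (auto dest!: sqint_integrable_sq)
  qed
  define X where "X z = - 2 * G r r' z - 1/2 * G \<phi> \<phi>' z - \<epsilon>\<^sup>2/2 * G p p' z - \<epsilon>\<^sup>2/2 * G m m' z - H z - 4 * J z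
      + 8 * K * F z + 2 * K\<^sup>2 * (D1 z)\<^sup>2 + K/4 * (d3 z)\<^sup>2 + K/4 * (d4 z)\<^sup>2 + K/4 * (d5 z)\<^sup>2" for z
  note ints = G(1)[OF r] G(1)[OF \<phi>] G(1)[OF p] G(1)[OF m] iH iJ iF i
  have iX: "integrable (lb V) X" unfolding X_def
    by (intro Bochner_Integration.integrable_add Bochner_Integration.integrable_diff integrable_mult_right ints)
  have "(\<integral>z. (r z + \<phi> z / 2 + \<epsilon> * (p z + m z) / 2)\<^sup>2 / 3 \<partial>lb V) \<le> integral\<^sup>L (lb V) X"
  proof (rule integral_mono_AE[OF _ iX])
    show "AE z in lb V. (r z + \<phi> z / 2 + \<epsilon> * (p z + m z) / 2)\<^sup>2 / 3 \<le> X z"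
      using eqr eq\<phi> eqp eqm AE_space
    proof eventually_elim
      fix z assume e: "2 * r' z + A z + 2 * w z = D1 z" "\<phi>' z + B z + \<phi> z / \<epsilon>\<^sup>2 = d3 z"
        "\<epsilon>\<^sup>2 * p' z + p z + C z = d4 z" "\<epsilon>\<^sup>2 * m' z + m z + E z = d5 z" and "z \<in> space (lb V)"
      then have "z \<in> V" using V by simp
      from energy_pointwise[OF e P[OF this] k1[of z] \<epsilon>, where r="r z" and W="W z"]
      show "(r z + \<phi> z / 2 + \<epsilon> * (p z + m z) / 2)\<^sup>2 / 3 \<le> X z"
        unfolding X_def G_def H_def J_def F_def .
    qed
  qed (use if2 in simp)
  also have "integral\<^sup>L (lb V) X = P0 * (2 * (\<integral>s. (r0 s)\<^sup>2 \<partial>lb S) + 1/2 * (\<integral>s. (\<phi>0 s)\<^sup>2 \<partial>lb S)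
      + 1/2 * (\<epsilon>\<^sup>2 * (\<integral>s. (p0 s)\<^sup>2 \<partial>lb S)) + 1/2 * (\<epsilon>\<^sup>2 * (\<integral>s. (m0 s)\<^sup>2 \<partial>lb S))) - integral\<^sup>L (lb V) H - 4 * integral\<^sup>L (lb V) J
      + 8 * K * integral\<^sup>L (lb V) F + 2 * K\<^sup>2 * (\<integral>z. (D1 z)\<^sup>2 \<partial>lb V) + K/4 * (\<integral>z. (d3 z)\<^sup>2 \<partial>lb V)
      + K/4 * (\<integral>z. (d4 z)\<^sup>2 \<partial>lb V) + K/4 * (\<integral>z. (d5 z)\<^sup>2 \<partial>lb V)"
    unfolding X_def using ints G(2)[OF r] G(2)[OF \<phi>] G(2)[OF p] G(2)[OF m] by (simp add: algebra_simps)
  finally have main: "(\<integral>z. (r z + \<phi> z / 2 + \<epsilon> * (p z + m z) / 2)\<^sup>2 / 3 \<partial>lb V) \<le> \<dots>" .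
  define a1 a2 a3 a4 a5 where "a1 = (\<integral>s. (r0 s)\<^sup>2 \<partial>lb S)" and "a2 = (\<integral>s. (\<phi>0 s)\<^sup>2 \<partial>lb S)"
    and "a3 = \<epsilon>\<^sup>2 * (\<integral>s. (p0 s)\<^sup>2 \<partial>lb S)" and "a4 = \<epsilon>\<^sup>2 * (\<integral>s. (m0 s)\<^sup>2 \<partial>lb S)"
    and "a5 = \<epsilon>^4 * (\<integral>s. (W0 s)\<^sup>2 \<partial>lb S)"
  define b1 b3 b4 b5 b6 where "b1 = (\<integral>z. (D1 z)\<^sup>2 \<partial>lb V)" and "b3 = (\<integral>z. (d3 z)\<^sup>2 \<partial>lb V)"
    and "b4 = (\<integral>z. (d4 z)\<^sup>2 \<partial>lb V)" and "b5 = (\<integral>z. (d5 z)\<^sup>2 \<partial>lb V)" and "b6 = (\<integral>z. (D z)\<^sup>2 \<partial>lb V)"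
  have nn: "0 \<le> a1" "0 \<le> a2" "0 \<le> a3" "0 \<le> a4" "0 \<le> a5" "0 \<le> b1" "0 \<le> b3" "0 \<le> b4" "0 \<le> b5" "0 \<le> b6"
    by (auto simp: a1_def a2_def a3_def a4_def a5_def b1_def b3_def b4_def b5_def b6_def)
  have HJ: "- integral\<^sup>L (lb V) H \<le> \<beta>" "0 \<le> integral\<^sup>L (lb V) J"
    using bdry orth unfolding H_def[abs_def] J_def[abs_def] P_def q_def by blast+
  have F8: "8 * K * integral\<^sup>L (lb V) F \<le> 8 * K * (2 * K * a5 + 4 * K * b6)"
    using Fle K by (intro mult_left_mono) (auto simp: a5_def b6_def)
  have main': "(\<integral>z. (r z + \<phi> z / 2 + \<epsilon> * (p z + m z) / 2)\<^sup>2 \<partial>lb V) / 3 \<le>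
     P0 * (2 * a1 + 1/2 * a2 + 1/2 * a3 + 1/2 * a4) + \<beta> + 8 * K * (2 * K * a5 + 4 * K * b6)
     + 2 * K\<^sup>2 * b1 + K/4 * b3 + K/4 * b4 + K/4 * b5"
    using main HJ F8 by (simp add: a1_def a2_def a3_def a4_def b1_def b3_def b4_def b5_def)
  have "K \<le> K ^ 3" using power_increasing[of 1 3 K] K by simp
  have K3: "1 * K \<le> K ^ 3" "K\<^sup>2 \<le> K ^ 3" using power_increasing[of 1 3 K] power_increasing[of 2 3 K] K by auto
  \<comment> \<open>A common bound for all coefficients: the largest is 32 K^2, in front of
    \<open>b6\<close>. Together with the divisor 3 of the pointwise bound it gives the constant
    96.\<close>
  have up: "c * x \<le> 32 * K ^ 3 * x" if "0 \<le> x" "c \<le> 32 * K ^ 3" for c x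
    using that by (intro mult_right_mono)
  have "P0 * (2 * a1 + 1/2 * a2 + 1/2 * a3 + 1/2 * a4) \<le> K * (2 * a1 + 1/2 * a2 + 1/2 * a3 + 1/2 * a4)"
    using P0 nn by (intro mult_right_mono) auto
  also have "\<dots> = (2 * K) * a1 + (K/2) * a2 + (K/2) * a3 + (K/2) * a4" by (simp add: algebra_simps)
  also have "\<dots> \<le> 32 * K ^ 3 * a1 + 32 * K ^ 3 * a2 + 32 * K ^ 3 * a3 + 32 * K ^ 3 * a4"
    using nn K3 K by (intro add_mono up) auto
  finally have 1: "P0 * (2 * a1 + 1/2 * a2 + 1/2 * a3 + 1/2 * a4) \<le> 32 * K ^ 3 * (a1 + a2 + a3 + a4)"
    by (simp add: algebra_simps)
  have "8 * K * (2 * K * a5 + 4 * K * b6) + 2 * K\<^sup>2 * b1 + K/4 * b3 + K/4 * b4 + K/4 * b5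
      = (16 * K\<^sup>2) * a5 + (32 * K\<^sup>2) * b6 + (2 * K\<^sup>2) * b1 + (K/4) * b3 + (K/4) * b4 + (K/4) * b5"
    by (simp add: power2_eq_square algebra_simps)
  also have "\<dots> \<le> 32 * K ^ 3 * a5 + 32 * K ^ 3 * b6 + 32 * K ^ 3 * b1 + 32 * K ^ 3 * b3 + 32 * K ^ 3 * b4 + 32 * K ^ 3 * b5"
    using nn K3 K by (intro add_mono up) auto
  finally have 2: "8 * K * (2 * K * a5 + 4 * K * b6) + 2 * K\<^sup>2 * b1 + K/4 * b3 + K/4 * b4 + K/4 * b5
      \<le> 32 * K ^ 3 * (a5 + b6 + b1 + b3 + b4 + b5)" by (simp add: algebra_simps)
  have "(\<integral>z. (r z + \<phi> z / 2 + \<epsilon> * (p z + m z) / 2)\<^sup>2 \<partial>lb V) / 3 \<le>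
      32 * K ^ 3 * (a1 + a2 + a3 + a4) + 32 * K ^ 3 * (a5 + b6 + b1 + b3 + b4 + b5) + \<beta>"
    using main' 1 2 by linarith
  then show ?thesis
    unfolding K_def[symmetric] a1_def[symmetric] a2_def[symmetric] a3_def[symmetric] a4_def[symmetric] a5_def[symmetric]
      b1_def[symmetric] b3_def[symmetric] b4_def[symmetric] b5_def[symmetric] b6_def[symmetric]
    by (simp add: algebra_simps)
qed

section \<open>Smooth functions\<close>

lemma Ck_differentiable: "Ck (Suc k) f \<Longrightarrow> f differentiable (at p)"
  by simp

lemma differentiable_imp_continuous_UNIV:
  "(\<And>p. f differentiable (at p)) \<Longrightarrow> continuous_on UNIV f"
  by (meson continuous_at_imp_continuous_on differentiable_imp_continuous_within)

lemma Ck_Suc_imp: "Ck (Suc k) f \<Longrightarrow> Ck k f"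
proof (induction k arbitrary: f)
  case 0
  then show ?case by (simp add: differentiable_imp_continuous_UNIV)
next
  case (Suc k)
  have "Ck k (pd h f)" if "h \<in> Basis" for h
    using Suc.prems that by (intro Suc.IH) simp
  then show ?case using Suc.prems by simp
qed

lemma smooth_continuous: "smooth f \<Longrightarrow> continuous_on UNIV f"
  unfolding smooth_def by (metis Ck.simps(1))

lemma smooth_differentiable: "smooth f \<Longrightarrow> f differentiable (at p)"
  unfolding smooth_def using Ck_differentiable by blast

lemma smooth_pd: "smooth f \<Longrightarrow> h \<in> Basis \<Longrightarrow> smooth (pd h f)"
  unfolding smooth_def by (metis Ck.simps(2))

lemma has_real_derivative_along:
  assumes "f differentiable (at p)"
  shows "((\<lambda>s. f (p + s *\<^sub>R h)) has_real_derivative pd h f p) (at 0)"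
proof -
  have f: "(f has_derivative frechet_derivative f (at p)) (at p)"
    using assms frechet_derivative_works by blast
  have g: "((\<lambda>s. p + s *\<^sub>R h) has_derivative (\<lambda>s. s *\<^sub>R h)) (at 0)"
    by (auto intro!: derivative_eq_intros)
  have "((\<lambda>s. f (p + s *\<^sub>R h)) has_derivative (\<lambda>s. frechet_derivative f (at p) (s *\<^sub>R h))) (at 0)"
    using has_derivative_compose[OF g, of f] f by simp
  moreover have "frechet_derivative f (at p) (s *\<^sub>R h) = pd h f p * s" for s
    using linear_frechet_derivative[OF assms] by (simp add: linear_scale)
  ultimately show ?thesis by (simp add: has_field_derivative_def)
qed

lemma smooth_cdiff: "smooth f \<Longrightarrow> h \<in> Basis \<Longrightarrow> cdiff h f (pd h f)"
  by (simp add: cdiff_def smooth_continuous smooth_pd has_real_derivative_along smooth_differentiable)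

lemma Ck_const: "Ck k (\<lambda>_. c)"
proof (induction k arbitrary: c)
  case (Suc k)
  have "pd h (\<lambda>_::'a. c) = (\<lambda>_. 0)" for h by (rule ext) simp
  then show ?case using Suc by simp
qed simp

lemma pd_eqI: "(f has_derivative f') (at p) \<Longrightarrow> pd h f p = f' h"
  by (metis frechet_derivative_at)

lemma Ck_add: "Ck k f \<Longrightarrow> Ck k g \<Longrightarrow> Ck k (\<lambda>p. f p + g p)"
proof (induction k arbitrary: f g)
  case 0
  then show ?case by (auto intro: continuous_intros)
next
  case (Suc k)
  have "pd h (\<lambda>p. f p + g p) = (\<lambda>p. pd h f p + pd h g p)" for h
  proof
    fix p
    have "(f has_derivative frechet_derivative f (at p)) (at p)" "(g has_derivative frechet_derivative g (at p)) (at p)"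
      using Suc.prems by (simp_all add: frechet_derivative_works[symmetric])
    from pd_eqI[OF has_derivative_add[OF this]]
    show "pd h (\<lambda>p. f p + g p) p = pd h f p + pd h g p" .
  qed
  then show ?case using Suc by simp
qed

lemma Ck_mult: "Ck k f \<Longrightarrow> Ck k g \<Longrightarrow> Ck k (\<lambda>p. f p * g p)"
proof (induction k arbitrary: f g)
  case 0
  then show ?case by (auto intro: continuous_intros)
next
  case (Suc k)
  have pd: "pd h (\<lambda>p. f p * g p) = (\<lambda>p. f p * pd h g p + pd h f p * g p)" for h
  proof
    fix p
    have "(f has_derivative frechet_derivative f (at p)) (at p)" "(g has_derivative frechet_derivative g (at p)) (at p)"
      using Suc.prems by (simp_all add: frechet_derivative_works[symmetric])
    from pd_eqI[OF has_derivative_mult[OF this]]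
    show "pd h (\<lambda>p. f p * g p) p = f p * pd h g p + pd h f p * g p" .
  qed
  have "Ck k (\<lambda>p. f p * pd h g p + pd h f p * g p)" if "h \<in> Basis" for h
    using Suc.prems Ck_Suc_imp[of k f] Ck_Suc_imp[of k g] that by (intro Ck_add Suc.IH) auto
  then show ?case using Suc.prems pd by simp
qed

lemma Ck_inner: "Ck k (\<lambda>p. p \<bullet> b)"
proof (cases k)
  case 0
  then show ?thesis by (auto intro: continuous_intros)
next
  case (Suc l)
  have d: "((\<lambda>p. p \<bullet> b) has_derivative (\<lambda>h. h \<bullet> b)) (at p)" for p
    by (auto intro!: derivative_eq_intros)
  have "pd h (\<lambda>p. p \<bullet> b) = (\<lambda>_. h \<bullet> b)" for h
    by (rule ext) (rule pd_eqI[OF d])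
  moreover have "(\<lambda>p. p \<bullet> b) differentiable (at p)" for p using d differentiable_def by blast
  ultimately show ?thesis using Suc by (simp add: Ck_const)
qed

text \<open>The sequence \<open>D\<close> lists all derivatives of the outer function. The induction
  varies \<open>n\<close>, since differentiating the composition with \<open>D n\<close> produces
  \<open>D (Suc n)\<close>.\<close>

lemma Ck_compose:
  assumes D: "\<And>n x. (D n has_real_derivative D (Suc n) x) (at x)"
  shows "Ck k f \<Longrightarrow> Ck k (\<lambda>p. D n (f p))"
proof (induction k arbitrary: n)
  case 0
  have "continuous_on UNIV (D n)"
    using D[of n] by (meson DERIV_continuous continuous_at_imp_continuous_on)
  then show ?case using 0 by (auto intro: continuous_on_compose2[of UNIV "D n"])
next
  case (Suc k)
  have d: "((\<lambda>p. D n (f p)) has_derivative (\<lambda>h. D (Suc n) (f p) * pd h f p)) (at p)" for p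
  proof -
    have "(f has_derivative frechet_derivative f (at p)) (at p)"
      using Suc.prems by (simp add: frechet_derivative_works[symmetric])
    moreover have "(D n has_derivative (*) (D (Suc n) (f p))) (at (f p))"
      using D[of n "f p"] by (simp add: has_field_derivative_def)
    ultimately show ?thesis by (rule has_derivative_compose)
  qed
  have "pd h (\<lambda>p. D n (f p)) = (\<lambda>p. D (Suc n) (f p) * pd h f p)" for h
    by (rule ext) (rule pd_eqI[OF d])
  moreover have "(\<lambda>p. D n (f p)) differentiable (at p)" for p using d differentiable_def by blast
  moreover have "Ck k (\<lambda>p. D (Suc n) (f p) * pd h f p)" if "h \<in> Basis" for h
    using Suc.prems Ck_Suc_imp[of k f] that by (intro Ck_mult Suc.IH) auto
  ultimately show ?case by simp
qed

lemma smooth_const: "smooth (\<lambda>_. c)" by (simp add: smooth_def Ck_const)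
lemma smooth_add: "smooth f \<Longrightarrow> smooth g \<Longrightarrow> smooth (\<lambda>p. f p + g p)" by (simp add: smooth_def Ck_add)
lemma smooth_mult: "smooth f \<Longrightarrow> smooth g \<Longrightarrow> smooth (\<lambda>p. f p * g p)" by (simp add: smooth_def Ck_mult)
lemma smooth_inner: "smooth (\<lambda>p. p \<bullet> b)" by (simp add: smooth_def Ck_inner)

lemma smooth_compose:
  assumes "\<And>n x. (D n has_real_derivative D (Suc n) x) (at x)" "smooth f"
  shows "smooth (\<lambda>p. D n (f p))"
  using assms(2) Ck_compose[of D, OF assms(1)] unfolding smooth_def by blast

lemma smooth_exp: "smooth f \<Longrightarrow> smooth (\<lambda>p. exp (f p))"
  by (rule smooth_compose[of "\<lambda>_. exp"]) (auto intro!: derivative_eq_intros)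

lemma smooth_prod: "finite A \<Longrightarrow> (\<And>i. i \<in> A \<Longrightarrow> smooth (f i)) \<Longrightarrow> smooth (\<lambda>p. \<Prod>i\<in>A. f i p)"
  by (induction A rule: finite_induct) (auto intro: smooth_const smooth_mult)

section \<open>Bump functions\<close>

text \<open>The family \<open>bumpD P\<close> is closed under differentiation; this gives smoothness of \<open>bumpD 1\<close>.\<close>

definition bumpD :: "real poly \<Rightarrow> real \<Rightarrow> real" where
  "bumpD P x = (if 0 < x then poly P (inverse x) * exp (- inverse x) else 0)"

lemma poly_exp_tendsto_0: "((\<lambda>y. poly P y * exp (- y)) \<longlongrightarrow> 0) at_top" for P :: "real poly"
proof -
  have "((\<lambda>y. \<Sum>i\<le>degree P. coeff P i * (y ^ i / exp y)) \<longlongrightarrow> (\<Sum>i\<le>degree P. coeff P i * 0)) at_top"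
    by (intro tendsto_sum tendsto_mult_left tendsto_power_div_exp_0)
  moreover have "(\<Sum>i\<le>degree P. coeff P i * (y ^ i / exp y)) = poly P y * exp (- y)" for y
    by (simp add: poly_altdef exp_minus sum_distrib_right divide_inverse mult.assoc)
  ultimately show ?thesis by simp
qed

text \<open>With y = 1/x, the x-derivative of P(y) exp(-y) is y^2 (P - P')(y) exp(-y), and
  \<open>[:0,0,1:]\<close> is the polynomial y^2. At 0 the difference quotient from the right is y
  P(y) exp(-y), which tends to 0 as y tends to infinity.\<close>

lemma bumpD_deriv: "(bumpD P has_real_derivative bumpD ([:0,0,1:] * (P - pderiv P)) x) (at x)"
proof -
  consider "x > 0" | "x < 0" | "x = 0" by linarith
  then show ?thesis
  proof cases
    case 1
    have "((\<lambda>x. poly P (inverse x) * exp (- inverse x)) has_real_derivative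
        bumpD ([:0,0,1:] * (P - pderiv P)) x) (at x)"
      using 1 by (auto intro!: derivative_eq_intros DERIV_chain'[OF _ poly_DERIV]
          simp: bumpD_def field_simps power2_eq_square)
    then show ?thesis
      by (rule has_field_derivative_transform_within_open[of _ _ _ "{0<..}"]) (use 1 in \<open>auto simp: bumpD_def\<close>)
  next
    case 2
    have "((\<lambda>x. 0) has_real_derivative bumpD ([:0,0,1:] * (P - pderiv P)) x) (at x)"
      using 2 by (simp add: bumpD_def)
    then show ?thesis
      by (rule has_field_derivative_transform_within_open[of _ _ _ "{..<0}"]) (use 2 in \<open>auto simp: bumpD_def\<close>)
  next
    case 3
    have "((\<lambda>y. bumpD P y / y) \<longlongrightarrow> 0) (at 0)"
    proof (rule filterlim_split_at)
      show "((\<lambda>y. bumpD P y / y) \<longlongrightarrow> 0) (at_left 0)"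
        by (rule tendsto_eventually) (auto simp: eventually_at_filter bumpD_def)
      have "((\<lambda>y. poly (pCons 0 P) (inverse y) * exp (- inverse y)) \<longlongrightarrow> 0) (at_right (0::real))"
        by (rule filterlim_compose[OF poly_exp_tendsto_0 filterlim_inverse_at_top_right])
      moreover have "\<forall>\<^sub>F y in at_right 0. poly (pCons 0 P) (inverse y) * exp (- inverse y) = bumpD P y / y"
        by (auto simp: eventually_at_filter bumpD_def divide_inverse)
      ultimately show "((\<lambda>y. bumpD P y / y) \<longlongrightarrow> 0) (at_right 0)"
        by (rule Lim_transform_eventually)
    qed
    then show ?thesis using 3 by (simp add: has_field_derivative_iff bumpD_def)
  qed
qed

definition bump :: "real \<Rightarrow> real" where "bump = bumpD 1"

lemma bump_pos: "0 < x \<Longrightarrow> 0 < bump x" and bump_zero: "x \<le> 0 \<Longrightarrow> bump x = 0"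
  and bump_nonneg: "0 \<le> bump x"
  by (auto simp: bump_def bumpD_def)

lemma smooth_bump: "smooth f \<Longrightarrow> smooth (\<lambda>p. bump (f p))"
proof -
  assume f: "smooth f"
  define D where "D n = bumpD (((\<lambda>P. [:0,0,1:] * (P - pderiv P)) ^^ n) 1)" for n
  have "smooth (\<lambda>p. D 0 (f p))"
    using f by (rule smooth_compose[rotated]) (auto simp: D_def intro: bumpD_deriv simp del: mult_pCons_left)
  then show ?thesis by (simp add: D_def bump_def)
qed

lemma continuous_bump: "continuous_on A bump"
  unfolding bump_def using bumpD_deriv[of 1] by (meson DERIV_continuous continuous_at_imp_continuous_on)

text \<open>Differences are written as sums with negated terms, so that smoothness follows from the
  rules for sums and products.\<close>

definition box_bump :: "'a::euclidean_space \<Rightarrow> 'a \<Rightarrow> 'a \<Rightarrow> real" where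
  "box_bump c d p = (\<Prod>b\<in>Basis. bump (p \<bullet> b + (- (c \<bullet> b))) * bump (d \<bullet> b + (-1) * (p \<bullet> b)))"

lemma smooth_box_bump: "smooth (box_bump c d)"
  unfolding box_bump_def[abs_def]
  by (intro smooth_prod smooth_mult smooth_bump smooth_add smooth_const smooth_inner) auto

lemma box_bump_pos: "p \<in> box c d \<Longrightarrow> 0 < box_bump c d p"
  unfolding box_bump_def by (intro prod_pos) (auto simp: mem_box intro!: mult_pos_pos bump_pos)

lemma box_bump_zero:
  assumes "p \<notin> box c d" shows "box_bump c d p = 0"
proof -
  obtain b where b: "b \<in> Basis" "p \<bullet> b \<le> c \<bullet> b \<or> d \<bullet> b \<le> p \<bullet> b"
    using assms by (auto simp: mem_box not_less)
  then have "bump (p \<bullet> b + (- (c \<bullet> b))) * bump (d \<bullet> b + (-1) * (p \<bullet> b)) = 0"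
    by (auto simp: bump_zero)
  then show ?thesis unfolding box_bump_def using b(1) by (intro prod_zero[OF finite_Basis]) (rule bexI)
qed

text \<open>The shift by \<open>1 / (n + 1)\<close> makes the support a compact subset of the open box.\<close>

definition cutoff :: "'a::euclidean_space \<Rightarrow> 'a \<Rightarrow> nat \<Rightarrow> 'a \<Rightarrow> real" where
  "cutoff c d n p = 1 + (-1) * exp ((- real n) * bump (box_bump c d p + (- inverse (real (Suc n)))))"

lemma cutoff_bounds: "0 \<le> cutoff c d n p" "cutoff c d n p \<le> 1"
  using bump_nonneg by (auto simp: cutoff_def)

text \<open>Inside the box the exponent tends to minus infinity, because the shifted bump converges
  to a positive number and is multiplied by n. Outside the box the cutoff is identically 0.\<close>

lemma cutoff_tendsto: "(\<lambda>n. cutoff c d n p) \<longlonglongrightarrow> indicator (box c d) p"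
proof (cases "p \<in> box c d")
  case True
  let ?y = "\<lambda>n. box_bump c d p + (- inverse (real (Suc n)))"
  have "?y \<longlonglongrightarrow> box_bump c d p + (- 0)"
    by (intro tendsto_intros LIMSEQ_inverse_real_of_nat)
  then have "(\<lambda>n. bump (?y n)) \<longlonglongrightarrow> bump (box_bump c d p)"
    using continuous_bump[of UNIV] isCont_tendsto_compose[of "box_bump c d p" bump ?y]
    by (simp add: continuous_on_eq_continuous_at)
  then have "filterlim (\<lambda>n. bump (?y n) * real n) at_top sequentially"
    using bump_pos[OF box_bump_pos[OF True]] filterlim_real_sequentially
    by (intro filterlim_tendsto_pos_mult_at_top) auto
  then have "(\<lambda>n. exp (- (bump (?y n) * real n))) \<longlonglongrightarrow> 0"
    by (intro filterlim_compose[OF exp_at_bot] filterlim_compose[OF filterlim_uminus_at_bot_at_top])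
  then have "(\<lambda>n. 1 + (-1) * exp (- (bump (?y n) * real n))) \<longlonglongrightarrow> 1 + (-1) * 0"
    by (intro tendsto_intros)
  then show ?thesis using True by (simp add: cutoff_def mult.commute)
next
  case False
  then show ?thesis by (simp add: cutoff_def box_bump_zero bump_zero)
qed

text \<open>The cutoff is nonzero only where \<open>box_bump\<close> exceeds 1/(n + 1). The
  corresponding superlevel set is closed and lies inside the bounded open box, hence is
  compact.\<close>

lemma test_function_cutoff:
  assumes "box c d \<subseteq> U" shows "test_function U (cutoff c d n)"
proof -
  let ?K = "{p. inverse (real (Suc n)) \<le> box_bump c d p}"
  have cl: "closed ?K"
    using smooth_continuous[OF smooth_box_bump] by (intro closed_Collect_le) auto
  have Kb: "?K \<subseteq> box c d"
  proof
    fix p assume "p \<in> ?K"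
    then have "box_bump c d p > 0" by (auto intro: less_le_trans[of _ "inverse (real (Suc n))"])
    then show "p \<in> box c d" using box_bump_zero by fastforce
  qed
  have "{p. cutoff c d n p \<noteq> 0} \<subseteq> ?K"
    by (auto simp: cutoff_def bump_zero not_le intro: ccontr)
  then have cK: "closure {p. cutoff c d n p \<noteq> 0} \<subseteq> ?K"
    using cl by (rule closure_minimal)
  moreover have "bounded ?K" using Kb bounded_box by (rule bounded_subset[rotated])
  then have "compact ?K" using cl by (simp add: compact_eq_bounded_closed)
  ultimately have "compact (closure {p. cutoff c d n p \<noteq> 0})"
    by (metis closed_closure compact_Int_closed inf.absorb_iff2)
  moreover have "smooth (cutoff c d n)"
    unfolding cutoff_def[abs_def]
    by (intro smooth_add smooth_mult smooth_const smooth_exp smooth_bump) (simp add: smooth_box_bump)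
  ultimately show ?thesis
    using cK Kb assms unfolding test_function_def by blast
qed

text \<open>Cutoffs converge boundedly to indicators of boxes, so \<open>g\<close> has integral 0
  over every box. Boxes are stable under intersection and generate the Borel sets, which extends
  this to all Borel sets, in particular to those where \<open>g\<close> is positive or
  negative.\<close>

lemma fundamental_lemma:
  fixes U :: "'a::euclidean_space set"
  assumes U: "U = box l u" and g: "integrable (lb U) g"
    and z: "\<And>\<phi>. test_function U \<phi> \<Longrightarrow> (\<integral>p. g p * \<phi> p \<partial>lb U) = 0"
  shows "AE p in lb U. g p = 0"
proof -
  have Ub: "U \<in> sets borel" using U by simp
  \<comment> \<open>Extension by 0 lets the generator consist of all boxes, not only of those inside
    \<open>U\<close>.\<close>
  define G where "G p = indicator U p * g p" for p
  have G: "integrable lborel G"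
    using g Ub by (simp add: G_def[abs_def] integrable_restrict_space)
  have box0: "(\<integral>p. indicator (box c d) p * G p \<partial>lborel) = 0" for c d
  proof -
    obtain c' d' where cd: "box c d \<inter> U = box c' d'"
      using U Int_interval[of c d l u] box_Int_box[of c d l u] by blast
    then have sub: "box c' d' \<subseteq> U" by blast
    have "(\<lambda>n. \<integral>p. g p * cutoff c' d' n p \<partial>lb U) \<longlonglongrightarrow> (\<integral>p. g p * indicator (box c' d') p \<partial>lb U)"
    proof (rule integral_dominated_convergence[where w="\<lambda>p. \<bar>g p\<bar>"])
      show "(\<lambda>p. g p * indicator (box c' d') p) \<in> borel_measurable (lb U)"
        by (intro borel_measurable_times borel_measurable_integrable[OF g] measurable_restrict_space1) auto
      show "(\<lambda>p. g p * cutoff c' d' n p) \<in> borel_measurable (lb U)" for n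
      proof -
        have "smooth (cutoff c' d' n)" using test_function_cutoff[OF sub] by (simp add: test_function_def)
        then show ?thesis
          using g continuous_on_UNIV_borel_lb[OF smooth_continuous] by (auto intro!: borel_measurable_times)
      qed
      show "AE p in lb U. (\<lambda>n. g p * cutoff c' d' n p) \<longlonglongrightarrow> g p * indicator (box c' d') p"
        by (intro AE_I2 tendsto_mult_left cutoff_tendsto)
      have "\<bar>g p * cutoff c' d' n p\<bar> \<le> \<bar>g p\<bar> * 1" for n p
        unfolding abs_mult using cutoff_bounds[of c' d' n p] by (intro mult_left_mono) auto
      then show "AE p in lb U. norm (g p * cutoff c' d' n p) \<le> \<bar>g p\<bar>" for n by simp
    qed (use g in auto)
    then have "(\<integral>p. g p * indicator (box c' d') p \<partial>lb U) = 0"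
      using z[OF test_function_cutoff[OF sub]] LIMSEQ_unique[OF _ tendsto_const] by simp
    moreover have "(\<integral>p. g p * indicator (box c' d') p \<partial>lb U) = (\<integral>p. indicator (box c d) p * G p \<partial>lborel)"
    proof -
      have "(\<integral>p. g p * indicator (box c' d') p \<partial>lb U) = (\<integral>p. indicator U p * (g p * indicator (box c' d') p) \<partial>lborel)"
        using Ub by (simp add: integral_restrict_space)
      also have "\<dots> = (\<integral>p. indicator (box c d) p * G p \<partial>lborel)"
        by (intro Bochner_Integration.integral_cong) (auto simp: G_def cd[symmetric] indicator_def)
      finally show ?thesis .
    qed
    ultimately show ?thesis by simp
  qed
  have si: "set_integrable lborel A G" if "A \<in> sets borel" for A
    using integrable_mult_indicator[of A lborel G] G that by (simp add: set_integrable_def)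
  have UG: "integral\<^sup>L lborel G = 0"
  proof -
    have "integral\<^sup>L lborel G = (\<integral>p. indicator (box l u) p * G p \<partial>lborel)"
      by (intro Bochner_Integration.integral_cong) (auto simp: G_def U indicator_def)
    then show ?thesis by (simp add: box0)
  qed
  have all: "(LINT p:A|lborel. G p) = 0" if "A \<in> sets borel" for A
  proof -
    let ?E = "range (\<lambda>(a, b). box a b) :: 'a set set"
    have "Int_stable ?E"
      by (auto simp: Int_stable_def box_Int_box)
    moreover have "?E \<subseteq> Pow UNIV" by simp
    moreover have "A \<in> sigma_sets UNIV ?E"
      using that by (simp add: borel_eq_box)
    ultimately show ?thesis
    proof (induction rule: sigma_sets_induct_disjoint)
      case (basic A)
      then show ?case using box0 by (auto simp: set_lebesgue_integral_def)
    next
      case empty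
      show ?case by (simp add: set_lebesgue_integral_def)
    next
      case (compl A)
      then have A: "A \<in> sets borel" by (simp add: borel_eq_box)
      have "(LINT p:A \<union> (UNIV - A)|lborel. G p) = (LINT p:A|lborel. G p) + (LINT p:UNIV - A|lborel. G p)"
        using A by (intro set_integral_Un si) auto
      then show ?case using compl UG by (simp add: set_lebesgue_integral_def)
    next
      case (union A)
      then have A: "A i \<in> sets borel" for i by (auto simp: borel_eq_box)
      have "(LINT p:(\<Union>i. A i)|lborel. G p) = (\<Sum>i. LINT p:A i|lborel. G p)"
      proof (rule lebesgue_integral_countable_add)
        show "set_integrable lborel (\<Union>i. A i) G" using A by (intro si) auto
      qed (use A union in \<open>auto simp: disjoint_family_on_def\<close>)
      then show ?case using union by simp
    qed
  qed
  have Gm: "G \<in> borel_measurable borel" using G by simp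
  have pos: "AE p in lborel. indicator A p * (s * G p) = 0"
    if A: "A \<in> sets borel" and nn: "\<And>p. p \<in> A \<Longrightarrow> 0 \<le> s * G p" for A s
  proof -
    have i: "integrable lborel (\<lambda>p. indicator A p * (s * G p))"
      using integrable_mult_indicator[of A lborel "\<lambda>p. s * G p"] A G by simp
    have "(\<integral>p. indicator A p * (s * G p) \<partial>lborel) = (\<integral>p. s * (indicator A p * G p) \<partial>lborel)"
      by (simp add: ac_simps)
    also have "\<dots> = 0" using all[OF A] by (simp add: set_lebesgue_integral_def)
    finally show ?thesis
      using integral_nonneg_eq_0_iff_AE[OF i] nn by (auto simp: indicator_def)
  qed
  have "AE p in lborel. indicator {p. 0 < G p} p * (1 * G p) = 0"
    using Gm by (intro pos) auto
  moreover have "AE p in lborel. indicator {p. G p < 0} p * (-1 * G p) = 0"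
    using Gm by (intro pos) auto
  ultimately have "AE p in lborel. G p = 0"
    by eventually_elim (auto simp: indicator_def split: if_splits)
  then show ?thesis
    using Ub by (auto simp: AE_restrict_space_iff G_def elim!: eventually_mono)
qed

section \<open>Weak derivatives\<close>

lemma L2_iff_sqint: "U \<in> sets borel \<Longrightarrow> L2 U u \<longleftrightarrow> sqint (lb U) u"
  unfolding L2_def sqint_def set_borel_measurable_def set_integrable_def
  by (simp add: borel_measurable_restrict_space_iff integrable_restrict_space)

lemma weak_pd_has_weak_deriv:
  assumes "H1 U u" "h \<in> Basis" shows "has_weak_deriv U h u (weak_pd U h u)"
  using assms unfolding H1_def weak_pd_def by (metis someI_ex)

lemma sqint_weak_pd: "H1 U u \<Longrightarrow> h \<in> Basis \<Longrightarrow> U \<in> sets borel \<Longrightarrow> sqint (lb U) (weak_pd U h u)"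
  using weak_pd_has_weak_deriv[of U u h] by (simp add: has_weak_deriv_def L2_iff_sqint)

lemma test_function_sqint:
  assumes "test_function U \<phi>" "bounded U" "U \<in> sets borel" "h \<in> Basis"
  shows "sqint (lb U) \<phi>" "sqint (lb U) (pd h \<phi>)"
  using assms by (auto simp: test_function_def intro!: sqint_continuous_lb smooth_continuous smooth_pd)

lemma has_weak_deriv_add:
  assumes U: "bounded U" "U \<in> sets borel" and h: "h \<in> Basis" and s: "sqint (lb U) u" "sqint (lb U) v"
    and "has_weak_deriv U h u g" "has_weak_deriv U h v k"
  shows "has_weak_deriv U h (\<lambda>p. u p + v p) (\<lambda>p. g p + k p)"
  unfolding has_weak_deriv_def
proof (intro conjI allI impI)
  have gk: "sqint (lb U) g" "sqint (lb U) k" using assms by (auto simp: has_weak_deriv_def L2_iff_sqint)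
  then show "L2 U (\<lambda>p. g p + k p)" using U by (simp add: L2_iff_sqint sqint_add)
  fix \<phi> assume t: "test_function U \<phi>"
  note \<phi> = test_function_sqint[OF t U h]
  have "(\<integral>p. u p * pd h \<phi> p \<partial>lb U) = - (\<integral>p. g p * \<phi> p \<partial>lb U)"
    "(\<integral>p. v p * pd h \<phi> p \<partial>lb U) = - (\<integral>p. k p * \<phi> p \<partial>lb U)"
    using assms t by (auto simp: has_weak_deriv_def set_integral_lb)
  moreover note sqint_mult_integrable[OF s(1) \<phi>(2)] sqint_mult_integrable[OF s(2) \<phi>(2)]
    sqint_mult_integrable[OF gk(1) \<phi>(1)] sqint_mult_integrable[OF gk(2) \<phi>(1)]
  ultimately show "(LINT p:U|lborel. (u p + v p) * pd h \<phi> p) = - (LINT p:U|lborel. (g p + k p) * \<phi> p)"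
    using U by (simp add: set_integral_lb distrib_right)
qed

lemma has_weak_deriv_cmult:
  assumes "U \<in> sets borel" "has_weak_deriv U h u g"
  shows "has_weak_deriv U h (\<lambda>p. c * u p) (\<lambda>p. c * g p)"
  using assms by (simp add: has_weak_deriv_def L2_iff_sqint sqint_cmult set_integral_lb mult.assoc)

text \<open>The difference of two weak derivatives integrates to 0 against every test function.
  Since \<open>weak_pd\<close> is a choice, this is the only way to compare it with a computed
  derivative.\<close>

lemma weak_pd_unique:
  assumes U: "U = box l u" and h: "h \<in> Basis"
    and w: "has_weak_deriv U h f g"
  shows "AE p in lb U. weak_pd U h f p = g p"
proof -
  have Ub: "bounded U" "U \<in> sets borel" using U by auto
  have w': "has_weak_deriv U h f (weak_pd U h f)"
    unfolding weak_pd_def by (rule someI[of "has_weak_deriv U h f", OF w])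
  have s: "sqint (lb U) g" "sqint (lb U) (weak_pd U h f)"
    using w w' Ub by (auto simp: has_weak_deriv_def L2_iff_sqint)
  have "AE p in lb U. weak_pd U h f p - g p = 0"
  proof (rule fundamental_lemma[OF U])
    show "integrable (lb U) (\<lambda>p. weak_pd U h f p - g p)"
      using s Ub by (intro sqint_imp_integrable finite_measure_lb sqint_diff)
    fix \<phi> assume t: "test_function U \<phi>"
    note \<phi> = test_function_sqint[OF t Ub h]
    have "(\<integral>p. weak_pd U h f p * \<phi> p \<partial>lb U) = (\<integral>p. g p * \<phi> p \<partial>lb U)"
      using w w' t Ub by (auto simp: has_weak_deriv_def set_integral_lb)
    then show "(\<integral>p. (weak_pd U h f p - g p) * \<phi> p \<partial>lb U) = 0"
      using sqint_mult_integrable[OF s(1) \<phi>(1)] sqint_mult_integrable[OF s(2) \<phi>(1)]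
      by (simp add: left_diff_distrib)
  qed
  then show ?thesis by simp
qed

text \<open>The smooth functions that realise the trace converge together with their whole gradient;
  only the component along \<open>h\<close> is retained.\<close>

lemma has_trace_trV:
  assumes t: "has_trace U u S \<gamma> g" and H: "H1 U u" and h: "h \<in> Basis"
    and U: "bounded U" "U \<in> sets borel" and S: "bounded S" "S \<in> sets borel" and \<gamma>: "continuous_on UNIV \<gamma>"
  shows "trV U h S \<gamma> u (weak_pd U h u) g"
proof -
  obtain un where un: "\<And>n::nat. smooth (un n)" "(\<lambda>n. LINT p:U|lborel. (un n p - u p)\<^sup>2) \<longlonglongrightarrow> 0"
    "(\<lambda>n. LINT p:U|lborel. (pd h (un n) p - weak_pd U h u p)\<^sup>2) \<longlonglongrightarrow> 0"
    "(\<lambda>n. LINT s:S|lborel. (un n (\<gamma> s) - g s)\<^sup>2) \<longlonglongrightarrow> 0"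
    using t h unfolding has_trace_def by blast
  have "L2 S g" using t by (simp add: has_trace_def)
  have c: "continuous_on UNIV (\<lambda>s. un n (\<gamma> s))" for n
    using smooth_continuous[OF un(1)[of n]] \<gamma> by (rule continuous_on_compose2) auto
  show ?thesis unfolding trV_def
  proof (intro exI conjI allI)
    show "cdiff h (un n) (pd h (un n))" for n using un(1) h by (rule smooth_cdiff)
    show "L2lim (lb U) un u"
      using un U H by (simp add: L2lim_def H1_def L2_iff_sqint set_integral_lb sqint_continuous_lb smooth_continuous)
    show "L2lim (lb U) (\<lambda>n. pd h (un n)) (weak_pd U h u)"
      using un U H h by (simp add: L2lim_def set_integral_lb sqint_continuous_lb smooth_continuous smooth_pd sqint_weak_pd)
    show "L2lim (lb S) (\<lambda>n s. un n (\<gamma> s)) g"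
      using un S \<open>L2 S g\<close> c by (simp add: L2lim_def L2_iff_sqint set_integral_lb sqint_continuous_lb)
  qed
qed

section \<open>Product domains\<close>

lemma perm_isoI:
  assumes "linear F" "linear G" "\<And>x. G (F x) = x" "\<And>y. F (G y) = y" "F ` Basis = Basis"
    "\<And>x y. F x \<bullet> F y = x \<bullet> y"
  shows "perm_iso F G"
  using assms by (simp add: perm_iso_def)

lemma perm_iso_id: "perm_iso (\<lambda>x. x) (\<lambda>x. x)"
  by (rule perm_isoI) (auto simp: linear_iff)

text \<open>Tuples nest to the right, as (t, (x, v)), whereas a velocity average needs the velocity
  split off from the pair (t, x).\<close>

definition assoc :: "('a \<times> 'b) \<times> 'c \<Rightarrow> 'a \<times> ('b \<times> 'c)" where
  "assoc p = (fst (fst p), (snd (fst p), snd p))"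

definition assoc' :: "'a \<times> ('b \<times> 'c) \<Rightarrow> ('a \<times> 'b) \<times> 'c" where
  "assoc' p = ((fst p, fst (snd p)), snd (snd p))"

lemma assoc_simps [simp]: "assoc ((t, x), v) = (t, (x, v))" "assoc' (t, (x, v)) = ((t, x), v)"
  by (simp_all add: assoc_def assoc'_def)

lemma perm_iso_assoc:
  "perm_iso (assoc :: ('a::euclidean_space \<times> 'b::euclidean_space) \<times> 'c::euclidean_space \<Rightarrow> _) assoc'"
proof (rule perm_isoI)
  show "(assoc :: ('a \<times> 'b) \<times> 'c \<Rightarrow> _) ` Basis = Basis"
    by (simp add: Basis_prod_def image_Un image_image zero_prod_def Un_assoc)
qed (auto simp: linear_iff assoc_def assoc'_def inner_prod_def)

lemma fibration_id:
  "B \<in> sets borel \<Longrightarrow> bounded B \<Longrightarrow> 0 < a \<Longrightarrow> fibration (B \<times> {0<..<a}) (\<lambda>x. x) (\<lambda>x. x) B a"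
  by (simp add: fibration_def perm_iso_id)

lemma fibration_assoc:
  assumes "B \<in> sets borel" "bounded B" "C \<in> sets borel" "bounded C" "0 < a"
  shows "fibration (B \<times> (C \<times> {0<..<a})) assoc assoc' (B \<times> C) a"
  using assms
  by (auto simp: fibration_def perm_iso_assoc borel_prod[symmetric] intro: bounded_Times)

lemma borel_Times [intro]:
  fixes A :: "'a::euclidean_space set" and B :: "'b::euclidean_space set"
  shows "A \<in> sets borel \<Longrightarrow> B \<in> sets borel \<Longrightarrow> A \<times> B \<in> sets borel"
  by (simp add: borel_prod[symmetric])

lemma integral_iterated2:
  fixes F :: "'a::euclidean_space \<times> 'b::euclidean_space \<Rightarrow> real"
  assumes "A \<in> sets borel" "B \<in> sets borel" "integrable (lb (A \<times> B)) F"
  shows "(LINT x:A|lborel. LINT y:B|lborel. F (x, y)) = integral\<^sup>L (lb (A \<times> B)) F"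
    and "integrable (lb A) (\<lambda>x. LINT y:B|lborel. F (x, y))"
proof -
  interpret pair_sigma_finite "lb A" "lb B"
    using assms by (auto simp: pair_sigma_finite_def intro: sigma_finite_lb)
  have i: "integrable (lb A \<Otimes>\<^sub>M lb B) F" using assms by (simp add: lb_prod)
  show "(LINT x:A|lborel. LINT y:B|lborel. F (x, y)) = integral\<^sup>L (lb (A \<times> B)) F"
    using integral_fst'[OF i] assms by (simp add: set_integral_lb lb_prod)
  show "integrable (lb A) (\<lambda>x. LINT y:B|lborel. F (x, y))"
    using integrable_fst'[OF i] assms by (simp add: set_integral_lb)
qed

text \<open>The loss is written with iterated integrals, the estimates with integrals over product
  domains. The second claim serves to exchange the time integral with finite sums over
  faces.\<close>

lemma integral_iterated3:
  fixes F :: "'a::euclidean_space \<times> 'b::euclidean_space \<times> real \<Rightarrow> real"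
  assumes A: "A \<in> sets borel" "bounded A" and B: "B \<in> sets borel" "bounded B" and a: "0 < a"
    and F: "integrable (lb (A \<times> (B \<times> {0<..<a}))) F"
  shows "(LINT x:A|lborel. LINT y:B|lborel. LINT z:{0<..<a}|lborel. F (x, y, z)) = integral\<^sup>L (lb (A \<times> (B \<times> {0<..<a}))) F"
    and "integrable (lb A) (\<lambda>x. LINT y:B|lborel. LINT z:{0<..<a}|lborel. F (x, y, z))"
proof -
  interpret V: fibration "A \<times> (B \<times> {0<..<a})" assoc assoc' "A \<times> B" a
    using assms by (intro fibration_assoc)
  have i: "integrable (lb (A \<times> B)) (\<lambda>b. LINT z:{0<..<a}|lborel. F (assoc (b, z)))"
    using V.integrable_inner[OF F] by (simp add: set_integral_lb)
  from integral_iterated2[OF A(1) B(1) i] V.integral_fubini[OF F]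
  show "(LINT x:A|lborel. LINT y:B|lborel. LINT z:{0<..<a}|lborel. F (x, y, z)) = integral\<^sup>L (lb (A \<times> (B \<times> {0<..<a}))) F"
    "integrable (lb A) (\<lambda>x. LINT y:B|lborel. LINT z:{0<..<a}|lborel. F (x, y, z))"
    by (simp_all add: set_integral_lb)
qed

text \<open>The one-dimensional loss integrates over the closed velocity interval, while the exact
  solution is controlled on the open one.\<close>

lemma set_integral_Icc_Ioo: "(LINT z:{0..a::real}|lborel. f z) = (LINT z:{0<..<a}|lborel. f z)" for f :: "real \<Rightarrow> real"
  unfolding set_lebesgue_integral_def
  by (rule integral_discrete_difference[where X="{0, a}"]) (auto simp: indicator_def)

lemma AE_lb_iff: "A \<in> sets borel \<Longrightarrow> (AE x in lb A. P x) \<longleftrightarrow> (AE x in lborel. x \<in> A \<longrightarrow> P x)"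
  by (simp add: AE_restrict_space_iff)

lemma integral_sum_sq_le:
  assumes "sqint M f" "sqint M g"
  shows "(\<integral>x. (f x + g x)\<^sup>2 \<partial>M) \<le> 2 * (\<integral>x. (f x)\<^sup>2 \<partial>M) + 2 * (\<integral>x. (g x)\<^sup>2 \<partial>M)"
proof -
  note i = sqint_integrable_sq[OF assms(1)] sqint_integrable_sq[OF assms(2)]
  have "(\<integral>x. (f x + g x)\<^sup>2 \<partial>M) \<le> (\<integral>x. 2 * (f x)\<^sup>2 + 2 * (g x)\<^sup>2 \<partial>M)"
  proof (rule integral_mono)
    fix x
    show "(f x + g x)\<^sup>2 \<le> 2 * (f x)\<^sup>2 + 2 * (g x)\<^sup>2"
      using sum_squares_bound[of "f x" "g x"] by (simp add: power2_sum)
  qed (use i sqint_integrable_sq[OF sqint_add[OF assms]] in auto)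
  then show ?thesis using i by simp
qed

text \<open>Here \<open>p\<close> and \<open>m\<close> play the roles of j1 + j2 and j2 - j1. Adding
  the first two equations eliminates the average of \<open>Q\<close> and gives the equation of r =
  \<rho> + \<epsilon>^2 w; averaging the second gives that of \<open>W\<close>. The boundary
  hypothesis quantifies over all weights bounded by T + 1, the bound of the time weight, so that its
  users need not know that weight.\<close>

theorem parity_estimate:
  fixes X :: "'x::euclidean_space set" and T a \<epsilon> :: real
  assumes A_def: "A = {0<..<a}" and U_def: "U = {0<..<T} \<times> X" and V_def: "V = {0<..<T} \<times> (X \<times> A)"
    and \<pi>_def: "\<pi> = (\<lambda>z. (fst z, fst (snd z)))"
    and X: "X \<in> sets borel" "bounded X" and T: "0 < T" and a: "0 < a" and \<epsilon>: "0 < \<epsilon>" "\<epsilon> \<le> 1"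
    and \<rho>: "trV U (1, 0) X (\<lambda>x. (0, x)) \<rho> \<rho>' \<rho>0"
    and w: "trV V (1, 0) (X \<times> A) (\<lambda>s. (0, s)) w w' w0"
    and \<phi>: "trV V (1, 0) (X \<times> A) (\<lambda>s. (0, s)) \<phi> \<phi>' \<phi>0"
    and p: "trV V (1, 0) (X \<times> A) (\<lambda>s. (0, s)) p p' p0"
    and m: "trV V (1, 0) (X \<times> A) (\<lambda>s. (0, s)) m m' m0"
    and sq: "sqint (lb V) Q" "sqint (lb V) B" "sqint (lb V) C" "sqint (lb V) E"
      "sqint (lb U) d1" "sqint (lb V) d2" "sqint (lb V) d3" "sqint (lb V) d4" "sqint (lb V) d5"
    and eq1: "AE b in lb U. 2 * \<rho>' b + fibration.avb assoc a Q b = d1 b"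
    and eq2: "AE z in lb V. 2 * \<epsilon>\<^sup>2 * w' z + Q z - fibration.avb assoc a Q (\<pi> z) + 2 * w z = d2 z"
    and eq3: "AE z in lb V. \<phi>' z + B z + \<phi> z / \<epsilon>\<^sup>2 = d3 z"
    and eq4: "AE z in lb V. \<epsilon>\<^sup>2 * p' z + p z + C z = d4 z"
    and eq5: "AE z in lb V. \<epsilon>\<^sup>2 * m' z + m z + E z = d5 z"
    and bdry: "\<And>P. continuous_on UNIV P \<Longrightarrow> (\<And>t. 0 < t \<Longrightarrow> t < T \<Longrightarrow> \<bar>P t\<bar> \<le> T + 1) \<Longrightarrow>
      - (\<integral>z. P (fst z) * (2 * (\<rho> (\<pi> z) + \<epsilon>\<^sup>2 * w z) * Q z + \<phi> z * B z + p z * C z + m z * E z) \<partial>lb V) \<le> \<beta>"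
  shows "(\<integral>z. (\<rho> (\<pi> z) + \<epsilon>\<^sup>2 * w z + \<phi> z / 2 + \<epsilon> * (p z + m z) / 2)\<^sup>2 \<partial>lb V) \<le> 96 * (T + 1) ^ 3 * (2 * a + 4) *
     ((\<integral>x. (\<rho>0 x)\<^sup>2 \<partial>lb X) + \<epsilon>^4 * (\<integral>s. (w0 s)\<^sup>2 \<partial>lb (X \<times> A)) + (\<integral>s. (\<phi>0 s)\<^sup>2 \<partial>lb (X \<times> A))
      + \<epsilon>\<^sup>2 * (\<integral>s. (p0 s)\<^sup>2 \<partial>lb (X \<times> A)) + \<epsilon>\<^sup>2 * (\<integral>s. (m0 s)\<^sup>2 \<partial>lb (X \<times> A))
      + (\<integral>b. (d1 b)\<^sup>2 \<partial>lb U) + (\<integral>z. (d2 z)\<^sup>2 \<partial>lb V) + (\<integral>z. (d3 z)\<^sup>2 \<partial>lb V)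
      + (\<integral>z. (d4 z)\<^sup>2 \<partial>lb V) + (\<integral>z. (d5 z)\<^sup>2 \<partial>lb V)) + 3 * \<beta>"
proof -
  have I: "{0<..<T} \<in> sets borel" "bounded {0<..<T}" by auto
  have fV: "fibration V assoc assoc' U a"
    unfolding V_def U_def A_def using X a by (intro fibration_assoc) auto
  interpret V: fibration V assoc assoc' U a by (rule fV)
  have fS: "fibration (X \<times> A) (\<lambda>x. x) (\<lambda>x. x) X a"
    unfolding A_def using X a by (intro fibration_id)
  interpret S: fibration "X \<times> A" "\<lambda>x. x" "\<lambda>x. x" X a by (rule fS)
  have V\<pi>: "V.\<pi> = \<pi>" by (rule ext) (simp add: V.\<pi>_def \<pi>_def assoc'_def)
  have S\<pi>: "S.\<pi> = fst" by (rule ext) (simp add: S.\<pi>_def)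
  have \<rho>V: "trV V (1, 0) (X \<times> A) (\<lambda>s. (0, s)) (\<lambda>z. \<rho> (\<pi> z)) (\<lambda>z. \<rho>' (\<pi> z)) (\<lambda>s. \<rho>0 (fst s))"
    using trV_lift[OF fV fS \<rho>, of "(1,0)" "\<lambda>s. (0, s)"] by (simp add: assoc'_def \<pi>_def zero_prod_def)
  define W where "W = V.av w"
  define W' where "W' = V.av w'"
  have WV: "trV V (1, 0) (X \<times> A) (\<lambda>s. (0, s)) W W' (S.av w0)"
    unfolding W_def W'_def
    by (rule trV_av[OF fV fS w, where hU="(1, 0)"]) (auto simp: assoc'_def assoc_def zero_prod_def)
  define r where "r z = \<rho> (\<pi> z) + \<epsilon>\<^sup>2 * w z" for z
  have rV: "trV V (1, 0) (X \<times> A) (\<lambda>s. (0, s)) r (\<lambda>z. \<rho>' (\<pi> z) + \<epsilon>\<^sup>2 * w' z) (\<lambda>s. \<rho>0 (fst s) + \<epsilon>\<^sup>2 * w0 s)"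
    unfolding r_def[abs_def] by (rule trV_add[OF \<rho>V trV_cmult[OF w]])
  note s\<rho> = trV_sqint[OF \<rho>] and sw = trV_sqint[OF w] and sr = trV_sqint[OF rV] and sW = trV_sqint[OF WV]
  define D where "D z = 1/2 * V.av d2 z" for z
  have sD: "sqint (lb V) D" unfolding D_def[abs_def] by (intro sqint_cmult V.av_sqint sq)
  define D1 where "D1 z = d1 (\<pi> z) + d2 z" for z
  have sd1: "sqint (lb V) (\<lambda>z. d1 (\<pi> z))" using V.lift_sqint[OF sq(5)] by (simp add: V\<pi>)
  have sD1: "sqint (lb V) D1" unfolding D1_def[abs_def] by (intro sqint_add sd1 sq)
  have eq1V: "AE z in lb V. 2 * \<rho>' (\<pi> z) + V.avb Q (\<pi> z) = d1 (\<pi> z)"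
    using V.lift_AE[OF eq1] by (simp add: V\<pi>)
  have eqr: "AE z in lb V. 2 * (\<rho>' (\<pi> z) + \<epsilon>\<^sup>2 * w' z) + Q z + 2 * w z = D1 z"
    using eq1V eq2 by eventually_elim (simp add: D1_def algebra_simps)
  have eqW: "AE z in lb V. \<epsilon>\<^sup>2 * W' z + W z = D z"
  proof -
    note si = sqint_imp_integrable[OF V.finite_V]
    have sQ: "sqint (lb V) (V.av Q)" by (intro V.av_sqint sq)
    have "AE b in lb U. V.avb d2 b = V.avb (\<lambda>z. (2 * \<epsilon>\<^sup>2 * w' z + Q z) + ((-1) * V.av Q z + 2 * w z)) b"
    proof (rule V.avb_cong_AE)
      show "AE z in lb V. d2 z = (2 * \<epsilon>\<^sup>2 * w' z + Q z) + ((-1) * V.av Q z + 2 * w z)"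
        using eq2 by eventually_elim (simp add: V.av_def V\<pi>)
      show "d2 \<in> borel_measurable (lb V)" using sq by (intro sqint_measurable)
      show "(\<lambda>z. (2 * \<epsilon>\<^sup>2 * w' z + Q z) + ((-1) * V.av Q z + 2 * w z)) \<in> borel_measurable (lb V)"
        by (intro sqint_measurable sqint_add sqint_cmult sw sq sQ)
    qed
    moreover have "AE b in lb U. V.avb (\<lambda>z. (2 * \<epsilon>\<^sup>2 * w' z + Q z) + ((-1) * V.av Q z + 2 * w z)) b
       = V.avb (\<lambda>z. 2 * \<epsilon>\<^sup>2 * w' z + Q z) b + V.avb (\<lambda>z. (-1) * V.av Q z + 2 * w z) b"
      by (intro V.avb_add_AE si sqint_add sqint_cmult sw sq sQ)
    moreover have "AE b in lb U. V.avb (\<lambda>z. 2 * \<epsilon>\<^sup>2 * w' z + Q z) b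
       = V.avb (\<lambda>z. 2 * \<epsilon>\<^sup>2 * w' z) b + V.avb Q b"
      by (intro V.avb_add_AE si sqint_cmult sw sq)
    moreover have "AE b in lb U. V.avb (\<lambda>z. (-1) * V.av Q z + 2 * w z) b
       = V.avb (\<lambda>z. (-1) * V.av Q z) b + V.avb (\<lambda>z. 2 * w z) b"
      by (intro V.avb_add_AE si sqint_cmult sw sQ)
    ultimately have "AE b in lb U. \<epsilon>\<^sup>2 * V.avb w' b + V.avb w b = 1/2 * V.avb d2 b"
    proof eventually_elim
      case (elim b)
      have "V.avb (V.av Q) b = V.avb Q b"
        unfolding V.av_def[abs_def] by (rule V.avb_lift)
      then show ?case using elim by (simp only: V.avb_cmult) (simp add: algebra_simps)
    qed
    from V.lift_AE[OF this] show ?thesis by (simp add: W_def W'_def D_def V.av_def)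
  qed
  have \<tau>: "continuous_on UNIV (fst :: real \<times> 'x \<times> real \<Rightarrow> real)" by (intro continuous_intros)
  have face: "face V (1, 0) (X \<times> A) (\<lambda>s. (0, s)) (\<lambda>s. (T, s)) (-1)"
  proof -
    have "(\<lambda>x. x) -` V = {0<..<T} \<times> (X \<times> A)" by (simp add: V_def)
    from face_slab(1)[OF perm_iso_id this T S.V_dom(2,1)] show ?thesis .
  qed
  have q: "0 < \<epsilon>\<^sup>2" using \<epsilon> by simp
  define P where "P = time_weight T (\<epsilon>\<^sup>2)"
  have P: "0 \<le> P t" "P t \<le> T + 1" if "0 < t" "t < T" for t
    using time_weight_bounds[OF q, of t T] that by (auto simp: P_def)
  have cP: "continuous_on UNIV P" using cdiff_time_weight[OF q, of T] by (simp add: cdiff_def P_def)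
  have orth: "0 \<le> (\<integral>z. P (fst z) * ((w z - W z) * r z) \<partial>lb V)"
  proof -
    \<comment> \<open>\<open>n\<close> is the weighted velocity-independent part of
      \<open>r\<close>. The remaining part of \<open>r\<close> is \<epsilon>^2 (w - W), which yields
      the nonnegative square.\<close>
    define n where "n b = P (fst b) * (\<rho> b + \<epsilon>\<^sup>2 * V.avb w b)" for b
    have Ub: "U \<in> sets borel" "bounded U" using V.B by auto
    have cPf: "continuous_on UNIV (\<lambda>z. P (fst z))" for z :: "real \<times> 'y::euclidean_space"
      by (rule continuous_on_compose2[OF cP]) (auto intro!: continuous_intros)
    have sn: "sqint (lb U) n"
    proof -
      have "sqint (lb U) (\<lambda>b. \<rho> b + \<epsilon>\<^sup>2 * V.avb w b)"
        by (intro sqint_add sqint_cmult s\<rho> V.avb_sqint sw)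
      then show ?thesis unfolding n_def[abs_def]
        by (intro sqint_bounded_mult[where K="T + 1"] continuous_on_UNIV_borel_lb
            continuous_on_compose2[OF cP] continuous_intros)
          (use P in \<open>auto simp: U_def space_restrict_space abs_le_iff intro!: order_trans[OF _ P(2)]\<close>)
    qed
    have swW: "sqint (lb V) (\<lambda>z. w z - W z)" by (intro sqint_diff sw sW)
    have i1: "integrable (lb V) (\<lambda>z. (w z - W z) * n (\<pi> z))"
      using V.lift_sqint[OF sn] swW by (intro sqint_mult_integrable) (simp_all add: V\<pi>)
    have i2: "integrable (lb V) (\<lambda>z. P (fst z) * ((w z - W z) * (w z - W z)))"
      using cP by (intro weighted_integrable V.V_dom swW continuous_on_compose2[OF cP] continuous_intros) auto
    have "(\<integral>z. P (fst z) * ((w z - W z) * r z) \<partial>lb V)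
        = (\<integral>z. (w z - W z) * n (\<pi> z) + \<epsilon>\<^sup>2 * (P (fst z) * ((w z - W z) * (w z - W z))) \<partial>lb V)"
      by (intro Bochner_Integration.integral_cong refl)
        (simp add: n_def r_def W_def V.av_def V\<pi> \<pi>_def algebra_simps)
    also have "\<dots> = (\<integral>z. (w z - W z) * n (\<pi> z) \<partial>lb V) + \<epsilon>\<^sup>2 * (\<integral>z. P (fst z) * ((w z - W z) * (w z - W z)) \<partial>lb V)"
      using i1 i2 by simp
    also have "(\<integral>z. (w z - W z) * n (\<pi> z) \<partial>lb V) = 0"
      using V.integral_fluctuation_lift[OF sw(1) sn] by (simp add: W_def V\<pi>)
    also have "0 \<le> (\<integral>z. P (fst z) * ((w z - W z) * (w z - W z)) \<partial>lb V)"
      using P by (intro integral_nonneg_AE AE_I2) (auto simp: V_def space_restrict_space)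
    ultimately show ?thesis by simp
  qed
  have main: "(\<integral>z. (r z + \<phi> z / 2 + \<epsilon> * (p z + m z) / 2)\<^sup>2 \<partial>lb V) \<le> 96 * (T + 1) ^ 3 *
     ((\<integral>s. (\<rho>0 (fst s) + \<epsilon>\<^sup>2 * w0 s)\<^sup>2 \<partial>lb (X \<times> A)) + (\<integral>s. (\<phi>0 s)\<^sup>2 \<partial>lb (X \<times> A)) + \<epsilon>\<^sup>2 * (\<integral>s. (p0 s)\<^sup>2 \<partial>lb (X \<times> A))
      + \<epsilon>\<^sup>2 * (\<integral>s. (m0 s)\<^sup>2 \<partial>lb (X \<times> A))
      + \<epsilon>^4 * (\<integral>s. (S.av w0 s)\<^sup>2 \<partial>lb (X \<times> A)) + (\<integral>z. (D1 z)\<^sup>2 \<partial>lb V) + (\<integral>z. (d3 z)\<^sup>2 \<partial>lb V) + (\<integral>z. (d4 z)\<^sup>2 \<partial>lb V)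
      + (\<integral>z. (d5 z)\<^sup>2 \<partial>lb V) + (\<integral>z. (D z)\<^sup>2 \<partial>lb V)) + 3 * \<beta>"
  proof (rule energy_estimate[OF face \<tau>, where T=T and w=w and A=Q and B=B and C=C and E=E and W=W and W'=W'])
    show "- (\<integral>z. time_weight T (\<epsilon>\<^sup>2) (fst z) * (2 * r z * Q z + \<phi> z * B z + p z * C z + m z * E z) \<partial>lb V) \<le> \<beta>"
      using bdry[OF cP] P by (simp add: P_def r_def abs_le_iff) (smt (verit))
    show "0 \<le> (\<integral>z. time_weight T (\<epsilon>\<^sup>2) (fst z) * ((w z - W z) * r z) \<partial>lb V)" using orth by (simp add: P_def)
  qed (use \<epsilon> T rV \<phi> p m WV sw sq sD sD1 eqr eq3 eq4 eq5 eqW in \<open>auto simp: V_def\<close>)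
  define a0 a1 a2 a3 a4 where "a0 = (\<integral>x. (\<rho>0 x)\<^sup>2 \<partial>lb X)" and "a1 = \<epsilon>^4 * (\<integral>s. (w0 s)\<^sup>2 \<partial>lb (X \<times> A))"
    and "a2 = (\<integral>s. (\<phi>0 s)\<^sup>2 \<partial>lb (X \<times> A))" and "a3 = \<epsilon>\<^sup>2 * (\<integral>s. (p0 s)\<^sup>2 \<partial>lb (X \<times> A))"
    and "a4 = \<epsilon>\<^sup>2 * (\<integral>s. (m0 s)\<^sup>2 \<partial>lb (X \<times> A))"
  define b1 b2 b3 b4 b5 where "b1 = (\<integral>b. (d1 b)\<^sup>2 \<partial>lb U)" and "b2 = (\<integral>z. (d2 z)\<^sup>2 \<partial>lb V)"
    and "b3 = (\<integral>z. (d3 z)\<^sup>2 \<partial>lb V)" and "b4 = (\<integral>z. (d4 z)\<^sup>2 \<partial>lb V)" and "b5 = (\<integral>z. (d5 z)\<^sup>2 \<partial>lb V)"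
  have nn: "0 \<le> a0" "0 \<le> a1" "0 \<le> a2" "0 \<le> a3" "0 \<le> a4" "0 \<le> b1" "0 \<le> b2" "0 \<le> b3" "0 \<le> b4" "0 \<le> b5"
    by (auto simp: a0_def a1_def a2_def a3_def a4_def b1_def b2_def b3_def b4_def b5_def)
  have e1: "(\<integral>s. (\<rho>0 (fst s) + \<epsilon>\<^sup>2 * w0 s)\<^sup>2 \<partial>lb (X \<times> A)) \<le> 2 * a * a0 + 2 * a1"
  proof -
    have "(\<integral>s. (\<rho>0 (fst s) + \<epsilon>\<^sup>2 * w0 s)\<^sup>2 \<partial>lb (X \<times> A))
        \<le> 2 * (\<integral>s. (\<rho>0 (fst s))\<^sup>2 \<partial>lb (X \<times> A)) + 2 * (\<integral>s. (\<epsilon>\<^sup>2 * w0 s)\<^sup>2 \<partial>lb (X \<times> A))"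
      using S.lift_sqint[OF s\<rho>(3)] by (intro integral_sum_sq_le sqint_cmult sw) (simp add: S\<pi>)
    moreover have "(\<integral>s. (\<rho>0 (fst s))\<^sup>2 \<partial>lb (X \<times> A)) = a * a0"
      using S.lift_integral[OF sqint_integrable_sq[OF s\<rho>(3)]] by (simp add: S\<pi> a0_def)
    moreover have "(\<integral>s. (\<epsilon>\<^sup>2 * w0 s)\<^sup>2 \<partial>lb (X \<times> A)) = a1"
      by (simp add: a1_def power_mult_distrib)
    ultimately show ?thesis by simp
  qed
  have e2: "\<epsilon>^4 * (\<integral>s. (S.av w0 s)\<^sup>2 \<partial>lb (X \<times> A)) \<le> a1"
    unfolding a1_def by (intro mult_left_mono S.av_bound sw) auto
  have e3: "(\<integral>z. (D1 z)\<^sup>2 \<partial>lb V) \<le> 2 * a * b1 + 2 * b2"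
  proof -
    have "(\<integral>z. (D1 z)\<^sup>2 \<partial>lb V) \<le> 2 * (\<integral>z. (d1 (\<pi> z))\<^sup>2 \<partial>lb V) + 2 * b2"
      unfolding D1_def b2_def by (intro integral_sum_sq_le sd1 sq)
    moreover have "(\<integral>z. (d1 (\<pi> z))\<^sup>2 \<partial>lb V) = a * b1"
      using V.lift_integral[OF sqint_integrable_sq[OF sq(5)]] by (simp add: V\<pi> b1_def)
    ultimately show ?thesis by simp
  qed
  have e4: "(\<integral>z. (D z)\<^sup>2 \<partial>lb V) \<le> b2"
  proof -
    have "(\<integral>z. (D z)\<^sup>2 \<partial>lb V) = 1/4 * (\<integral>z. (V.av d2 z)\<^sup>2 \<partial>lb V)"
      by (simp add: D_def power_divide)
    moreover have "0 \<le> (\<integral>z. (V.av d2 z)\<^sup>2 \<partial>lb V)" by simp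
    ultimately show ?thesis using V.av_bound[OF sq(6)] unfolding b2_def by linarith
  qed
  have "(\<integral>s. (\<rho>0 (fst s) + \<epsilon>\<^sup>2 * w0 s)\<^sup>2 \<partial>lb (X \<times> A)) + a2 + a3 + a4
      + \<epsilon>^4 * (\<integral>s. (S.av w0 s)\<^sup>2 \<partial>lb (X \<times> A)) + (\<integral>z. (D1 z)\<^sup>2 \<partial>lb V) + b3 + b4 + b5 + (\<integral>z. (D z)\<^sup>2 \<partial>lb V)
      \<le> (2 * a * a0 + 2 * a1) + a2 + a3 + a4 + a1 + (2 * a * b1 + 2 * b2) + b3 + b4 + b5 + b2"
    using e1 e2 e3 e4 by simp
  \<comment> \<open>The coefficients on the left are 2 a for \<open>a0\<close> and
    \<open>b1\<close>, 3 for \<open>a1\<close> and \<open>b2\<close>, and 1 otherwise; 2 a + 4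
    dominates them all. The terms with 2 a come from lifting functions of (t, x) or x to a fibre of
    length a.\<close>
  also have "\<dots> \<le> (2 * a + 4) * (a0 + a1 + a2 + a3 + a4 + b1 + b2 + b3 + b4 + b5)"
  proof -
    have "0 \<le> a * a1" "0 \<le> a * a2" "0 \<le> a * a3" "0 \<le> a * a4" "0 \<le> a * b2" "0 \<le> a * b3" "0 \<le> a * b4" "0 \<le> a * b5"
      using a nn by auto
    then show ?thesis using nn by (simp add: algebra_simps)
  qed
  finally have "96 * (T + 1) ^ 3 * ((\<integral>s. (\<rho>0 (fst s) + \<epsilon>\<^sup>2 * w0 s)\<^sup>2 \<partial>lb (X \<times> A)) + a2 + a3 + a4
      + \<epsilon>^4 * (\<integral>s. (S.av w0 s)\<^sup>2 \<partial>lb (X \<times> A)) + (\<integral>z. (D1 z)\<^sup>2 \<partial>lb V) + b3 + b4 + b5 + (\<integral>z. (D z)\<^sup>2 \<partial>lb V))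
      \<le> 96 * (T + 1) ^ 3 * ((2 * a + 4) * (a0 + a1 + a2 + a3 + a4 + b1 + b2 + b3 + b4 + b5))"
    using T by (intro mult_left_mono) auto
  then show ?thesis using main
    unfolding a0_def[symmetric] a1_def[symmetric] a2_def[symmetric] a3_def[symmetric] a4_def[symmetric]
      b1_def[symmetric] b2_def[symmetric] b3_def[symmetric] b4_def[symmetric] b5_def[symmetric] r_def
    by (simp only: mult.assoc)
qed

lemma error_trV:
  assumes "has_trace U u S \<gamma> g" "H1 U u" "h \<in> Basis" "cdiff h n n'"
    and "bounded U" "U \<in> sets borel" "bounded S" "S \<in> sets borel" "continuous_on UNIV \<gamma>"
  shows "trV U h S \<gamma> (\<lambda>p. n p - u p) (\<lambda>p. n' p - weak_pd U h u p) (\<lambda>s. n (\<gamma> s) - g s)"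
  using assms by (intro trV_diff trV_cdiff has_trace_trV)

text \<open>The face integrals are products of traces with a bounded factor of either sign. Bounding
  a product by the sum of squares makes them quadratic in the boundary errors, the form in which the
  loss controls them.\<close>

lemma green_slab_bound:
  assumes iso: "perm_iso \<Phi> \<Psi>" and V: "\<Phi> -` V = {l<..<r::real} \<times> S" and lr: "l < r"
    and S: "bounded S" "S \<in> sets borel" and h: "h = \<Phi> (1, 0)"
    and ul: "trV V h S (\<lambda>s. \<Phi> (l, s)) u u' gl" and vl: "trV V h S (\<lambda>s. \<Phi> (l, s)) v v' kl"
    and ur: "trV V h S (\<lambda>s. \<Phi> (r, s)) u u' gr" and vr: "trV V h S (\<lambda>s. \<Phi> (r, s)) v v' kr"
    and m: "continuous_on UNIV m" "\<And>p s. m (p + s *\<^sub>R h) = m p"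
    and K: "\<And>x s. s \<in> S \<Longrightarrow> \<bar>m (\<Phi> (x, s))\<bar> \<le> K" "0 \<le> K"
  shows "\<bar>\<integral>p. m p * (u p * v' p + u' p * v p) \<partial>lb V\<bar>
    \<le> K * ((\<integral>s. (gl s)\<^sup>2 \<partial>lb S) + (\<integral>s. (kl s)\<^sup>2 \<partial>lb S) + (\<integral>s. (gr s)\<^sup>2 \<partial>lb S) + (\<integral>s. (kr s)\<^sup>2 \<partial>lb S))"
proof -
  have bd: "\<bar>\<integral>s. m (\<Phi> (x, s)) * (g s * k s) \<partial>lb S\<bar> \<le> K * ((\<integral>s. (g s)\<^sup>2 \<partial>lb S) + (\<integral>s. (k s)\<^sup>2 \<partial>lb S))"
    if g: "sqint (lb S) g" and k: "sqint (lb S) k" for x g k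
  proof -
    have cm: "continuous_on UNIV (\<lambda>s. m (\<Phi> (x, s)))"
      by (rule continuous_on_compose2[OF m(1)])
        (auto intro!: continuous_on_compose2[OF perm_iso_continuous(1)[OF iso, of UNIV]] continuous_intros)
    have i: "integrable (lb S) (\<lambda>s. m (\<Phi> (x, s)) * (g s * k s))"
      by (rule weighted_integrable[OF cm S g k])
    have i2: "integrable (lb S) (\<lambda>s. K * ((g s)\<^sup>2 + (k s)\<^sup>2))"
      using sqint_integrable_sq[OF g] sqint_integrable_sq[OF k] by simp
    have "\<bar>\<integral>s. m (\<Phi> (x, s)) * (g s * k s) \<partial>lb S\<bar> \<le> (\<integral>s. \<bar>m (\<Phi> (x, s)) * (g s * k s)\<bar> \<partial>lb S)"
      by (rule integral_abs_bound)
    also have "\<dots> \<le> (\<integral>s. K * ((g s)\<^sup>2 + (k s)\<^sup>2) \<partial>lb S)"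
    proof (rule integral_mono[OF _ i2])
      show "integrable (lb S) (\<lambda>s. \<bar>m (\<Phi> (x, s)) * (g s * k s)\<bar>)" using i by simp
      fix s assume "s \<in> space (lb S)"
      then have "\<bar>m (\<Phi> (x, s))\<bar> \<le> K" using K(1) S by simp
      moreover have "\<bar>g s * k s\<bar> \<le> (g s)\<^sup>2 + (k s)\<^sup>2"
      proof -
        have "2 * (\<bar>g s\<bar> * \<bar>k s\<bar>) \<le> \<bar>g s\<bar>\<^sup>2 + \<bar>k s\<bar>\<^sup>2"
          using sum_squares_bound[of "\<bar>g s\<bar>" "\<bar>k s\<bar>"] by simp
        moreover have "0 \<le> \<bar>g s\<bar> * \<bar>k s\<bar>" by simp
        ultimately show ?thesis unfolding abs_mult power2_abs by linarith
      qed
      ultimately show "\<bar>m (\<Phi> (x, s)) * (g s * k s)\<bar> \<le> K * ((g s)\<^sup>2 + (k s)\<^sup>2)"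
        unfolding abs_mult[of "m (\<Phi> (x, s))"] using K(2) by (intro mult_mono) auto
    qed
    also have "\<dots> = K * ((\<integral>s. (g s)\<^sup>2 \<partial>lb S) + (\<integral>s. (k s)\<^sup>2 \<partial>lb S))"
      using sqint_integrable_sq[OF g] sqint_integrable_sq[OF k] by simp
    finally show ?thesis .
  qed
  have "\<bar>\<integral>p. m p * (u p * v' p + u' p * v p) \<partial>lb V\<bar>
      \<le> \<bar>\<integral>s. m (\<Phi> (r, s)) * (gr s * kr s) \<partial>lb S\<bar> + \<bar>\<integral>s. m (\<Phi> (l, s)) * (gl s * kl s) \<partial>lb S\<bar>"
    unfolding green_slab[OF iso V lr S h ul vl ur vr m] by (rule abs_triangle_ineq4)
  also have "\<dots> \<le> K * ((\<integral>s. (gr s)\<^sup>2 \<partial>lb S) + (\<integral>s. (kr s)\<^sup>2 \<partial>lb S))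
      + K * ((\<integral>s. (gl s)\<^sup>2 \<partial>lb S) + (\<integral>s. (kl s)\<^sup>2 \<partial>lb S))"
    by (intro add_mono bd trV_sqint[OF ul] trV_sqint[OF vl] trV_sqint[OF ur] trV_sqint[OF vr])
  finally show ?thesis by (simp add: algebra_simps)
qed

lemma measure_lborel_Times:
  fixes A :: "'a::euclidean_space set" and B :: "'b::euclidean_space set"
  assumes "A \<in> sets borel" "B \<in> sets borel"
  shows "measure lborel (A \<times> B) = measure lborel A * measure lborel B"
proof -
  have "emeasure (lborel \<Otimes>\<^sub>M lborel) (A \<times> B) = emeasure lborel A * emeasure lborel B"
    using assms by (intro lborel.emeasure_pair_measure_Times) auto
  then show ?thesis by (simp add: lborel_prod measure_def enn2real_mult)
qed

text \<open>Bounds the boundary values of \<open>r\<close> by those of its components. The boundary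
  loss weighs \<open>w\<close> without powers of \<epsilon>, so \<epsilon>^4 \<le> 1 is all that is
  used for its coefficient.\<close>

lemma (in fibration) lifted_trace_bound:
  assumes "sqint (lb B) \<rho>" "sqint (lb V) w" "0 \<le> \<epsilon>" "\<epsilon> \<le> 1"
  shows "(\<integral>q. (\<rho> (\<pi> q) + \<epsilon>\<^sup>2 * w q)\<^sup>2 \<partial>lb V) \<le> 2 * a * (\<integral>b. (\<rho> b)\<^sup>2 \<partial>lb B) + 2 * (\<integral>q. (w q)\<^sup>2 \<partial>lb V)"
proof -
  have "(\<integral>q. (\<rho> (\<pi> q) + \<epsilon>\<^sup>2 * w q)\<^sup>2 \<partial>lb V) \<le> 2 * (\<integral>q. (\<rho> (\<pi> q))\<^sup>2 \<partial>lb V) + 2 * (\<integral>q. (\<epsilon>\<^sup>2 * w q)\<^sup>2 \<partial>lb V)"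
    by (intro integral_sum_sq_le sqint_cmult assms lift_sqint)
  moreover have "(\<integral>q. (\<rho> (\<pi> q))\<^sup>2 \<partial>lb V) = a * (\<integral>b. (\<rho> b)\<^sup>2 \<partial>lb B)"
    by (rule lift_integral[OF sqint_integrable_sq[OF assms(1)]])
  moreover have "(\<integral>q. (\<epsilon>\<^sup>2 * w q)\<^sup>2 \<partial>lb V) \<le> (\<integral>q. (w q)\<^sup>2 \<partial>lb V)"
  proof -
    have "(\<epsilon>\<^sup>2)\<^sup>2 * (\<integral>q. (w q)\<^sup>2 \<partial>lb V) \<le> 1 * (\<integral>q. (w q)\<^sup>2 \<partial>lb V)"
      using assms by (intro mult_right_mono) (auto simp: power_le_one)
    then show ?thesis by (simp add: power_mult_distrib)
  qed
  ultimately show ?thesis by simp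
qed

section \<open>One space dimension\<close>

text \<open>Brings the space variable to the front, which presents the domain as a slab in x with
  faces parametrised by (t, v).\<close>

definition swap1 :: "real \<times> (real \<times> real) \<Rightarrow> real \<times> (real \<times> real)" where
  "swap1 q = (fst (snd q), (fst q, snd (snd q)))"

lemma perm_iso_swap1: "perm_iso swap1 swap1"
proof (rule perm_isoI)
  show "swap1 ` Basis = Basis"
    by (auto simp add: Basis_prod_def image_Un image_image zero_prod_def swap1_def)
qed (auto simp: linear_iff swap1_def inner_prod_def)

text \<open>Here and in \<open>rate2\<close> below, \<open>L\<close> is the measure of the domain and \<open>l\<close> that of its boundary.\<close>

definition rate1 :: "real \<Rightarrow> real \<Rightarrow> real \<Rightarrow> real \<Rightarrow> real \<Rightarrow> real \<Rightarrow> real" where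
  "rate1 T L lam1 lam2 lam3 lam4 =
     576 * (T + 1) ^ 3 * (L / lam1 + 4 * (L / lam2) + 4 * (T * L) + 4 * (T * L))
     + 24 * (T + 1) * (2 * T / lam3 + 2 * T / lam4)"

text \<open>The one-dimensional equations, multiplied by 2, are an instance of
  \<open>parity_estimate\<close> with \<phi> = m = 0, p = 2 j, Q = 2 v \<partial>_x j and C = 2 v
  \<partial>_x r. The error of f is then r + \<epsilon> p/2 up to sign.\<close>

lemma error_bound1:
  assumes T: "0 < T" and lam: "0 < lam1" "0 < lam2" "0 < lam3" "0 < lam4" and x: "xL < xR"
    and \<epsilon>: "0 < \<epsilon>" "\<epsilon> \<le> 1" and ex: "exact_solution1 T xL xR \<epsilon> s ic bc" and N: "network1 N"
  shows "0 \<le> R_APNN1 T xL xR lam1 lam2 lam3 lam4 \<epsilon> ic bc N"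
    and "R_total1 T xL xR \<epsilon> s N
      \<le> rate1 T (xR - xL) lam1 lam2 lam3 lam4 * R_APNN1 T xL xR lam1 lam2 lam3 lam4 \<epsilon> ic bc N"
proof -

  \<comment> \<open>Domains and data of the exact solution\<close>
  define I where "I = {0<..<T}"
  define X where "X = {xL<..<xR}"
  define A where "A = {0<..<1::real}"
  define U where "U = I \<times> X"
  define V where "V = I \<times> (X \<times> A)"
  have dom: "I \<in> sets borel" "bounded I" "X \<in> sets borel" "bounded X" "A \<in> sets borel" "bounded A"
    by (auto simp: I_def X_def A_def)
  have domp: "U \<in> sets borel" "bounded U" "V \<in> sets borel" "bounded V"
    "X \<times> A \<in> sets borel" "bounded (X \<times> A)" "I \<times> A \<in> sets borel" "bounded (I \<times> A)"
    using dom by (auto simp: U_def V_def intro!: bounded_Times)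
  have fV: "fibration V assoc assoc' U 1"
    unfolding V_def U_def A_def using dom by (intro fibration_assoc) auto
  interpret V: fibration V assoc assoc' U 1 by (rule fV)
  have fB: "fibration (I \<times> A) (\<lambda>x. x) (\<lambda>x. x) I 1"
    unfolding A_def using dom by (intro fibration_id) auto
  interpret B: fibration "I \<times> A" "\<lambda>x. x" "\<lambda>x. x" I 1 by (rule fB)
  define \<pi> where "\<pi> z = (fst z, fst (snd z))" for z :: "real \<times> real \<times> real"
  have V\<pi>: "V.\<pi> = \<pi>" by (rule ext) (simp add: V.\<pi>_def \<pi>_def assoc'_def)

  note sol = ex[unfolded exact_solution1_def]
  have H: "H1 U (rho1 s)" "H1 V (j1d s)" "H1 V (w1d s)"
    and eqs: "AE (t, x) in lborel. (t, x) \<in> U \<longrightarrow>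
           weak_pd U (1, 0) (rho1 s) (t, x) + avg1 (\<lambda>v. v * weak_pd V (0, 1, 0) (j1d s) (t, x, v)) = 0"
      "AE (t, x, v) in lborel. (t, x, v) \<in> V \<longrightarrow>
           \<epsilon>\<^sup>2 * weak_pd V (1, 0, 0) (j1d s) (t, x, v) + v * weak_pd U (0, 1) (rho1 s) (t, x)
             + \<epsilon>\<^sup>2 * v * weak_pd V (0, 1, 0) (w1d s) (t, x, v) + j1d s (t, x, v) = 0"
      "AE (t, x, v) in lborel. (t, x, v) \<in> V \<longrightarrow>
           \<epsilon>\<^sup>2 * weak_pd V (1, 0, 0) (w1d s) (t, x, v) + w1d s (t, x, v) + v * weak_pd V (0, 1, 0) (j1d s) (t, x, v)
             - avg1 (\<lambda>v'. v' * weak_pd V (0, 1, 0) (j1d s) (t, x, v')) = 0"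
    using sol unfolding solves1_def Let_def U_def V_def I_def X_def A_def by blast+
  have ini: "has_trace U (rho1 s) X (\<lambda>x. (0, x)) (rho1_IC ic)"
      "has_trace V (j1d s) (X \<times> A) (\<lambda>s. (0, s)) (j1d_IC ic)"
      "has_trace V (w1d s) (X \<times> A) (\<lambda>s. (0, s)) (w1d_IC ic)"
    using sol unfolding initial_data1_def Let_def U_def V_def I_def X_def A_def
    by (simp_all add: case_prod_beta')
  have bnd: "has_trace U (rho1 s) I (\<lambda>t. (t, x)) (\<lambda>t. rho1 bc (t, x))"
      "has_trace V (j1d s) (I \<times> A) (\<lambda>s. swap1 (x, s)) (\<lambda>s. j1d bc (swap1 (x, s)))"
      "has_trace V (w1d s) (I \<times> A) (\<lambda>s. swap1 (x, s)) (\<lambda>s. w1d bc (swap1 (x, s)))" if "x \<in> {xL, xR}" for x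
    using sol that unfolding boundary_data1_def Let_def U_def V_def I_def X_def A_def
    by (auto simp add: case_prod_beta' swap1_def)
  have net: "smooth (rho1 N)" "smooth (j1d N)" "smooth (w1d N)" using N by (auto simp: network1_def)
  have bas: "(1, 0) \<in> (Basis :: (real \<times> real) set)" "(0, 1) \<in> (Basis :: (real \<times> real) set)"
    "(1, 0, 0) \<in> (Basis :: (real \<times> real \<times> real) set)" "(0, 1, 0) \<in> (Basis :: (real \<times> real \<times> real) set)"
    by (auto simp: Basis_prod_def zero_prod_def)
  note cd = smooth_cdiff[OF net(1)] smooth_cdiff[OF net(2)] smooth_cdiff[OF net(3)]
  have csw: "continuous_on UNIV (\<lambda>s. swap1 (x, s))" for x
    by (auto simp: swap1_def intro!: continuous_intros)

  have c0: "continuous_on UNIV (\<lambda>s. (0::real, s))" for s :: "'z::euclidean_space"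
    by (intro continuous_intros)
  have ct: "continuous_on UNIV (\<lambda>t. (t, x::real))" for t :: real and x by (intro continuous_intros)

  \<comment> \<open>Errors and their traces\<close>
  define \<rho> where "\<rho> p = rho1 N p - rho1 s p" for p
  define \<rho>t where "\<rho>t p = pd (1, 0) (rho1 N) p - weak_pd U (1, 0) (rho1 s) p" for p
  define \<rho>x where "\<rho>x p = pd (0, 1) (rho1 N) p - weak_pd U (0, 1) (rho1 s) p" for p
  define \<rho>0 where "\<rho>0 x = rho1 N (0, x) - rho1_IC ic x" for x
  define \<rho>b where "\<rho>b x t = rho1 N (t, x) - rho1 bc (t, x)" for x t
  define j where "j p = j1d N p - j1d s p" for p
  define jt where "jt p = pd (1, 0, 0) (j1d N) p - weak_pd V (1, 0, 0) (j1d s) p" for p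
  define jx where "jx p = pd (0, 1, 0) (j1d N) p - weak_pd V (0, 1, 0) (j1d s) p" for p
  define j0 where "j0 q = j1d N (0, q) - j1d_IC ic q" for q
  define jb where "jb x q = j1d N (swap1 (x, q)) - j1d bc (swap1 (x, q))" for x q
  define w where "w p = w1d N p - w1d s p" for p
  define wt where "wt p = pd (1, 0, 0) (w1d N) p - weak_pd V (1, 0, 0) (w1d s) p" for p
  define wx where "wx p = pd (0, 1, 0) (w1d N) p - weak_pd V (0, 1, 0) (w1d s) p" for p
  define w0 where "w0 q = w1d N (0, q) - w1d_IC ic q" for q
  define wb where "wb x q = w1d N (swap1 (x, q)) - w1d bc (swap1 (x, q))" for x q
  have tr0: "trV U (1, 0) X (\<lambda>x. (0, x)) \<rho> \<rho>t \<rho>0"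
    "trV V (1, 0) (X \<times> A) (\<lambda>s. (0, s)) j jt j0"
    "trV V (1, 0) (X \<times> A) (\<lambda>s. (0, s)) w wt w0"
    using error_trV[OF ini(1) H(1) bas(1) cd(1)[OF bas(1)] domp(2,1) dom(4,3) c0]
      error_trV[OF ini(2) H(2) bas(3) cd(2)[OF bas(3)] domp(4,3,6,5) c0]
      error_trV[OF ini(3) H(3) bas(3) cd(3)[OF bas(3)] domp(4,3,6,5) c0]
    unfolding \<rho>_def[abs_def] \<rho>t_def[abs_def] \<rho>0_def[abs_def] j_def[abs_def] jt_def[abs_def] j0_def[abs_def]
      w_def[abs_def] wt_def[abs_def] w0_def[abs_def]
    by (simp_all add: zero_prod_def)
  have trb: "trV U (0, 1) I (\<lambda>t. (t, x)) \<rho> \<rho>x (\<rho>b x)"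
    "trV V (0, 1, 0) (I \<times> A) (\<lambda>s. swap1 (x, s)) j jx (jb x)"
    "trV V (0, 1, 0) (I \<times> A) (\<lambda>s. swap1 (x, s)) w wx (wb x)" if "x \<in> {xL, xR}" for x
    using error_trV[OF bnd(1)[OF that] H(1) bas(2) cd(1)[OF bas(2)] domp(2,1) dom(2,1) ct]
      error_trV[OF bnd(2)[OF that] H(2) bas(4) cd(2)[OF bas(4)] domp(4,3,8,7) csw]
      error_trV[OF bnd(3)[OF that] H(3) bas(4) cd(3)[OF bas(4)] domp(4,3,8,7) csw]
    unfolding \<rho>_def[abs_def] \<rho>x_def[abs_def] \<rho>b_def[abs_def] j_def[abs_def] jx_def[abs_def] jb_def[abs_def]
      w_def[abs_def] wx_def[abs_def] wb_def[abs_def]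
    by blast+
  have xLR: "xL \<in> {xL, xR}" "xR \<in> {xL, xR}" by auto
  note s\<rho> = trV_sqint[OF tr0(1)] and sj = trV_sqint[OF tr0(2)] and sw = trV_sqint[OF tr0(3)]
  note s\<rho>b = trV_sqint[OF trb(1)] and sjb = trV_sqint[OF trb(2)] and swb = trV_sqint[OF trb(3)]
  have vb: "sqint (lb V) (\<lambda>z. snd (snd z) * f z)" if "sqint (lb V) f" for f
    using that domp
    by (intro sqint_bounded_mult[where K=1] continuous_on_UNIV_borel_lb) (auto simp: V_def A_def intro!: continuous_intros)
  have lift: "sqint (lb V) (\<lambda>z. f (\<pi> z))" if "sqint (lb U) f" for f
    using V.lift_sqint[OF that] by (simp add: V\<pi>)

  \<comment> \<open>Error equations with the residuals as sources\<close>
  have avg: "avg1 (\<lambda>v. F (t, x, v)) = V.avb F (t, x)" for F t x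
    by (simp add: avg1_def V.avb_def set_integral_Icc_Ioo set_integral_lb)
  define FN where "FN z = snd (snd z) * pd (0, 1, 0) (j1d N) z" for z :: "real \<times> real \<times> real"
  define Fs where "Fs z = snd (snd z) * weak_pd V (0, 1, 0) (j1d s) z" for z :: "real \<times> real \<times> real"
  have sN: "sqint (lb V) (pd (1, 0, 0) (w1d N))" "sqint (lb V) (pd (0, 1, 0) (w1d N))"
    "sqint (lb V) (pd (1, 0, 0) (j1d N))" "sqint (lb V) (pd (0, 1, 0) (j1d N))"
    "sqint (lb V) (w1d N)" "sqint (lb V) (j1d N)" "sqint (lb U) (pd (1, 0) (rho1 N))" "sqint (lb U) (pd (0, 1) (rho1 N))"
    using domp net bas by (auto intro!: sqint_continuous_lb smooth_continuous smooth_pd)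
  have sFN: "sqint (lb V) FN" unfolding FN_def by (intro vb sN)
  have sFs: "sqint (lb V) Fs" unfolding Fs_def using H bas domp by (intro vb sqint_weak_pd)
  define Q where "Q z = 2 * (FN z - Fs z)" for z
  have sQ: "sqint (lb V) Q" unfolding Q_def by (intro sqint_cmult sqint_diff sFN sFs)
  have avQ: "AE b in lb U. V.avb Q b = 2 * (V.avb FN b - V.avb Fs b)"
    using V.avb_diff_AE[OF sqint_imp_integrable[OF V.finite_V sFN] sqint_imp_integrable[OF V.finite_V sFs]]
    unfolding Q_def by eventually_elim (simp only: V.avb_cmult)
  define r1 where "r1 b = res1_1 N (fst b) (snd b)" for b
  define r2 where "r2 z = res1_2 \<epsilon> N (fst z) (fst (snd z)) (snd (snd z))" for z
  define r3 where "r3 z = res1_3 \<epsilon> N (fst z) (fst (snd z)) (snd (snd z))" for z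
  have r1: "r1 b = pd (1, 0) (rho1 N) b + V.avb FN b" for b
    using avg[of FN "fst b" "snd b"] by (simp add: r1_def res1_1_def FN_def)
  have r3: "r3 z = \<epsilon>\<^sup>2 * pd (1, 0, 0) (w1d N) z + w1d N z + FN z - V.avb FN (\<pi> z)" for z
    using avg[of FN "fst z" "fst (snd z)"] by (simp add: r3_def res1_3_def FN_def \<pi>_def)
  have r2: "r2 z = \<epsilon>\<^sup>2 * pd (1, 0, 0) (j1d N) z + snd (snd z) * pd (0, 1) (rho1 N) (\<pi> z)
      + \<epsilon>\<^sup>2 * (snd (snd z) * pd (0, 1, 0) (w1d N) z) + j1d N z" for z
    by (simp add: r2_def res1_2_def \<pi>_def)
  \<comment> \<open>Square integrability matters beyond the estimate: the integral of a
    non-integrable function is 0 by convention, so without it the loss would not measure the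
    residuals.\<close>
  have sr: "sqint (lb U) r1" "sqint (lb V) r2" "sqint (lb V) r3"
  proof -
    show "sqint (lb U) r1" unfolding r1[abs_def] by (intro sqint_add sN V.avb_sqint sFN)
    show "sqint (lb V) r2" unfolding r2[abs_def] by (intro sqint_add sqint_cmult sN vb lift)
    show "sqint (lb V) r3" unfolding r3[abs_def]
      by (intro sqint_add sqint_diff sqint_cmult sN lift V.avb_sqint sFN)
  qed
  \<comment> \<open>The equations for the errors arise by subtracting the exact equations, which
    hold almost everywhere, from the definitions of the residuals.\<close>
  have eq1: "AE b in lb U. 2 * \<rho>t b + V.avb Q b = 2 * r1 b"
  proof -
    have "AE b in lb U. weak_pd U (1, 0) (rho1 s) b + V.avb Fs b = 0"
      unfolding AE_lb_iff[OF domp(1)] using eqs(1)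
    proof eventually_elim
      case (elim b)
      then show ?case using avg[of Fs "fst b" "snd b"] by (cases b) (simp add: Fs_def)
    qed
    with avQ show ?thesis by eventually_elim (simp add: \<rho>t_def r1)
  qed
  have eq2: "AE z in lb V. 2 * \<epsilon>\<^sup>2 * wt z + Q z - V.avb Q (\<pi> z) + 2 * w z = 2 * r3 z"
  proof -
    have "AE z in lb V. \<epsilon>\<^sup>2 * weak_pd V (1, 0, 0) (w1d s) z + w1d s z + Fs z - V.avb Fs (\<pi> z) = 0"
      unfolding AE_lb_iff[OF domp(3)] using eqs(3)
    proof eventually_elim
      case (elim z)
      then show ?case using avg[of Fs "fst z" "fst (snd z)"] by (cases z) (simp add: Fs_def \<pi>_def)
    qed
    with V.lift_AE[OF avQ, unfolded V\<pi>] show ?thesis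
      by eventually_elim (simp add: wt_def w_def r3 Q_def algebra_simps)
  qed
  define C where "C z = 2 * (snd (snd z) * (\<rho>x (\<pi> z) + \<epsilon>\<^sup>2 * wx z))" for z
  have srx: "sqint (lb V) (\<lambda>z. \<rho>x (\<pi> z) + \<epsilon>\<^sup>2 * wx z)"
    using s\<rho>b(2)[OF xLR(1)] swb(2)[OF xLR(1)] by (intro sqint_add sqint_cmult lift)
  have sC: "sqint (lb V) C" unfolding C_def by (intro sqint_cmult vb srx)
  have eq4: "AE z in lb V. \<epsilon>\<^sup>2 * (2 * jt z) + 2 * j z + C z = 2 * r2 z"
  proof -
    have "AE z in lb V. \<epsilon>\<^sup>2 * weak_pd V (1, 0, 0) (j1d s) z + snd (snd z) * weak_pd U (0, 1) (rho1 s) (\<pi> z)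
             + \<epsilon>\<^sup>2 * snd (snd z) * weak_pd V (0, 1, 0) (w1d s) z + j1d s z = 0"
      unfolding AE_lb_iff[OF domp(3)] using eqs(2)
    proof eventually_elim
      case (elim z)
      then show ?case by (cases z) (simp add: \<pi>_def)
    qed
    then show ?thesis
      by eventually_elim (simp add: jt_def j_def r2 C_def \<rho>x_def wx_def algebra_simps)
  qed

  \<comment> \<open>Lateral boundary terms\<close>
  define B1 where "B1 = (\<Sum>x\<in>{xL, xR}. \<integral>t. (\<rho>b x t)\<^sup>2 \<partial>lb I)"
  define B2 where "B2 = (\<Sum>x\<in>{xL, xR}. \<integral>q. (wb x q)\<^sup>2 + (jb x q)\<^sup>2 \<partial>lb (I \<times> A))"
  define \<beta> where "\<beta> = 8 * (T + 1) * (B1 + B2)"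
  define r where "r z = \<rho> (\<pi> z) + \<epsilon>\<^sup>2 * w z" for z
  have trr: "trV V (0, 1, 0) (I \<times> A) (\<lambda>s. swap1 (x, s)) r (\<lambda>z. \<rho>x (\<pi> z) + \<epsilon>\<^sup>2 * wx z) (\<lambda>q. \<rho>b x (fst q) + \<epsilon>\<^sup>2 * wb x q)"
    if "x \<in> {xL, xR}" for x
  proof -
    have "trV V (0, 1, 0) (I \<times> A) (\<lambda>s. swap1 (x, s)) (\<lambda>z. \<rho> (\<pi> z)) (\<lambda>z. \<rho>x (\<pi> z)) (\<lambda>q. \<rho>b x (fst q))"
      using trV_lift[OF fV fB trb(1)[OF that], of "(0, 1, 0)" "\<lambda>s. swap1 (x, s)"]
      by (simp add: assoc'_def \<pi>_def swap1_def)
    then show ?thesis unfolding r_def[abs_def] by (intro trV_add trV_cmult trb that)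
  qed
  have rb2: "(\<integral>q. (\<rho>b x (fst q) + \<epsilon>\<^sup>2 * wb x q)\<^sup>2 \<partial>lb (I \<times> A)) + (\<integral>q. (jb x q)\<^sup>2 \<partial>lb (I \<times> A))
      \<le> 2 * ((\<integral>t. (\<rho>b x t)\<^sup>2 \<partial>lb I) + (\<integral>q. (wb x q)\<^sup>2 + (jb x q)\<^sup>2 \<partial>lb (I \<times> A)))" if "x \<in> {xL, xR}" for x
  proof -
    note sb = s\<rho>b(3)[OF that] sjb(3)[OF that] swb(3)[OF that]
    have "B.\<pi> = fst" by (rule ext) (simp add: B.\<pi>_def)
    then have "(\<integral>q. (\<rho>b x (fst q) + \<epsilon>\<^sup>2 * wb x q)\<^sup>2 \<partial>lb (I \<times> A))
        \<le> 2 * (\<integral>t. (\<rho>b x t)\<^sup>2 \<partial>lb I) + 2 * (\<integral>q. (wb x q)\<^sup>2 \<partial>lb (I \<times> A))"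
      using B.lifted_trace_bound[OF sb(1,3), of \<epsilon>] \<epsilon> by simp
    moreover have "(\<integral>q. (wb x q)\<^sup>2 + (jb x q)\<^sup>2 \<partial>lb (I \<times> A)) = (\<integral>q. (wb x q)\<^sup>2 \<partial>lb (I \<times> A)) + (\<integral>q. (jb x q)\<^sup>2 \<partial>lb (I \<times> A))"
      using sb by (intro Bochner_Integration.integral_add sqint_integrable_sq)
    moreover have "0 \<le> (\<integral>q. (jb x q)\<^sup>2 \<partial>lb (I \<times> A))" by simp
    ultimately show ?thesis unfolding distrib_left by linarith
  qed
  have bdry: "- (\<integral>z. P (fst z) * (2 * (\<rho> (\<pi> z) + \<epsilon>\<^sup>2 * w z) * Q z + 0 * 0 + 2 * j z * C z + 0 * 0) \<partial>lb V) \<le> \<beta>"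
    if cP: "continuous_on UNIV P" and P: "\<And>t. 0 < t \<Longrightarrow> t < T \<Longrightarrow> \<bar>P t\<bar> \<le> T + 1" for P
  proof -
    define m where "m z = P (fst z) * snd (snd z)" for z :: "real \<times> real \<times> real"
    define J where "J = (\<integral>z. m z * (r z * jx z + (\<rho>x (\<pi> z) + \<epsilon>\<^sup>2 * wx z) * j z) \<partial>lb V)"
    \<comment> \<open>The integrand 2 r Q + 2 j C equals 4 v \<partial>_x (r j), so a single
      application of Green's formula in x suffices.\<close>
    have eq: "(\<integral>z. P (fst z) * (2 * (\<rho> (\<pi> z) + \<epsilon>\<^sup>2 * w z) * Q z + 0 * 0 + 2 * j z * C z + 0 * 0) \<partial>lb V)
        = (\<integral>z. 4 * (m z * (r z * jx z + (\<rho>x (\<pi> z) + \<epsilon>\<^sup>2 * wx z) * j z)) \<partial>lb V)"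
      by (intro Bochner_Integration.integral_cong refl)
        (simp add: m_def r_def Q_def FN_def Fs_def jx_def C_def algebra_simps)
    have "\<bar>\<integral>z. m z * (r z * jx z + (\<rho>x (\<pi> z) + \<epsilon>\<^sup>2 * wx z) * j z) \<partial>lb V\<bar>
      \<le> (T + 1) * ((\<integral>q. (\<rho>b xL (fst q) + \<epsilon>\<^sup>2 * wb xL q)\<^sup>2 \<partial>lb (I \<times> A)) + (\<integral>q. (jb xL q)\<^sup>2 \<partial>lb (I \<times> A))
        + (\<integral>q. (\<rho>b xR (fst q) + \<epsilon>\<^sup>2 * wb xR q)\<^sup>2 \<partial>lb (I \<times> A)) + (\<integral>q. (jb xR q)\<^sup>2 \<partial>lb (I \<times> A)))"
    proof (rule green_slab_bound[OF perm_iso_swap1 _ x _ _ _ trr[OF xLR(1)] trb(2)[OF xLR(1)] trr[OF xLR(2)] trb(2)[OF xLR(2)]])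
      show "swap1 -` V = {xL<..<xR} \<times> (I \<times> A)" by (auto simp: swap1_def V_def X_def)
      show "continuous_on UNIV m" unfolding m_def[abs_def]
        by (intro continuous_intros continuous_on_compose2[OF cP]) auto
      fix y q assume q: "q \<in> I \<times> A"
      then have "\<bar>P (fst q)\<bar> * \<bar>snd q\<bar> \<le> (T + 1) * 1"
        using T by (intro mult_mono P) (auto simp: I_def A_def)
      then show "\<bar>m (swap1 (y, q))\<bar> \<le> T + 1" by (simp add: m_def swap1_def abs_mult)
    qed (use domp T in \<open>auto simp: swap1_def m_def zero_prod_def\<close>)
    also have "\<dots> \<le> (T + 1) * (2 * (B1 + B2))"
      using rb2[OF xLR(1)] rb2[OF xLR(2)] x T
      by (intro mult_left_mono) (auto simp: B1_def B2_def)
    finally have J: "- J \<le> (T + 1) * (2 * (B1 + B2))" unfolding J_def by (simp only: abs_le_iff)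
    have "- (4 * J) = 4 * (- J)" by simp
    also have "\<dots> \<le> 4 * ((T + 1) * (2 * (B1 + B2)))" by (rule mult_left_mono[OF J]) simp
    also have "\<dots> = \<beta>" by (simp add: \<beta>_def algebra_simps)
    finally show ?thesis unfolding eq J_def by simp
  qed

  \<comment> \<open>Application of the parity estimate\<close>
  have z0: "trV V (1, 0) (X \<times> A) (\<lambda>s. (0, s)) (\<lambda>_. 0) (\<lambda>_. 0) (\<lambda>_. 0)"
    using trV_cmult[OF tr0(2), of 0] by simp
  have est: "(\<integral>z. (\<rho> (\<pi> z) + \<epsilon>\<^sup>2 * w z + 0 / 2 + \<epsilon> * (2 * j z + 0) / 2)\<^sup>2 \<partial>lb V) \<le> 96 * (T + 1) ^ 3 * (2 * 1 + 4) *
     ((\<integral>x. (\<rho>0 x)\<^sup>2 \<partial>lb X) + \<epsilon>^4 * (\<integral>s. (w0 s)\<^sup>2 \<partial>lb (X \<times> A)) + (\<integral>s. 0\<^sup>2 \<partial>lb (X \<times> A))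
      + \<epsilon>\<^sup>2 * (\<integral>s. (2 * j0 s)\<^sup>2 \<partial>lb (X \<times> A)) + \<epsilon>\<^sup>2 * (\<integral>s. 0\<^sup>2 \<partial>lb (X \<times> A))
      + (\<integral>b. (2 * r1 b)\<^sup>2 \<partial>lb U) + (\<integral>z. (2 * r3 z)\<^sup>2 \<partial>lb V) + (\<integral>z. 0\<^sup>2 \<partial>lb V)
      + (\<integral>z. (2 * r2 z)\<^sup>2 \<partial>lb V) + (\<integral>z. 0\<^sup>2 \<partial>lb V)) + 3 * \<beta>"
  proof (rule parity_estimate[where X=X and U=U and V=V and A=A and a=1 and T=T and \<epsilon>=\<epsilon> and \<pi>=\<pi> and \<beta>=\<beta>
       and \<rho>=\<rho> and \<rho>'=\<rho>t and ?\<rho>0.0=\<rho>0 and w=w and w'=wt and ?w0.0=w0 and \<phi>="\<lambda>_. 0" and \<phi>'="\<lambda>_. 0" and ?\<phi>0.0="\<lambda>_. 0"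
       and p="\<lambda>z. 2 * j z" and p'="\<lambda>z. 2 * jt z" and ?p0.0="\<lambda>z. 2 * j0 z"
       and m="\<lambda>_. 0" and m'="\<lambda>_. 0" and ?m0.0="\<lambda>_. 0" and Q=Q and B="\<lambda>_. 0" and C=C and E="\<lambda>_. 0"
       and ?d1.0="\<lambda>b. 2 * r1 b" and ?d2.0="\<lambda>z. 2 * r3 z" and ?d3.0="\<lambda>_. 0" and ?d4.0="\<lambda>z. 2 * r2 z" and ?d5.0="\<lambda>_. 0"])
    show "V = {0<..<T} \<times> (X \<times> A)" "U = {0<..<T} \<times> X" by (simp_all add: V_def U_def I_def)
    show "\<pi> = (\<lambda>z. (fst z, fst (snd z)))" by (rule ext) (simp add: \<pi>_def)
    show "trV V (1, 0) (X \<times> A) (\<lambda>s. (0, s)) (\<lambda>z. 2 * j z) (\<lambda>z. 2 * jt z) (\<lambda>z. 2 * j0 z)"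
      by (rule trV_cmult[OF tr0(2)])
    show "sqint (lb U) (\<lambda>b. 2 * r1 b)" "sqint (lb V) (\<lambda>z. 2 * r3 z)" "sqint (lb V) (\<lambda>z. 2 * r2 z)"
      by (intro sqint_cmult sr)+
  qed (fact A_def dom T zero_less_one \<epsilon> tr0 z0 sQ sqint_zero sC eq1 eq2 eq4 bdry | simp)+

  \<comment> \<open>Comparison with the loss\<close>
  define P1 where "P1 = (\<integral>b. (r1 b)\<^sup>2 \<partial>lb U)"
  define P2 where "P2 = (\<integral>z. (r2 z)\<^sup>2 + (r3 z)\<^sup>2 \<partial>lb V)"
  define I1 where "I1 = (\<integral>x. (\<rho>0 x)\<^sup>2 \<partial>lb X)"
  define I2 where "I2 = (\<integral>q. \<epsilon>^2 * (j0 q)\<^sup>2 + \<epsilon>^4 * (w0 q)\<^sup>2 \<partial>lb (X \<times> A))"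
  note sqi = sqint_integrable_sq
  have nn: "0 \<le> P1" "0 \<le> P2" "0 \<le> I1" "0 \<le> I2" "0 \<le> B1" "0 \<le> B2"
    by (auto simp: P1_def P2_def I1_def I2_def B1_def B2_def intro!: sum_nonneg)
  have I2eq: "I2 = \<epsilon>\<^sup>2 * (\<integral>q. (j0 q)\<^sup>2 \<partial>lb (X \<times> A)) + \<epsilon>^4 * (\<integral>q. (w0 q)\<^sup>2 \<partial>lb (X \<times> A))"
    unfolding I2_def using sqi[OF sj(3)] sqi[OF sw(3)] by simp
  have P2eq: "P2 = (\<integral>z. (r2 z)\<^sup>2 \<partial>lb V) + (\<integral>z. (r3 z)\<^sup>2 \<partial>lb V)"
    unfolding P2_def using sqi[OF sr(2)] sqi[OF sr(3)] by simp
  have total: "R_total1 T xL xR \<epsilon> s N = (\<integral>z. (\<rho> (\<pi> z) + \<epsilon>\<^sup>2 * w z + 0 / 2 + \<epsilon> * (2 * j z + 0) / 2)\<^sup>2 \<partial>lb V)"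
  proof -
    have "R_total1 T xL xR \<epsilon> s N = (\<integral>z. (f1 \<epsilon> s z - f1 \<epsilon> N z)\<^sup>2 \<partial>lb V)"
      using domp by (simp add: R_total1_def set_integral_lb V_def I_def X_def A_def)
    also have "\<dots> = (\<integral>z. (\<rho> (\<pi> z) + \<epsilon>\<^sup>2 * w z + 0 / 2 + \<epsilon> * (2 * j z + 0) / 2)\<^sup>2 \<partial>lb V)"
    proof (rule Bochner_Integration.integral_cong[OF refl])
      fix z
      have e: "f1 \<epsilon> s z - f1 \<epsilon> N z = - (\<rho> (\<pi> z) + \<epsilon>\<^sup>2 * w z + 0 / 2 + \<epsilon> * (2 * j z + 0) / 2)"
        by (cases z) (simp add: f1_def \<rho>_def w_def j_def \<pi>_def algebra_simps diff_divide_distrib)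
      show "(f1 \<epsilon> s z - f1 \<epsilon> N z)\<^sup>2 = (\<rho> (\<pi> z) + \<epsilon>\<^sup>2 * w z + 0 / 2 + \<epsilon> * (2 * j z + 0) / 2)\<^sup>2"
        unfolding e by (rule power2_minus)
    qed
    finally show ?thesis .
  qed
  \<comment> \<open>The constant is 576 = 96 (2 a + 4) with a = 1. The factors 4 are the squares of
    the doubling of j and of the three residuals.\<close>
  have up: "R_total1 T xL xR \<epsilon> s N \<le> 576 * (T + 1) ^ 3 * (I1 + 4 * I2 + 4 * P1 + 4 * P2) + 24 * (T + 1) * (B1 + B2)"
  proof -
    have "R_total1 T xL xR \<epsilon> s N \<le> 576 * (T + 1) ^ 3 * (I1 + \<epsilon>^4 * (\<integral>s. (w0 s)\<^sup>2 \<partial>lb (X \<times> A))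
        + 4 * (\<epsilon>\<^sup>2 * (\<integral>s. (j0 s)\<^sup>2 \<partial>lb (X \<times> A))) + 4 * P1 + 4 * P2) + 24 * (T + 1) * (B1 + B2)"
      using est unfolding total by (simp add: power_mult_distrib P2eq P1_def I1_def \<beta>_def algebra_simps)
    also have "\<dots> \<le> 576 * (T + 1) ^ 3 * (I1 + 4 * I2 + 4 * P1 + 4 * P2) + 24 * (T + 1) * (B1 + B2)"
      using T by (intro add_right_mono mult_left_mono) (auto simp: I2eq)
    finally show ?thesis .
  qed
  have L: "0 < xR - xL" using x by simp
  have residual: "R_residual1 T xL xR \<epsilon> N = P1 / (T * (xR - xL)) + P2 / (T * (xR - xL))"
  proof -
    have "(LINT t:{0<..<T}|lborel. LINT x:{xL<..<xR}|lborel. (res1_1 N t x)\<^sup>2) = P1"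
      using integral_iterated2(1)[OF dom(1,3), of "\<lambda>b. (r1 b)\<^sup>2"] sqi[OF sr(1)]
      by (simp add: P1_def U_def r1_def I_def X_def)
    moreover have "(LINT t:{0<..<T}|lborel. LINT x:{xL<..<xR}|lborel. LINT v:{0..1}|lborel.
          (res1_2 \<epsilon> N t x v)\<^sup>2 + (res1_3 \<epsilon> N t x v)\<^sup>2) = P2"
      using integral_iterated3(1)[OF dom(1-4) zero_less_one, of "\<lambda>z. (r2 z)\<^sup>2 + (r3 z)\<^sup>2"] sqi[OF sr(2)] sqi[OF sr(3)]
      unfolding set_integral_Icc_Ioo by (simp add: P2_def V_def A_def r2_def r3_def I_def X_def)
    moreover have "measure lborel ({0<..<T} \<times> {xL<..<xR}) = T * (xR - xL)"
      "measure lborel ({0<..<T} \<times> {xL<..<xR} \<times> {0..1::real}) = T * (xR - xL)"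
      using T x by (simp_all add: measure_lborel_Times borel_Times)
    ultimately show ?thesis unfolding R_residual1_def by simp
  qed
  have initial: "R_initial1 xL xR lam1 lam2 \<epsilon> ic N = lam1 / (xR - xL) * I1 + lam2 / (xR - xL) * I2"
  proof -
    have "(LINT x:{xL<..<xR}|lborel. LINT v:{0..1}|lborel.
          \<epsilon>^2 * (j1d N (0, x, v) - j1d_IC ic (x, v))\<^sup>2 + \<epsilon>^4 * (w1d N (0, x, v) - w1d_IC ic (x, v))\<^sup>2) = I2"
      using integral_iterated2(1)[OF dom(3,5), of "\<lambda>q. \<epsilon>^2 * (j0 q)\<^sup>2 + \<epsilon>^4 * (w0 q)\<^sup>2"] sqi[OF sj(3)] sqi[OF sw(3)]
      unfolding set_integral_Icc_Ioo by (simp add: I2_def A_def j0_def w0_def X_def)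
    moreover have "measure lborel ({xL<..<xR} \<times> {0..1::real}) = xR - xL"
      using x by (simp add: measure_lborel_Times)
    moreover have "(LINT x:{xL<..<xR}|lborel. (rho1 N (0, x) - rho1_IC ic x)\<^sup>2) = I1"
      by (simp add: I1_def \<rho>0_def set_integral_lb X_def)
    ultimately show ?thesis unfolding R_initial1_def using x by simp
  qed
  have boundary: "R_boundary1 T xL xR lam3 lam4 bc N = lam3 / (2 * T) * B1 + lam4 / (2 * T) * B2"
  proof -
    have "(LINT t:{0<..<T}|lborel. \<Sum>x\<in>{xL, xR}. (rho1 N (t, x) - rho1 bc (t, x))\<^sup>2) = B1"
      unfolding B1_def I_def[symmetric] set_integral_lb[OF dom(1)] \<rho>b_def[symmetric]
      by (rule Bochner_Integration.integral_sum) (auto intro!: sqi s\<rho>b(3))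
    moreover have "(LINT t:{0<..<T}|lborel. \<Sum>x\<in>{xL, xR}. LINT v:{0..1}|lborel.
          (w1d N (t, x, v) - w1d bc (t, x, v))\<^sup>2 + (j1d N (t, x, v) - j1d bc (t, x, v))\<^sup>2) = B2"
    proof -
      have i: "integrable (lb (I \<times> A)) (\<lambda>q. (wb x q)\<^sup>2 + (jb x q)\<^sup>2)" if "x \<in> {xL, xR}" for x
        by (intro Bochner_Integration.integrable_add sqi swb(3) sjb(3) that)
      have eq: "(LINT v:{0..1}|lborel. (w1d N (t, x, v) - w1d bc (t, x, v))\<^sup>2 + (j1d N (t, x, v) - j1d bc (t, x, v))\<^sup>2)
         = (LINT v:A|lborel. (wb x (t, v))\<^sup>2 + (jb x (t, v))\<^sup>2)" for t x
        unfolding set_integral_Icc_Ioo by (simp add: A_def wb_def jb_def swap1_def)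
      have "(LINT t:I|lborel. \<Sum>x\<in>{xL, xR}. LINT v:A|lborel. (wb x (t, v))\<^sup>2 + (jb x (t, v))\<^sup>2)
         = (\<Sum>x\<in>{xL, xR}. LINT t:I|lborel. LINT v:A|lborel. (wb x (t, v))\<^sup>2 + (jb x (t, v))\<^sup>2)"
        unfolding set_integral_lb[OF dom(1)]
        by (rule Bochner_Integration.integral_sum) (rule integral_iterated2(2)[OF dom(1,5) i])
      also have "\<dots> = B2"
        unfolding B2_def by (intro sum.cong refl integral_iterated2(1)[OF dom(1,5) i])
      finally show ?thesis unfolding eq I_def .
    qed
    ultimately show ?thesis unfolding R_boundary1_def using T x by (simp add: card_insert_if mult.commute)
  qed
  define R where "R = R_APNN1 T xL xR lam1 lam2 lam3 lam4 \<epsilon> ic bc N"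
  define L where "L = xR - xL"
  have R: "R = P1 / (T * L) + P2 / (T * L) + lam1 / L * I1 + lam2 / L * I2 + lam3 / (2 * T) * B1 + lam4 / (2 * T) * B2"
    unfolding R_def R_APNN1_def residual initial boundary L_def by simp
  have L0: "0 < L" using x by (simp add: L_def)
  have nonneg: "0 \<le> P1 / (T * L)" "0 \<le> P2 / (T * L)" "0 \<le> lam1 / L * I1" "0 \<le> lam2 / L * I2"
    "0 \<le> lam3 / (2 * T) * B1" "0 \<le> lam4 / (2 * T) * B2"
    using nn lam T L0 by auto
  show "0 \<le> R_APNN1 T xL xR lam1 lam2 lam3 lam4 \<epsilon> ic bc N"
    using nonneg R unfolding R_def by linarith
  \<comment> \<open>All six contributions to the loss are nonnegative, so each is bounded by the
    whole loss and can be solved for its integral.\<close>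
  have "P1 / (T * L) \<le> R" "P2 / (T * L) \<le> R" "lam1 / L * I1 \<le> R" "lam2 / L * I2 \<le> R"
    "lam3 / (2 * T) * B1 \<le> R" "lam4 / (2 * T) * B2 \<le> R"
    using nonneg R by linarith+
  then have "P1 \<le> T * L * R" "P2 \<le> T * L * R" "I1 \<le> L / lam1 * R" "I2 \<le> L / lam2 * R"
    "B1 \<le> 2 * T / lam3 * R" "B2 \<le> 2 * T / lam4 * R"
    using lam T L0 by (simp_all add: field_simps)
  then have "576 * (T + 1) ^ 3 * (I1 + 4 * I2 + 4 * P1 + 4 * P2) + 24 * (T + 1) * (B1 + B2)
     \<le> 576 * (T + 1) ^ 3 * (L / lam1 * R + 4 * (L / lam2 * R) + 4 * (T * L * R) + 4 * (T * L * R))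
       + 24 * (T + 1) * (2 * T / lam3 * R + 2 * T / lam4 * R)"
    using T by (intro add_mono mult_left_mono) auto
  also have "\<dots> = rate1 T L lam1 lam2 lam3 lam4 * R"
    by (simp add: rate1_def ring_distribs mult.assoc)
  finally show "R_total1 T xL xR \<epsilon> s N
      \<le> rate1 T (xR - xL) lam1 lam2 lam3 lam4 * R_APNN1 T xL xR lam1 lam2 lam3 lam4 \<epsilon> ic bc N"
    using up unfolding R_def L_def by linarith
qed

section \<open>Two space dimensions\<close>

text \<open>\<open>face_x\<close> and \<open>face_y\<close> bring one space coordinate to the front,
  so that the domain becomes a slab in that direction and each side of the rectangle, times the
  intervals of time and angle, becomes one of its faces.\<close>

definition face_x :: "real \<times> (real \<times> (real \<times> real)) \<Rightarrow> real \<times> ((real \<times> real) \<times> real)" where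
  "face_x q = (fst (snd q), ((fst q, fst (snd (snd q))), snd (snd (snd q))))"

definition face_x' :: "real \<times> ((real \<times> real) \<times> real) \<Rightarrow> real \<times> (real \<times> (real \<times> real))" where
  "face_x' z = (fst (fst (snd z)), (fst z, (snd (fst (snd z)), snd (snd z))))"

definition face_y :: "real \<times> (real \<times> (real \<times> real)) \<Rightarrow> real \<times> ((real \<times> real) \<times> real)" where
  "face_y q = (fst (snd q), ((fst (snd (snd q)), fst q), snd (snd (snd q))))"

definition face_y' :: "real \<times> ((real \<times> real) \<times> real) \<Rightarrow> real \<times> (real \<times> (real \<times> real))" where
  "face_y' z = (snd (fst (snd z)), (fst z, (fst (fst (snd z)), snd (snd z))))"

lemma perm_iso_face_x: "perm_iso face_x face_x'"
proof (rule perm_isoI)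
  show "face_x ` Basis = Basis"
    by (auto simp add: Basis_prod_def image_Un image_image zero_prod_def face_x_def)
qed (auto simp: linear_iff face_x_def face_x'_def inner_prod_def)

lemma perm_iso_face_y: "perm_iso face_y face_y'"
proof (rule perm_isoI)
  show "face_y ` Basis = Basis"
    by (auto simp add: Basis_prod_def image_Un image_image zero_prod_def face_y_def)
qed (auto simp: linear_iff face_y_def face_y'_def inner_prod_def)

lemma continuous_arc: "continuous_on UNIV arc"
  unfolding arc_def[abs_def] by (intro continuous_intros)

text \<open>The parametrisation of the arc changes only the velocity argument, so derivatives in
  time and space commute with \<open>on_arc\<close>.\<close>

lemma cdiff_on_arc:
  assumes n: "smooth n" and h: "(th, xh, 0) \<in> Basis"
  shows "cdiff (th, xh, 0) (on_arc n) (on_arc (pd (th, xh, (0, 0)) n))"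
proof -
  let ?L = "\<lambda>z::real \<times> (real \<times> real) \<times> real. (fst z, fst (snd z), arc (snd (snd z)))"
  have b: "(th, xh, (0, 0)) \<in> Basis"
    using h by (auto simp: Basis_prod_def zero_prod_def)
  have "cdiff (th, xh, 0) (\<lambda>z. n (?L z)) (\<lambda>z. pd (th, xh, (0, 0)) n (?L z))"
  proof (rule cdiff_compose[OF smooth_cdiff[OF n b]])
    show "continuous_on UNIV ?L"
      by (intro continuous_intros continuous_on_compose2[OF continuous_arc]) auto
  qed (simp add: scaleR_prod_def zero_prod_def[symmetric])
  then show ?thesis by (simp add: on_arc_def case_prod_beta')
qed

text \<open>
  \<open>weak_pd\<close> picks an arbitrary representative and need not be linear in \<open>u\<close>; uniqueness of weak derivatives up
  to null sets identifies it here.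
\<close>

lemma has_trace_combine:
  assumes u: "has_trace U u S \<gamma> g" "H1 U u" and v: "has_trace U v S \<gamma> k" "H1 U v"
    and U: "U = box l r" and h: "h \<in> Basis" and S: "bounded S" "S \<in> sets borel" and \<gamma>: "continuous_on UNIV \<gamma>"
  shows "trV U h S \<gamma> (\<lambda>p. u p + e * v p) (weak_pd U h (\<lambda>p. u p + e * v p)) (\<lambda>s. g s + e * k s)"
proof -
  have Ub: "bounded U" "U \<in> sets borel" using U by auto
  have su: "sqint (lb U) u" "sqint (lb U) v" using u v Ub by (auto simp: H1_def L2_iff_sqint)
  have w: "has_weak_deriv U h (\<lambda>p. u p + e * v p) (\<lambda>p. weak_pd U h u p + e * weak_pd U h v p)"
    using u v Ub h su
    by (intro has_weak_deriv_add has_weak_deriv_cmult weak_pd_has_weak_deriv sqint_cmult)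
  have ae: "AE p in lb U. weak_pd U h u p + e * weak_pd U h v p = weak_pd U h (\<lambda>p. u p + e * v p) p"
    using weak_pd_unique[OF U h w] by eventually_elim simp
  have "has_weak_deriv U h (\<lambda>p. u p + e * v p) (weak_pd U h (\<lambda>p. u p + e * v p))"
    unfolding weak_pd_def by (rule someI[of "has_weak_deriv U h (\<lambda>p. u p + e * v p)", OF w])
  then have "weak_pd U h (\<lambda>p. u p + e * v p) \<in> borel_measurable (lb U)"
    using Ub by (auto simp: has_weak_deriv_def L2_iff_sqint sqint_measurable)
  then show ?thesis
    using trV_cong_AE[OF trV_add[OF has_trace_trV[OF u h Ub S \<gamma>] trV_cmult[OF has_trace_trV[OF v h Ub S \<gamma>]]] _ ae]
    by blast
qed

lemma on_arc_jplus: "on_arc (jplus s) = (\<lambda>p. on_arc (j1 s) p + 1 * on_arc (j2 s) p)"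
  by (rule ext) (simp add: on_arc_def jplus_def case_prod_beta')

lemma on_arc_jminus: "on_arc (jminus s) = (\<lambda>p. on_arc (j2 s) p + (-1) * on_arc (j1 s) p)"
  by (rule ext) (simp add: on_arc_def jminus_def case_prod_beta')

text \<open>Kept general in the face and the direction, so that it serves the initial face and all
  four sides. For j1 + j2 and j2 - j1 the system involves \<open>weak_pd\<close> of the combination
  while traces are given for j1 and j2 separately; \<open>has_trace_combine\<close> bridges
  this.\<close>

lemma field_errors:
  assumes net: "network2 N"
    and H: "H1 V (on_arc (phi2 s))" "H1 V (on_arc (j1 s))" "H1 V (on_arc (j2 s))" "H1 V (on_arc (w2d s))"
    and tr: "has_trace V (on_arc (phi2 s)) S \<gamma> k\<phi>" "has_trace V (on_arc (j1 s)) S \<gamma> k1"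
      "has_trace V (on_arc (j2 s)) S \<gamma> k2" "has_trace V (on_arc (w2d s)) S \<gamma> kw"
    and V: "V = box l r" and S: "bounded S" "S \<in> sets borel" and \<gamma>: "continuous_on UNIV \<gamma>"
    and h: "h \<in> Basis" "h = (th, xh, 0)" and h': "h' = (th, xh, (0, 0))"
  shows "trV V h S \<gamma> (\<lambda>z. on_arc (phi2 N) z - on_arc (phi2 s) z)
      (\<lambda>z. on_arc (pd h' (phi2 N)) z - weak_pd V h (on_arc (phi2 s)) z) (\<lambda>q. on_arc (phi2 N) (\<gamma> q) - k\<phi> q)"
    and "trV V h S \<gamma> (\<lambda>z. on_arc (w2d N) z - on_arc (w2d s) z)
      (\<lambda>z. on_arc (pd h' (w2d N)) z - weak_pd V h (on_arc (w2d s)) z) (\<lambda>q. on_arc (w2d N) (\<gamma> q) - kw q)"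
    and "trV V h S \<gamma> (\<lambda>z. on_arc (jplus N) z - on_arc (jplus s) z)
      (\<lambda>z. on_arc (pd h' (jplus N)) z - weak_pd V h (on_arc (jplus s)) z) (\<lambda>q. on_arc (jplus N) (\<gamma> q) - (k1 q + k2 q))"
    and "trV V h S \<gamma> (\<lambda>z. on_arc (jminus N) z - on_arc (jminus s) z)
      (\<lambda>z. on_arc (pd h' (jminus N)) z - weak_pd V h (on_arc (jminus s)) z) (\<lambda>q. on_arc (jminus N) (\<gamma> q) - (k2 q - k1 q))"
proof -
  have sm: "smooth (phi2 N)" "smooth (j1 N)" "smooth (j2 N)" "smooth (w2d N)"
    using net by (auto simp: network2_def)
  have smp: "smooth (jplus N)" unfolding jplus_def by (intro smooth_add sm)
  have smm: "smooth (jminus N)"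
  proof -
    have "smooth (\<lambda>p. j2 N p + (-1) * j1 N p)" by (intro smooth_add smooth_mult smooth_const sm)
    then show ?thesis by (simp add: jminus_def)
  qed
  have Vb: "bounded V" "V \<in> sets borel" using V by auto
  have b: "(th, xh, 0 :: real) \<in> Basis" using h by simp
  have n: "trV V h S \<gamma> (on_arc n) (on_arc (pd h' n)) (\<lambda>q. on_arc n (\<gamma> q))" if "smooth n" for n
    using trV_cdiff[OF cdiff_on_arc[OF that b] \<gamma> Vb S] by (simp add: h(2) h')
  note ex = has_trace_trV[OF _ _ h(1) Vb S \<gamma>]
  show "trV V h S \<gamma> (\<lambda>z. on_arc (phi2 N) z - on_arc (phi2 s) z)
      (\<lambda>z. on_arc (pd h' (phi2 N)) z - weak_pd V h (on_arc (phi2 s)) z) (\<lambda>q. on_arc (phi2 N) (\<gamma> q) - k\<phi> q)"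
    by (intro trV_diff n sm ex tr H)
  show "trV V h S \<gamma> (\<lambda>z. on_arc (w2d N) z - on_arc (w2d s) z)
      (\<lambda>z. on_arc (pd h' (w2d N)) z - weak_pd V h (on_arc (w2d s)) z) (\<lambda>q. on_arc (w2d N) (\<gamma> q) - kw q)"
    by (intro trV_diff n sm ex tr H)
  have "trV V h S \<gamma> (on_arc (jplus s)) (weak_pd V h (on_arc (jplus s))) (\<lambda>q. k1 q + k2 q)"
    using has_trace_combine[OF tr(2) H(2) tr(3) H(3) V h(1) S \<gamma>, of 1]
    unfolding on_arc_jplus by simp
  then show "trV V h S \<gamma> (\<lambda>z. on_arc (jplus N) z - on_arc (jplus s) z)
      (\<lambda>z. on_arc (pd h' (jplus N)) z - weak_pd V h (on_arc (jplus s)) z) (\<lambda>q. on_arc (jplus N) (\<gamma> q) - (k1 q + k2 q))"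
    by (intro trV_diff n smp)
  have "trV V h S \<gamma> (on_arc (jminus s)) (weak_pd V h (on_arc (jminus s))) (\<lambda>q. k2 q - k1 q)"
    using has_trace_combine[OF tr(3) H(3) tr(2) H(2) V h(1) S \<gamma>, of "-1"]
    unfolding on_arc_jminus by simp
  then show "trV V h S \<gamma> (\<lambda>z. on_arc (jminus N) z - on_arc (jminus s) z)
      (\<lambda>z. on_arc (pd h' (jminus N)) z - weak_pd V h (on_arc (jminus s)) z) (\<lambda>q. on_arc (jminus N) (\<gamma> q) - (k2 q - k1 q))"
    by (intro trV_diff n smm)
qed

definition rate2 :: "real \<Rightarrow> real \<Rightarrow> real \<Rightarrow> real \<Rightarrow> real \<Rightarrow> real \<Rightarrow> real \<Rightarrow> real" where
  "rate2 T L l lam1 lam2 lam3 lam4 =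
     96 * (T + 1) ^ 3 * (pi + 4) * (L / lam1 + L * (pi / 2) / lam2 + T * L + T * L * (pi / 2))
     + 24 * (T + 1) * (T * l / lam3 + T * l * (pi / 2) / lam4)"

text \<open>The errors of j1 + j2 and j2 - j1 are the components \<open>p\<close> and
  \<open>m\<close> of \<open>parity_estimate\<close>. Velocity is represented by the angle, so the
  fibre has length pi/2 and the velocity components become the bounded smooth multipliers cos and
  sin.\<close>

lemma error_bound2:
  assumes T: "0 < T" and lam: "0 < lam1" "0 < lam2" "0 < lam3" "0 < lam4" and ab: "a < b" and cd: "c < d"
    and \<epsilon>: "0 < \<epsilon>" "\<epsilon> \<le> 1" and ex: "exact_solution2 T a b c d \<epsilon> s ic bc" and N: "network2 N"
  shows "0 \<le> R_APNN2 T a b c d lam1 lam2 lam3 lam4 \<epsilon> ic bc N"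
    and "R_total2 T a b c d \<epsilon> s N
      \<le> rate2 T ((b - a) * (d - c)) (2 * (b - a) + 2 * (d - c)) lam1 lam2 lam3 lam4
        * R_APNN2 T a b c d lam1 lam2 lam3 lam4 \<epsilon> ic bc N"
proof -

  \<comment> \<open>Domains and data of the exact solution\<close>
  define I where "I = {0<..<T}"
  define Xh where "Xh = {a<..<b}"
  define Yv where "Yv = {c<..<d}"
  define X where "X = Xh \<times> Yv"
  define A where "A = {0<..<pi/2}"
  define U where "U = I \<times> X"
  define V where "V = I \<times> (X \<times> A)"
  define SX where "SX = I \<times> (Yv \<times> A)"
  define SY where "SY = I \<times> (Xh \<times> A)"
  have rect: "rect a b c d = X" by (simp add: rect_def X_def Xh_def Yv_def)
  have dom: "I \<in> sets borel" "bounded I" "Xh \<in> sets borel" "bounded Xh" "Yv \<in> sets borel" "bounded Yv"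
      "A \<in> sets borel" "bounded A" "X \<in> sets borel" "bounded X"
    by (auto simp: I_def Xh_def Yv_def A_def X_def intro!: bounded_Times)
  have domp: "U \<in> sets borel" "bounded U" "V \<in> sets borel" "bounded V" "X \<times> A \<in> sets borel" "bounded (X \<times> A)"
      "SX \<in> sets borel" "bounded SX" "SY \<in> sets borel" "bounded SY"
      "I \<times> Yv \<in> sets borel" "bounded (I \<times> Yv)" "I \<times> Xh \<in> sets borel" "bounded (I \<times> Xh)"
    using dom by (auto simp: U_def V_def SX_def SY_def intro!: bounded_Times)
  have pi2: "0 < pi/2" by simp
  have fV: "fibration V assoc assoc' U (pi/2)"
    unfolding V_def U_def A_def using dom pi2 by (intro fibration_assoc)
  interpret V: fibration V assoc assoc' U "pi/2" by (rule fV)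
  have fSX: "fibration SX assoc assoc' (I \<times> Yv) (pi/2)"
    unfolding SX_def A_def using dom pi2 by (intro fibration_assoc)
  interpret SX: fibration SX assoc assoc' "I \<times> Yv" "pi/2" by (rule fSX)
  have fSY: "fibration SY assoc assoc' (I \<times> Xh) (pi/2)"
    unfolding SY_def A_def using dom pi2 by (intro fibration_assoc)
  interpret SY: fibration SY assoc assoc' "I \<times> Xh" "pi/2" by (rule fSY)
  define \<pi> where "\<pi> z = (fst z, fst (snd z))" for z :: "real \<times> (real \<times> real) \<times> real"
  define \<pi>b where "\<pi>b z = (fst z, fst (snd z))" for z :: "real \<times> real \<times> real"
  have V\<pi>: "V.\<pi> = \<pi>" by (rule ext) (simp add: V.\<pi>_def \<pi>_def assoc'_def)
  have SX\<pi>: "SX.\<pi> = \<pi>b" by (rule ext) (simp add: SX.\<pi>_def \<pi>b_def assoc'_def)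
  have SY\<pi>: "SY.\<pi> = \<pi>b" by (rule ext) (simp add: SY.\<pi>_def \<pi>b_def assoc'_def)
  \<comment> \<open>The box form is needed because uniqueness of weak derivatives is available on
    boxes; it enters through j1 + j2 and j2 - j1.\<close>
  have Vbox: "V = box (0, (a, c), 0) (T, (b, d), pi/2)"
    by (auto simp: V_def X_def I_def Xh_def Yv_def A_def mem_box Basis_prod_def)

  define ht :: "real \<times> (real \<times> real) \<times> real" where "ht = (1, (0, 0), 0)"
  define hx :: "real \<times> (real \<times> real) \<times> real" where "hx = (0, (1, 0), 0)"
  define hy :: "real \<times> (real \<times> real) \<times> real" where "hy = (0, (0, 1), 0)"
  have bas: "ht \<in> Basis" "hx \<in> Basis" "hy \<in> Basis"
    by (auto simp: ht_def hx_def hy_def Basis_prod_def zero_prod_def)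
  have basU: "(1, (0, 0)) \<in> (Basis :: (real \<times> real \<times> real) set)" "(0, (1, 0)) \<in> (Basis :: (real \<times> real \<times> real) set)"
    "(0, (0, 1)) \<in> (Basis :: (real \<times> real \<times> real) set)"
    by (auto simp: Basis_prod_def zero_prod_def)
  define Aex where "Aex z = cos (snd (snd z)) * weak_pd V hx (on_arc (jplus s)) z
      + sin (snd (snd z)) * weak_pd V hy (on_arc (jminus s)) z" for z
  have avg: "2 / pi * (LINT \<alpha>:A|lborel. F (t, x, \<alpha>)) = V.avb F (t, x)" for F t x
    by (simp add: V.avb_def A_def set_integral_lb)
  have avA: "V.avb Aex z = 2 / pi * (LINT \<alpha>:A|lborel. cos \<alpha> * weak_pd V hx (on_arc (jplus s)) (fst z, snd z, \<alpha>)
      + sin \<alpha> * weak_pd V hy (on_arc (jminus s)) (fst z, snd z, \<alpha>))" for z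
    using avg[of Aex "fst z" "snd z"] by (simp add: Aex_def)
  note sol = ex[unfolded exact_solution2_def]
  have H: "H1 U (rho2 s)" "H1 V (on_arc (phi2 s))" "H1 V (on_arc (j1 s))" "H1 V (on_arc (j2 s))" "H1 V (on_arc (w2d s))"
    using sol unfolding solves2_def Let_def rect I_def[symmetric] A_def[symmetric] U_def[symmetric] V_def[symmetric] by blast+
  have eqs: "AE z in lborel. z \<in> U \<longrightarrow> 2 * weak_pd U (1, (0, 0)) (rho2 s) z + V.avb Aex z = 0"
      "AE z in lborel. z \<in> V \<longrightarrow>
           2 * \<epsilon>\<^sup>2 * weak_pd V ht (on_arc (w2d s)) z + Aex z - V.avb Aex (\<pi> z) + 2 * on_arc (w2d s) z = 0"
      "AE z in lborel. z \<in> V \<longrightarrow>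
           \<epsilon>\<^sup>2 * weak_pd V ht (on_arc (phi2 s)) z + \<epsilon>\<^sup>2 * cos (snd (snd z)) * weak_pd V hx (on_arc (jminus s)) z
             + \<epsilon>\<^sup>2 * sin (snd (snd z)) * weak_pd V hy (on_arc (jplus s)) z + on_arc (phi2 s) z = 0"
      "AE z in lborel. z \<in> V \<longrightarrow>
           \<epsilon>\<^sup>2 * weak_pd V ht (on_arc (jplus s)) z + on_arc (jplus s) z
             + 2 * cos (snd (snd z)) * (weak_pd U (0, (1, 0)) (rho2 s) (\<pi> z) + \<epsilon>\<^sup>2 * weak_pd V hx (on_arc (w2d s)) z)
             + sin (snd (snd z)) * weak_pd V hy (on_arc (phi2 s)) z = 0"
      "AE z in lborel. z \<in> V \<longrightarrow>
           \<epsilon>\<^sup>2 * weak_pd V ht (on_arc (jminus s)) z + on_arc (jminus s) z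
             + cos (snd (snd z)) * weak_pd V hx (on_arc (phi2 s)) z
             + 2 * sin (snd (snd z)) * (weak_pd U (0, (0, 1)) (rho2 s) (\<pi> z) + \<epsilon>\<^sup>2 * weak_pd V hy (on_arc (w2d s)) z) = 0"
    using sol
    unfolding solves2_def Let_def rect I_def[symmetric] A_def[symmetric] U_def[symmetric] V_def[symmetric]
      ht_def[symmetric] hx_def[symmetric] hy_def[symmetric]
    unfolding case_prod_beta' avA Aex_def on_arc_def \<pi>_def
    by simp_all
  have ini0: "has_trace U (rho2 s) X (\<lambda>x. (0, x)) (rho2_IC ic)"
    and ini: "has_trace V (on_arc (phi2 s)) (X \<times> A) (\<lambda>q. (0, q)) (\<lambda>q. phi2_IC ic (fst q, arc (snd q)))"
      "has_trace V (on_arc (j1 s)) (X \<times> A) (\<lambda>q. (0, q)) (\<lambda>q. j1_IC ic (fst q, arc (snd q)))"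
      "has_trace V (on_arc (j2 s)) (X \<times> A) (\<lambda>q. (0, q)) (\<lambda>q. j2_IC ic (fst q, arc (snd q)))"
      "has_trace V (on_arc (w2d s)) (X \<times> A) (\<lambda>q. (0, q)) (\<lambda>q. w2d_IC ic (fst q, arc (snd q)))"
    using sol
    unfolding initial_data2_def Let_def rect I_def[symmetric] A_def[symmetric] U_def[symmetric] V_def[symmetric]
    by (simp_all add: case_prod_beta')
  have bx0: "has_trace U (rho2 s) (I \<times> Yv) (\<lambda>q. (fst q, (x, snd q))) (\<lambda>q. rho2 bc (fst q, (x, snd q)))"
    and bx: "has_trace V (on_arc (phi2 s)) SX (\<lambda>q. face_x (x, q)) (\<lambda>q. on_arc (phi2 bc) (face_x (x, q)))"
      "has_trace V (on_arc (j1 s)) SX (\<lambda>q. face_x (x, q)) (\<lambda>q. on_arc (j1 bc) (face_x (x, q)))"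
      "has_trace V (on_arc (j2 s)) SX (\<lambda>q. face_x (x, q)) (\<lambda>q. on_arc (j2 bc) (face_x (x, q)))"
      "has_trace V (on_arc (w2d s)) SX (\<lambda>q. face_x (x, q)) (\<lambda>q. on_arc (w2d bc) (face_x (x, q)))"
    if "x \<in> {a, b}" for x
    using sol that
    unfolding boundary_data2_def Let_def rect I_def[symmetric] A_def[symmetric] Yv_def[symmetric]
      U_def[symmetric] V_def[symmetric] SX_def[symmetric]
    by (auto simp: case_prod_beta' face_x_def on_arc_def)
  have by0: "has_trace U (rho2 s) (I \<times> Xh) (\<lambda>q. (fst q, (snd q, y))) (\<lambda>q. rho2 bc (fst q, (snd q, y)))"
    and "by": "has_trace V (on_arc (phi2 s)) SY (\<lambda>q. face_y (y, q)) (\<lambda>q. on_arc (phi2 bc) (face_y (y, q)))"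
      "has_trace V (on_arc (j1 s)) SY (\<lambda>q. face_y (y, q)) (\<lambda>q. on_arc (j1 bc) (face_y (y, q)))"
      "has_trace V (on_arc (j2 s)) SY (\<lambda>q. face_y (y, q)) (\<lambda>q. on_arc (j2 bc) (face_y (y, q)))"
      "has_trace V (on_arc (w2d s)) SY (\<lambda>q. face_y (y, q)) (\<lambda>q. on_arc (w2d bc) (face_y (y, q)))"
    if "y \<in> {c, d}" for y
    using sol that
    unfolding boundary_data2_def Let_def rect I_def[symmetric] A_def[symmetric] Xh_def[symmetric]
      U_def[symmetric] V_def[symmetric] SY_def[symmetric]
    by (auto simp: case_prod_beta' face_y_def on_arc_def)

  \<comment> \<open>Errors and their traces\<close>
  \<comment> \<open>\<open>F\<close> ranges over field selectors such as \<open>phi2\<close> and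
    \<open>jplus\<close>, so one set of definitions covers the errors of all velocity-dependent
    fields.\<close>
  define e where "e F z = on_arc (F N) z - on_arc (F s) z" for F :: "state2 \<Rightarrow> real \<times> (real \<times> real) \<times> real \<times> real \<Rightarrow> real" and z
  define et where "et F z = on_arc (dt2 (F N)) z - weak_pd V ht (on_arc (F s)) z" for F :: "state2 \<Rightarrow> real \<times> (real \<times> real) \<times> real \<times> real \<Rightarrow> real" and z
  define ex where "ex F z = on_arc (dx2 (F N)) z - weak_pd V hx (on_arc (F s)) z" for F :: "state2 \<Rightarrow> real \<times> (real \<times> real) \<times> real \<times> real \<Rightarrow> real" and z
  define ey where "ey F z = on_arc (dy2 (F N)) z - weak_pd V hy (on_arc (F s)) z" for F :: "state2 \<Rightarrow> real \<times> (real \<times> real) \<times> real \<times> real \<Rightarrow> real" and z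
  define eb where "eb F z = on_arc (F N) z - on_arc (F bc) z" for F :: "state2 \<Rightarrow> real \<times> (real \<times> real) \<times> real \<times> real \<Rightarrow> real" and z
  define \<phi>0 where "\<phi>0 q = on_arc (phi2 N) (0, q) - phi2_IC ic (fst q, arc (snd q))" for q
  define w0 where "w0 q = on_arc (w2d N) (0, q) - w2d_IC ic (fst q, arc (snd q))" for q
  define p0 where "p0 q = on_arc (jplus N) (0, q) - (j1_IC ic (fst q, arc (snd q)) + j2_IC ic (fst q, arc (snd q)))" for q
  define m0 where "m0 q = on_arc (jminus N) (0, q) - (j2_IC ic (fst q, arc (snd q)) - j1_IC ic (fst q, arc (snd q)))" for q
  define \<rho> where "\<rho> z = rho2 N z - rho2 s z" for z
  define \<rho>t where "\<rho>t z = pd (1, (0, 0)) (rho2 N) z - weak_pd U (1, (0, 0)) (rho2 s) z" for z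
  define \<rho>x where "\<rho>x z = pd (0, (1, 0)) (rho2 N) z - weak_pd U (0, (1, 0)) (rho2 s) z" for z
  define \<rho>y where "\<rho>y z = pd (0, (0, 1)) (rho2 N) z - weak_pd U (0, (0, 1)) (rho2 s) z" for z
  define \<rho>0 where "\<rho>0 x = rho2 N (0, x) - rho2_IC ic x" for x
  define \<rho>b where "\<rho>b z = rho2 N z - rho2 bc z" for z
  have c0: "continuous_on UNIV (\<lambda>s. (0::real, s))" for s :: "'z::euclidean_space"
    by (intro continuous_intros)
  have cx: "continuous_on UNIV (\<lambda>q. face_x (x, q))" and cy: "continuous_on UNIV (\<lambda>q. face_y (x, q))" for x
    by (auto simp: face_x_def face_y_def intro!: continuous_intros)
  have cxU: "continuous_on UNIV (\<lambda>q::real \<times> real. (fst q, (x::real, snd q)))"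
    and cyU: "continuous_on UNIV (\<lambda>q::real \<times> real. (fst q, (snd q, x::real)))" for x
    by (auto intro!: continuous_intros)
  note smN = N[unfolded network2_def]
  have smooth_rho: "smooth (rho2 N)" using smN by simp

  have trt: "trV V ht (X \<times> A) (\<lambda>q. (0, q)) (e phi2) (et phi2) \<phi>0"
      "trV V ht (X \<times> A) (\<lambda>q. (0, q)) (e w2d) (et w2d) w0"
      "trV V ht (X \<times> A) (\<lambda>q. (0, q)) (e jplus) (et jplus) p0"
      "trV V ht (X \<times> A) (\<lambda>q. (0, q)) (e jminus) (et jminus) m0"
    using field_errors[OF N H(2-5) ini Vbox domp(6,5) c0 bas(1) ht_def refl]
    unfolding e_def[abs_def] et_def[abs_def] \<phi>0_def[abs_def] w0_def[abs_def] p0_def[abs_def] m0_def[abs_def] .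
  have jb: "on_arc (jplus N) z - (on_arc (j1 bc) z + on_arc (j2 bc) z) = eb jplus z"
      "on_arc (jminus N) z - (on_arc (j2 bc) z - on_arc (j1 bc) z) = eb jminus z" for z
    by (simp_all add: eb_def on_arc_jplus[of bc] on_arc_jminus[of bc])
  have trx: "trV V hx SX (\<lambda>q. face_x (x, q)) (e phi2) (ex phi2) (\<lambda>q. eb phi2 (face_x (x, q)))"
      "trV V hx SX (\<lambda>q. face_x (x, q)) (e w2d) (ex w2d) (\<lambda>q. eb w2d (face_x (x, q)))"
      "trV V hx SX (\<lambda>q. face_x (x, q)) (e jplus) (ex jplus) (\<lambda>q. eb jplus (face_x (x, q)))"
      "trV V hx SX (\<lambda>q. face_x (x, q)) (e jminus) (ex jminus) (\<lambda>q. eb jminus (face_x (x, q)))"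
    if "x \<in> {a, b}" for x
    using field_errors[OF N H(2-5) bx[OF that] Vbox domp(8,7) cx bas(2) hx_def refl]
    unfolding jb by (simp_all add: e_def[abs_def] ex_def[abs_def] eb_def)
  have "try": "trV V hy SY (\<lambda>q. face_y (y, q)) (e phi2) (ey phi2) (\<lambda>q. eb phi2 (face_y (y, q)))"
      "trV V hy SY (\<lambda>q. face_y (y, q)) (e w2d) (ey w2d) (\<lambda>q. eb w2d (face_y (y, q)))"
      "trV V hy SY (\<lambda>q. face_y (y, q)) (e jplus) (ey jplus) (\<lambda>q. eb jplus (face_y (y, q)))"
      "trV V hy SY (\<lambda>q. face_y (y, q)) (e jminus) (ey jminus) (\<lambda>q. eb jminus (face_y (y, q)))"
    if "y \<in> {c, d}" for y
    using field_errors[OF N H(2-5) "by"[OF that] Vbox domp(10,9) cy bas(3) hy_def refl]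
    unfolding jb by (simp_all add: e_def[abs_def] ey_def[abs_def] eb_def)
  have tr\<rho>: "trV U (1, (0, 0)) X (\<lambda>x. (0, x)) \<rho> \<rho>t \<rho>0"
    using error_trV[OF ini0 H(1) basU(1) smooth_cdiff[OF smooth_rho basU(1)] domp(2,1) dom(10,9) c0]
    unfolding \<rho>_def[abs_def] \<rho>t_def[abs_def] \<rho>0_def[abs_def] .
  have tr\<rho>x: "trV U (0, (1, 0)) (I \<times> Yv) (\<lambda>q. (fst q, (x, snd q))) \<rho> \<rho>x (\<lambda>q. \<rho>b (fst q, (x, snd q)))"
    if "x \<in> {a, b}" for x
    using error_trV[OF bx0[OF that] H(1) basU(2) smooth_cdiff[OF smooth_rho basU(2)] domp(2,1) domp(12,11) cxU]
    unfolding \<rho>_def[abs_def] \<rho>x_def[abs_def] \<rho>b_def .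
  have tr\<rho>y: "trV U (0, (0, 1)) (I \<times> Xh) (\<lambda>q. (fst q, (snd q, y))) \<rho> \<rho>y (\<lambda>q. \<rho>b (fst q, (snd q, y)))"
    if "y \<in> {c, d}" for y
    using error_trV[OF by0[OF that] H(1) basU(3) smooth_cdiff[OF smooth_rho basU(3)] domp(2,1) domp(14,13) cyU]
    unfolding \<rho>_def[abs_def] \<rho>y_def[abs_def] \<rho>b_def .
  have abcd: "a \<in> {a, b}" "b \<in> {a, b}" "c \<in> {c, d}" "d \<in> {c, d}" by auto

  define r where "r z = \<rho> (\<pi> z) + \<epsilon>\<^sup>2 * e w2d z" for z
  define rx where "rx z = \<rho>x (\<pi> z) + \<epsilon>\<^sup>2 * ex w2d z" for z
  define ry where "ry z = \<rho>y (\<pi> z) + \<epsilon>\<^sup>2 * ey w2d z" for z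
  define rbx where "rbx x q = \<rho>b (fst (\<pi>b q), (x, snd (\<pi>b q))) + \<epsilon>\<^sup>2 * eb w2d (face_x (x, q))" for x q
  define rby where "rby y q = \<rho>b (fst (\<pi>b q), (snd (\<pi>b q), y)) + \<epsilon>\<^sup>2 * eb w2d (face_y (y, q))" for y q
  have trr: "trV V hx SX (\<lambda>q. face_x (x, q)) r rx (rbx x)" if "x \<in> {a, b}" for x
  proof -
    have "trV V hx SX (\<lambda>q. face_x (x, q)) (\<lambda>z. \<rho> (\<pi> z)) (\<lambda>z. \<rho>x (\<pi> z)) (\<lambda>q. \<rho>b (fst (\<pi>b q), (x, snd (\<pi>b q))))"
      using trV_lift[OF fV fSX tr\<rho>x[OF that], of hx "\<lambda>q. face_x (x, q)"]
      by (simp add: assoc'_def \<pi>_def \<pi>b_def face_x_def hx_def)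
    then show ?thesis unfolding r_def[abs_def] rx_def[abs_def] rbx_def[abs_def]
      by (intro trV_add trV_cmult trx that)
  qed
  have trry: "trV V hy SY (\<lambda>q. face_y (y, q)) r ry (rby y)" if "y \<in> {c, d}" for y
  proof -
    have "trV V hy SY (\<lambda>q. face_y (y, q)) (\<lambda>z. \<rho> (\<pi> z)) (\<lambda>z. \<rho>y (\<pi> z)) (\<lambda>q. \<rho>b (fst (\<pi>b q), (snd (\<pi>b q), y)))"
      using trV_lift[OF fV fSY tr\<rho>y[OF that], of hy "\<lambda>q. face_y (y, q)"]
      by (simp add: assoc'_def \<pi>_def \<pi>b_def face_y_def hy_def)
    then show ?thesis unfolding r_def[abs_def] ry_def[abs_def] rby_def[abs_def]
      by (intro trV_add trV_cmult "try" that)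
  qed
  note s\<rho> = trV_sqint[OF tr\<rho>]
  note st = trV_sqint[OF trt(1)] trV_sqint[OF trt(2)] trV_sqint[OF trt(3)] trV_sqint[OF trt(4)]
  note sx = trV_sqint(2)[OF trx(1)[OF abcd(1)]] trV_sqint(2)[OF trx(2)[OF abcd(1)]]
    trV_sqint(2)[OF trx(3)[OF abcd(1)]] trV_sqint(2)[OF trx(4)[OF abcd(1)]] trV_sqint(2)[OF trr[OF abcd(1)]]
  note sy = trV_sqint(2)[OF "try"(1)[OF abcd(3)]] trV_sqint(2)[OF "try"(2)[OF abcd(3)]]
    trV_sqint(2)[OF "try"(3)[OF abcd(3)]] trV_sqint(2)[OF "try"(4)[OF abcd(3)]] trV_sqint(2)[OF trry[OF abcd(3)]]
  have cosb: "sqint (lb V) (\<lambda>z. cos (snd (snd z)) * f z)" and sinb: "sqint (lb V) (\<lambda>z. sin (snd (snd z)) * f z)"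
    if "sqint (lb V) f" for f
    using that
    by (auto intro!: sqint_bounded_mult[where K=1] continuous_on_UNIV_borel_lb continuous_intros)
  have lift: "sqint (lb V) (\<lambda>z. f (\<pi> z))" if "sqint (lb U) f" for f
    using V.lift_sqint[OF that] by (simp add: V\<pi>)
  have sN: "sqint (lb V) (on_arc n)" "sqint (lb V) (on_arc (dt2 n))" "sqint (lb V) (on_arc (dx2 n))" "sqint (lb V) (on_arc (dy2 n))"
    if "smooth n" for n
    using cdiff_on_arc[OF that bas(1)[unfolded ht_def]] cdiff_on_arc[OF that bas(2)[unfolded hx_def]]
      cdiff_on_arc[OF that bas(3)[unfolded hy_def]] domp
    by (auto simp: cdiff_def intro!: sqint_continuous_lb)
  have smp: "smooth (jplus N)" unfolding jplus_def by (intro smooth_add) (use smN in auto)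
  have smm: "smooth (jminus N)"
  proof -
    have "smooth (\<lambda>p. j2 N p + (-1) * j1 N p)" by (intro smooth_add smooth_mult smooth_const) (use smN in auto)
    then show ?thesis by (simp add: jminus_def)
  qed
  have sm: "smooth (phi2 N)" "smooth (w2d N)" using smN by auto
  have sNU: "sqint (lb U) (pd (1, (0, 0)) (rho2 N))" "sqint (lb U) (pd (0, (1, 0)) (rho2 N))" "sqint (lb U) (pd (0, (0, 1)) (rho2 N))"
    using domp basU smooth_rho by (auto intro!: sqint_continuous_lb smooth_continuous smooth_pd)

  \<comment> \<open>Error equations with the residuals as sources\<close>
  define QN where "QN z = cos (snd (snd z)) * on_arc (dx2 (jplus N)) z + sin (snd (snd z)) * on_arc (dy2 (jminus N)) z" for z
  define Q where "Q z = cos (snd (snd z)) * ex jplus z + sin (snd (snd z)) * ey jminus z" for z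
  define B where "B z = cos (snd (snd z)) * ex jminus z + sin (snd (snd z)) * ey jplus z" for z
  define C where "C z = 2 * (cos (snd (snd z)) * rx z) + sin (snd (snd z)) * ey phi2 z" for z
  define E where "E z = cos (snd (snd z)) * ex phi2 z + 2 * (sin (snd (snd z)) * ry z)" for z
  have sQN: "sqint (lb V) QN" unfolding QN_def by (intro sqint_add cosb sinb sN smp smm)
  have sQ: "sqint (lb V) Q" unfolding Q_def by (intro sqint_add cosb sinb sx sy)
  have sB: "sqint (lb V) B" unfolding B_def by (intro sqint_add cosb sinb sx sy)
  have sC: "sqint (lb V) C" unfolding C_def by (intro sqint_add sqint_cmult cosb sinb sx sy)
  have sE: "sqint (lb V) E" unfolding E_def by (intro sqint_add sqint_cmult cosb sinb sx sy)
  \<comment> \<open>The flux of the exact solution is the network flux minus the flux of the errors;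
    the averages follow this only almost everywhere, where the fibre integrals converge.\<close>
  have Aex: "Aex z = QN z - Q z" for z by (simp add: Aex_def QN_def Q_def ex_def ey_def algebra_simps)
  have avQ: "AE z in lb U. V.avb Aex z = V.avb QN z - V.avb Q z"
    unfolding Aex[abs_def]
    by (intro V.avb_diff_AE sqint_imp_integrable V.finite_V sQN sQ)
  define r1 where "r1 z = res2_1 N (fst z) (snd z)" for z
  define r2 where "r2 z = res2_2 \<epsilon> N (fst z) (fst (snd z)) (arc (snd (snd z)))" for z
  define r3 where "r3 z = res2_3 \<epsilon> N (fst z) (fst (snd z)) (arc (snd (snd z)))" for z
  define r4 where "r4 z = res2_4 \<epsilon> N (fst z) (fst (snd z)) (arc (snd (snd z)))" for z
  define r5 where "r5 z = res2_5 \<epsilon> N (fst z) (fst (snd z)) (arc (snd (snd z)))" for z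
  have arcs: "fst (arc \<alpha>) = cos \<alpha>" "snd (arc \<alpha>) = sin \<alpha>" for \<alpha> by (simp_all add: arc_def)
  have A2: "A2 N t x (arc \<alpha>) = QN (t, x, \<alpha>)" for t x \<alpha>
    by (simp add: A2_def QN_def on_arc_def arcs)
  have avA2: "avg2 (A2 N t x) = V.avb QN (t, x)" for t x
    unfolding avg2_def arc_integral_def A2 A_def[symmetric] by (rule avg)
  have r1: "r1 z = 2 * pd (1, (0, 0)) (rho2 N) z + V.avb QN z" for z
    by (simp add: r1_def res2_1_def avA2)
  have r2: "r2 z = 2 * \<epsilon>\<^sup>2 * on_arc (dt2 (w2d N)) z + QN z - V.avb QN (\<pi> z) + 2 * on_arc (w2d N) z" for z
    by (cases z) (simp add: r2_def res2_2_def avA2 A2 on_arc_def \<pi>_def)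
  have r3: "r3 z = on_arc (dt2 (phi2 N)) z + cos (snd (snd z)) * on_arc (dx2 (jminus N)) z
      + sin (snd (snd z)) * on_arc (dy2 (jplus N)) z + 1 / \<epsilon>\<^sup>2 * on_arc (phi2 N) z" for z
    by (cases z) (simp add: r3_def res2_3_def on_arc_def arcs)
  have r4: "r4 z = \<epsilon>\<^sup>2 * on_arc (dt2 (jplus N)) z + on_arc (jplus N) z
      + 2 * (cos (snd (snd z)) * (pd (0, (1, 0)) (rho2 N) (\<pi> z) + \<epsilon>\<^sup>2 * on_arc (dx2 (w2d N)) z))
      + sin (snd (snd z)) * on_arc (dy2 (phi2 N)) z" for z
    by (cases z) (simp add: r4_def res2_4_def on_arc_def arcs \<pi>_def)
  have r5: "r5 z = \<epsilon>\<^sup>2 * on_arc (dt2 (jminus N)) z + on_arc (jminus N) z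
      + cos (snd (snd z)) * on_arc (dx2 (phi2 N)) z
      + 2 * (sin (snd (snd z)) * (pd (0, (0, 1)) (rho2 N) (\<pi> z) + \<epsilon>\<^sup>2 * on_arc (dy2 (w2d N)) z))" for z
    by (cases z) (simp add: r5_def res2_5_def on_arc_def arcs \<pi>_def)
  have sr: "sqint (lb U) r1" "sqint (lb V) r2" "sqint (lb V) r3" "sqint (lb V) r4" "sqint (lb V) r5"
  proof -
    show "sqint (lb U) r1" unfolding r1[abs_def] by (intro sqint_add sqint_cmult sNU V.avb_sqint sQN)
    show "sqint (lb V) r2" unfolding r2[abs_def]
      by (intro sqint_add sqint_diff sqint_cmult sN sm lift V.avb_sqint sQN)
    show "sqint (lb V) r3" unfolding r3[abs_def]
      by (intro sqint_add sqint_cmult cosb sinb sN sm smp smm)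
    show "sqint (lb V) r4" unfolding r4[abs_def]
      by (intro sqint_add sqint_cmult cosb sinb lift sN sNU sm smp smm)
    show "sqint (lb V) r5" unfolding r5[abs_def]
      by (intro sqint_add sqint_cmult cosb sinb lift sN sNU sm smp smm)
  qed
  note exU = eqs(1)[folded AE_lb_iff[OF domp(1)]]
  note exV = eqs(2-5)[folded AE_lb_iff[OF domp(3)]]
  have eq1: "AE z in lb U. 2 * \<rho>t z + V.avb Q z = r1 z"
    using exU avQ by eventually_elim (simp add: \<rho>t_def r1 algebra_simps)
  have eq2: "AE z in lb V. 2 * \<epsilon>\<^sup>2 * et w2d z + Q z - V.avb Q (\<pi> z) + 2 * e w2d z = r2 z"
    using exV(1) V.lift_AE[OF avQ, unfolded V\<pi>]
    by eventually_elim (simp add: et_def e_def r2 Aex algebra_simps)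
  \<comment> \<open>The exact equation for \<phi> carries the factor \<epsilon>^2, whereas the
    residual is its version divided by \<epsilon>^2; hence the division here.\<close>
  have eq3: "AE z in lb V. et phi2 z + B z + e phi2 z / \<epsilon>\<^sup>2 = r3 z"
    using exV(2)
  proof eventually_elim
    case (elim z)
    have "\<epsilon>\<^sup>2 * (weak_pd V ht (on_arc (phi2 s)) z + cos (snd (snd z)) * weak_pd V hx (on_arc (jminus s)) z
        + sin (snd (snd z)) * weak_pd V hy (on_arc (jplus s)) z + on_arc (phi2 s) z / \<epsilon>\<^sup>2) = 0"
      using elim \<epsilon> by (simp add: algebra_simps)
    then have "weak_pd V ht (on_arc (phi2 s)) z + cos (snd (snd z)) * weak_pd V hx (on_arc (jminus s)) z
        + sin (snd (snd z)) * weak_pd V hy (on_arc (jplus s)) z + on_arc (phi2 s) z / \<epsilon>\<^sup>2 = 0"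
      using \<epsilon> by simp
    then show ?case by (simp add: et_def e_def B_def ex_def ey_def r3 algebra_simps diff_divide_distrib)
  qed
  have eq4: "AE z in lb V. \<epsilon>\<^sup>2 * et jplus z + e jplus z + C z = r4 z"
    using exV(3) by eventually_elim (simp add: et_def e_def C_def rx_def \<rho>x_def ex_def ey_def r4 algebra_simps)
  have eq5: "AE z in lb V. \<epsilon>\<^sup>2 * et jminus z + e jminus z + E z = r5 z"
    using exV(4) by eventually_elim (simp add: et_def e_def E_def ry_def \<rho>y_def ex_def ey_def r5 algebra_simps)

  \<comment> \<open>Lateral boundary terms\<close>
  define bX where "bX x = (\<integral>q. (\<rho>b (fst q, (x, snd q)))\<^sup>2 \<partial>lb (I \<times> Yv))" for x
  define bY where "bY y = (\<integral>q. (\<rho>b (fst q, (snd q, y)))\<^sup>2 \<partial>lb (I \<times> Xh))" for y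
  define gX where "gX x q = (eb w2d (face_x (x, q)))\<^sup>2 + (eb phi2 (face_x (x, q)))\<^sup>2
      + (eb jplus (face_x (x, q)))\<^sup>2 + (eb jminus (face_x (x, q)))\<^sup>2" for x q
  define gY where "gY y q = (eb w2d (face_y (y, q)))\<^sup>2 + (eb phi2 (face_y (y, q)))\<^sup>2
      + (eb jplus (face_y (y, q)))\<^sup>2 + (eb jminus (face_y (y, q)))\<^sup>2" for y q
  define cX where "cX x = integral\<^sup>L (lb SX) (gX x)" for x
  define cY where "cY y = integral\<^sup>L (lb SY) (gY y)" for y
  define B1 where "B1 = (\<Sum>y\<in>{c, d}. bY y) + (\<Sum>x\<in>{a, b}. bX x)"
  define B2 where "B2 = (\<Sum>y\<in>{c, d}. cY y) + (\<Sum>x\<in>{a, b}. cX x)"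
  define \<beta> where "\<beta> = 8 * (T + 1) * (B1 + B2)"
  note sqi = sqint_integrable_sq
  have iX: "integrable (lb SX) (gX x)" if "x \<in> {a, b}" for x
    unfolding gX_def[abs_def] using trx[OF that]
    by (intro Bochner_Integration.integrable_add sqi trV_sqint(3))
  have iY: "integrable (lb SY) (gY y)" if "y \<in> {c, d}" for y
    unfolding gY_def[abs_def] using "try"[OF that]
    by (intro Bochner_Integration.integrable_add sqi trV_sqint(3))
  \<comment> \<open>The coefficients collect the factors in 2 J1 + J2 and 2 J3 + J4 below: on
    vertical sides r is paired with j1 + j2 and \<phi> with j2 - j1, on horizontal sides the two
    pairings are exchanged.\<close>
  define nX where "nX x = 2 * (\<integral>q. (rbx x q)\<^sup>2 \<partial>lb SX) + (\<integral>q. (eb phi2 (face_x (x, q)))\<^sup>2 \<partial>lb SX)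
      + 2 * (\<integral>q. (eb jplus (face_x (x, q)))\<^sup>2 \<partial>lb SX) + (\<integral>q. (eb jminus (face_x (x, q)))\<^sup>2 \<partial>lb SX)" for x
  define nY where "nY y = 2 * (\<integral>q. (rby y q)\<^sup>2 \<partial>lb SY) + (\<integral>q. (eb phi2 (face_y (y, q)))\<^sup>2 \<partial>lb SY)
      + (\<integral>q. (eb jplus (face_y (y, q)))\<^sup>2 \<partial>lb SY) + 2 * (\<integral>q. (eb jminus (face_y (y, q)))\<^sup>2 \<partial>lb SY)" for y
  \<comment> \<open>Lifting boundary values of \<rho> to a fibre of length pi/2 produces the factor
    pi; bounding it by 4 gives the constant 8 in both estimates below.\<close>
  have pi4: "pi * z \<le> 4 * z" if "0 \<le> z" for z
    using that pi_less_4 by (intro mult_right_mono) auto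
  have nX: "nX x \<le> 8 * (bX x + cX x)" if x: "x \<in> {a, b}" for x
  proof -
    note t = trV_sqint(3)[OF trx(1)[OF x]] trV_sqint(3)[OF trx(2)[OF x]] trV_sqint(3)[OF trx(3)[OF x]]
      trV_sqint(3)[OF trx(4)[OF x]]
    have "(\<integral>q. (rbx x q)\<^sup>2 \<partial>lb SX) \<le> pi * bX x + 2 * (\<integral>q. (eb w2d (face_x (x, q)))\<^sup>2 \<partial>lb SX)"
      using SX.lifted_trace_bound[OF trV_sqint(3)[OF tr\<rho>x[OF x]] t(2), of \<epsilon>] \<epsilon>
      by (simp add: SX\<pi> rbx_def bX_def)
    moreover have "cX x = (\<integral>q. (eb w2d (face_x (x, q)))\<^sup>2 \<partial>lb SX) + (\<integral>q. (eb phi2 (face_x (x, q)))\<^sup>2 \<partial>lb SX)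
      + (\<integral>q. (eb jplus (face_x (x, q)))\<^sup>2 \<partial>lb SX) + (\<integral>q. (eb jminus (face_x (x, q)))\<^sup>2 \<partial>lb SX)"
      unfolding cX_def gX_def[abs_def] using t by (simp add: sqi)
    moreover have "0 \<le> (\<integral>q. (eb w2d (face_x (x, q)))\<^sup>2 \<partial>lb SX)" "0 \<le> (\<integral>q. (eb phi2 (face_x (x, q)))\<^sup>2 \<partial>lb SX)"
      "0 \<le> (\<integral>q. (eb jplus (face_x (x, q)))\<^sup>2 \<partial>lb SX)" "0 \<le> (\<integral>q. (eb jminus (face_x (x, q)))\<^sup>2 \<partial>lb SX)" by simp_all
    moreover have "pi * bX x \<le> 4 * bX x" by (rule pi4) (simp add: bX_def)
    ultimately show ?thesis unfolding nX_def distrib_left by linarith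
  qed
  have nY: "nY y \<le> 8 * (bY y + cY y)" if y: "y \<in> {c, d}" for y
  proof -
    note t = trV_sqint(3)[OF "try"(1)[OF y]] trV_sqint(3)[OF "try"(2)[OF y]] trV_sqint(3)[OF "try"(3)[OF y]]
      trV_sqint(3)[OF "try"(4)[OF y]]
    have "(\<integral>q. (rby y q)\<^sup>2 \<partial>lb SY) \<le> pi * bY y + 2 * (\<integral>q. (eb w2d (face_y (y, q)))\<^sup>2 \<partial>lb SY)"
      using SY.lifted_trace_bound[OF trV_sqint(3)[OF tr\<rho>y[OF y]] t(2), of \<epsilon>] \<epsilon>
      by (simp add: SY\<pi> rby_def bY_def)
    moreover have "cY y = (\<integral>q. (eb w2d (face_y (y, q)))\<^sup>2 \<partial>lb SY) + (\<integral>q. (eb phi2 (face_y (y, q)))\<^sup>2 \<partial>lb SY)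
      + (\<integral>q. (eb jplus (face_y (y, q)))\<^sup>2 \<partial>lb SY) + (\<integral>q. (eb jminus (face_y (y, q)))\<^sup>2 \<partial>lb SY)"
      unfolding cY_def gY_def[abs_def] using t by (simp add: sqi)
    moreover have "0 \<le> (\<integral>q. (eb w2d (face_y (y, q)))\<^sup>2 \<partial>lb SY)" "0 \<le> (\<integral>q. (eb phi2 (face_y (y, q)))\<^sup>2 \<partial>lb SY)"
      "0 \<le> (\<integral>q. (eb jplus (face_y (y, q)))\<^sup>2 \<partial>lb SY)" "0 \<le> (\<integral>q. (eb jminus (face_y (y, q)))\<^sup>2 \<partial>lb SY)" by simp_all
    moreover have "pi * bY y \<le> 4 * bY y" by (rule pi4) (simp add: bY_def)
    ultimately show ?thesis unfolding nY_def distrib_left by linarith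
  qed
  have bdry: "- (\<integral>z. P (fst z) * (2 * (\<rho> (\<pi> z) + \<epsilon>\<^sup>2 * e w2d z) * Q z + e phi2 z * B z + e jplus z * C z + e jminus z * E z) \<partial>lb V) \<le> \<beta>"
    if cP: "continuous_on UNIV P" and P: "\<And>t. 0 < t \<Longrightarrow> t < T \<Longrightarrow> \<bar>P t\<bar> \<le> T + 1" for P
  proof -
    define mc where "mc z = P (fst z) * cos (snd (snd z))" for z :: "real \<times> (real \<times> real) \<times> real"
    define ms where "ms z = P (fst z) * sin (snd (snd z))" for z :: "real \<times> (real \<times> real) \<times> real"
    have cm: "continuous_on UNIV mc" "continuous_on UNIV ms" unfolding mc_def[abs_def] ms_def[abs_def]
      by (intro continuous_intros continuous_on_compose2[OF cP]; simp)+
    have inv: "mc (z + t *\<^sub>R hx) = mc z" "ms (z + t *\<^sub>R hy) = ms z" for z t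
      by (simp_all add: mc_def ms_def hx_def hy_def)
    have hxy: "hx = face_x (1, 0)" "hy = face_y (1, 0)"
      by (simp_all add: hx_def hy_def face_x_def face_y_def zero_prod_def)
    have preim: "face_x -` V = {a<..<b} \<times> SX" "face_y -` V = {c<..<d} \<times> SY"
      by (auto simp: face_x_def face_y_def V_def X_def SX_def SY_def Xh_def Yv_def)
    have mb: "\<bar>mc (face_x (x, q))\<bar> \<le> T + 1" if "q \<in> SX" for x q
    proof -
      have "\<bar>P (fst q)\<bar> * \<bar>cos (snd (snd q))\<bar> \<le> (T + 1) * 1"
        using that T by (intro mult_mono P) (auto simp: SX_def I_def)
      then show ?thesis by (simp add: mc_def face_x_def abs_mult)
    qed
    have mb': "\<bar>ms (face_y (y, q))\<bar> \<le> T + 1" if "q \<in> SY" for y q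
    proof -
      have "\<bar>P (fst q)\<bar> * \<bar>sin (snd (snd q))\<bar> \<le> (T + 1) * 1"
        using that T by (intro mult_mono P) (auto simp: SY_def I_def)
      then show ?thesis by (simp add: ms_def face_y_def abs_mult)
    qed
    have T1: "0 \<le> T + 1" using T by simp
    define J1 where "J1 = (\<integral>z. mc z * (r z * ex jplus z + rx z * e jplus z) \<partial>lb V)"
    define J2 where "J2 = (\<integral>z. mc z * (e phi2 z * ex jminus z + ex phi2 z * e jminus z) \<partial>lb V)"
    define J3 where "J3 = (\<integral>z. ms z * (r z * ey jminus z + ry z * e jminus z) \<partial>lb V)"
    define J4 where "J4 = (\<integral>z. ms z * (e phi2 z * ey jplus z + ey phi2 z * e jplus z) \<partial>lb V)"
    have gx: "\<bar>\<integral>z. mc z * (u z * v' z + u' z * v z) \<partial>lb V\<bar>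
        \<le> (T + 1) * ((\<integral>q. (gu a q)\<^sup>2 \<partial>lb SX) + (\<integral>q. (gv a q)\<^sup>2 \<partial>lb SX) + (\<integral>q. (gu b q)\<^sup>2 \<partial>lb SX) + (\<integral>q. (gv b q)\<^sup>2 \<partial>lb SX))"
      if "\<And>x. x \<in> {a, b} \<Longrightarrow> trV V hx SX (\<lambda>q. face_x (x, q)) u u' (gu x)"
        "\<And>x. x \<in> {a, b} \<Longrightarrow> trV V hx SX (\<lambda>q. face_x (x, q)) v v' (gv x)" for u u' gu v v' gv
      by (rule green_slab_bound[OF perm_iso_face_x preim(1) ab domp(8,7) hxy(1) that(1)[OF abcd(1)] that(2)[OF abcd(1)]
          that(1)[OF abcd(2)] that(2)[OF abcd(2)] cm(1) inv(1) mb T1])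
    have gy: "\<bar>\<integral>z. ms z * (u z * v' z + u' z * v z) \<partial>lb V\<bar>
        \<le> (T + 1) * ((\<integral>q. (gu c q)\<^sup>2 \<partial>lb SY) + (\<integral>q. (gv c q)\<^sup>2 \<partial>lb SY) + (\<integral>q. (gu d q)\<^sup>2 \<partial>lb SY) + (\<integral>q. (gv d q)\<^sup>2 \<partial>lb SY))"
      if "\<And>y. y \<in> {c, d} \<Longrightarrow> trV V hy SY (\<lambda>q. face_y (y, q)) u u' (gu y)"
        "\<And>y. y \<in> {c, d} \<Longrightarrow> trV V hy SY (\<lambda>q. face_y (y, q)) v v' (gv y)" for u u' gu v v' gv
      by (rule green_slab_bound[OF perm_iso_face_y preim(2) cd domp(10,9) hxy(2) that(1)[OF abcd(3)] that(2)[OF abcd(3)]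
          that(1)[OF abcd(4)] that(2)[OF abcd(4)] cm(2) inv(2) mb' T1])
    note J = gx[OF trr trx(3), folded J1_def] gx[OF trx(1) trx(4), folded J2_def]
      gy[OF trry "try"(4), folded J3_def] gy[OF "try"(1) "try"(3), folded J4_def]
    note sr0 = trV_sqint(1)[OF trr[OF abcd(1)]]
    have int: "integrable (lb V) (\<lambda>z. mc z * (u z * v' z + u' z * v z))" "integrable (lb V) (\<lambda>z. ms z * (u z * v' z + u' z * v z))"
      if "sqint (lb V) u" "sqint (lb V) u'" "sqint (lb V) v" "sqint (lb V) v'" for u u' v v'
      unfolding distrib_left
      by (intro Bochner_Integration.integrable_add weighted_integrable cm domp that)+
    \<comment> \<open>The flux terms combine to 2 cos \<alpha> \<partial>_x (r p) + cos \<alpha>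
      \<partial>_x (\<phi> m) + 2 sin \<alpha> \<partial>_y (r m) + sin \<alpha> \<partial>_y
      (\<phi> p), with p = j1 + j2 and m = j2 - j1; this symmetry reduces them to four applications
      of Green's formula.\<close>
    have "(\<integral>z. P (fst z) * (2 * (\<rho> (\<pi> z) + \<epsilon>\<^sup>2 * e w2d z) * Q z + e phi2 z * B z + e jplus z * C z + e jminus z * E z) \<partial>lb V)
       = (\<integral>z. 2 * (mc z * (r z * ex jplus z + rx z * e jplus z)) + mc z * (e phi2 z * ex jminus z + ex phi2 z * e jminus z)
          + 2 * (ms z * (r z * ey jminus z + ry z * e jminus z)) + ms z * (e phi2 z * ey jplus z + ey phi2 z * e jplus z) \<partial>lb V)"
      by (intro Bochner_Integration.integral_cong refl)
        (simp add: mc_def ms_def r_def Q_def B_def C_def E_def algebra_simps)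
    also have "\<dots> = 2 * J1 + J2 + 2 * J3 + J4"
      unfolding J1_def J2_def J3_def J4_def using int sr0 sx sy st by simp
    finally have eq: "(\<integral>z. P (fst z) * (2 * (\<rho> (\<pi> z) + \<epsilon>\<^sup>2 * e w2d z) * Q z + e phi2 z * B z + e jplus z * C z + e jminus z * E z) \<partial>lb V)
       = 2 * J1 + J2 + 2 * J3 + J4" .
    have "- (2 * J1 + J2 + 2 * J3 + J4) \<le> 2 * \<bar>J1\<bar> + \<bar>J2\<bar> + 2 * \<bar>J3\<bar> + \<bar>J4\<bar>" by simp
    also have "\<dots> \<le> (T + 1) * ((nX a + nX b) + (nY c + nY d))"
      using J unfolding nX_def nY_def by (simp add: algebra_simps)
    also have "\<dots> \<le> (T + 1) * ((8 * (bX a + cX a) + 8 * (bX b + cX b)) + (8 * (bY c + cY c) + 8 * (bY d + cY d)))"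
      by (intro mult_left_mono add_mono nX nY T1) auto
    also have "\<dots> = \<beta>" using ab cd by (simp add: \<beta>_def B1_def B2_def algebra_simps)
    finally show ?thesis unfolding eq .
  qed

  \<comment> \<open>Application of the parity estimate\<close>
  have est: "(\<integral>z. (\<rho> (\<pi> z) + \<epsilon>\<^sup>2 * e w2d z + e phi2 z / 2 + \<epsilon> * (e jplus z + e jminus z) / 2)\<^sup>2 \<partial>lb V)
    \<le> 96 * (T + 1) ^ 3 * (2 * (pi/2) + 4) *
     ((\<integral>x. (\<rho>0 x)\<^sup>2 \<partial>lb X) + \<epsilon>^4 * (\<integral>s. (w0 s)\<^sup>2 \<partial>lb (X \<times> A)) + (\<integral>s. (\<phi>0 s)\<^sup>2 \<partial>lb (X \<times> A))
      + \<epsilon>\<^sup>2 * (\<integral>s. (p0 s)\<^sup>2 \<partial>lb (X \<times> A)) + \<epsilon>\<^sup>2 * (\<integral>s. (m0 s)\<^sup>2 \<partial>lb (X \<times> A))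
      + (\<integral>b. (r1 b)\<^sup>2 \<partial>lb U) + (\<integral>z. (r2 z)\<^sup>2 \<partial>lb V) + (\<integral>z. (r3 z)\<^sup>2 \<partial>lb V)
      + (\<integral>z. (r4 z)\<^sup>2 \<partial>lb V) + (\<integral>z. (r5 z)\<^sup>2 \<partial>lb V)) + 3 * \<beta>"
  proof (rule parity_estimate[where X=X and U=U and V=V and A=A and a="pi/2" and T=T and \<epsilon>=\<epsilon> and \<pi>=\<pi> and \<beta>=\<beta>
       and \<rho>=\<rho> and \<rho>'=\<rho>t and ?\<rho>0.0=\<rho>0 and w="e w2d" and w'="et w2d" and ?w0.0=w0
       and \<phi>="e phi2" and \<phi>'="et phi2" and ?\<phi>0.0=\<phi>0
       and p="e jplus" and p'="et jplus" and ?p0.0=p0 and m="e jminus" and m'="et jminus" and ?m0.0=m0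
       and Q=Q and B=B and C=C and E=E
       and ?d1.0=r1 and ?d2.0=r2 and ?d3.0=r3 and ?d4.0=r4 and ?d5.0=r5])
    show "V = {0<..<T} \<times> (X \<times> A)" "U = {0<..<T} \<times> X" by (simp_all add: V_def U_def I_def)
    show "\<pi> = (\<lambda>z. (fst z, fst (snd z)))" by (rule ext) (simp add: \<pi>_def)
    have h0: "(1, 0) = ht" "(1, 0) = (1 :: real, (0 :: real, 0 :: real))" by (simp_all add: ht_def zero_prod_def)
    show "trV V (1, 0) (X \<times> A) (\<lambda>q. (0, q)) (e phi2) (et phi2) \<phi>0"
      "trV V (1, 0) (X \<times> A) (\<lambda>q. (0, q)) (e w2d) (et w2d) w0"
      "trV V (1, 0) (X \<times> A) (\<lambda>q. (0, q)) (e jplus) (et jplus) p0"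
      "trV V (1, 0) (X \<times> A) (\<lambda>q. (0, q)) (e jminus) (et jminus) m0"
      "trV U (1, 0) X (\<lambda>x. (0, x)) \<rho> \<rho>t \<rho>0"
      unfolding h0 by (fact trt tr\<rho>)+
  qed (fact A_def dom T pi2 \<epsilon> sQ sB sC sE sr eq1 eq2 eq3 eq4 eq5 bdry)+

  \<comment> \<open>Comparison with the loss\<close>
  define P1 where "P1 = (\<integral>b. (r1 b)\<^sup>2 \<partial>lb U)"
  define P2 where "P2 = (\<integral>z. (r2 z)\<^sup>2 \<partial>lb V) + (\<integral>z. (r3 z)\<^sup>2 \<partial>lb V) + (\<integral>z. (r4 z)\<^sup>2 \<partial>lb V) + (\<integral>z. (r5 z)\<^sup>2 \<partial>lb V)"
  define I1 where "I1 = (\<integral>x. (\<rho>0 x)\<^sup>2 \<partial>lb X)"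
  define h0 where "h0 q = \<epsilon>^4 * (w0 q)\<^sup>2 + (\<phi>0 q)\<^sup>2 + \<epsilon>^2 * (p0 q)\<^sup>2 + \<epsilon>^2 * (m0 q)\<^sup>2" for q
  define I2 where "I2 = integral\<^sup>L (lb (X \<times> A)) h0"
  have ih0: "integrable (lb (X \<times> A)) h0"
    unfolding h0_def[abs_def] using st by (simp add: sqi)
  have nn: "0 \<le> P1" "0 \<le> P2" "0 \<le> I1" "0 \<le> I2" "0 \<le> B1" "0 \<le> B2"
    by (auto simp: P1_def P2_def I1_def I2_def B1_def B2_def bX_def bY_def cX_def cY_def gX_def gY_def h0_def
        intro!: add_nonneg_nonneg sum_nonneg)
  have I2eq: "I2 = \<epsilon>^4 * (\<integral>s. (w0 s)\<^sup>2 \<partial>lb (X \<times> A)) + (\<integral>s. (\<phi>0 s)\<^sup>2 \<partial>lb (X \<times> A))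
      + \<epsilon>\<^sup>2 * (\<integral>s. (p0 s)\<^sup>2 \<partial>lb (X \<times> A)) + \<epsilon>\<^sup>2 * (\<integral>s. (m0 s)\<^sup>2 \<partial>lb (X \<times> A))"
    unfolding I2_def h0_def[abs_def] using st by (simp add: sqi)
  have total: "R_total2 T a b c d \<epsilon> s N
      = (\<integral>z. (\<rho> (\<pi> z) + \<epsilon>\<^sup>2 * e w2d z + e phi2 z / 2 + \<epsilon> * (e jplus z + e jminus z) / 2)\<^sup>2 \<partial>lb V)"
  proof -
    have "R_total2 T a b c d \<epsilon> s N = (\<integral>z. (on_arc (f2 \<epsilon> s) z - on_arc (f2 \<epsilon> N) z)\<^sup>2 \<partial>lb V)"
      unfolding R_total2_def rect I_def[symmetric] A_def[symmetric] V_def[symmetric] set_integral_lb[OF domp(3)]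
      by (simp add: case_prod_beta' on_arc_def)
    also have "\<dots> = (\<integral>z. (\<rho> (\<pi> z) + \<epsilon>\<^sup>2 * e w2d z + e phi2 z / 2 + \<epsilon> * (e jplus z + e jminus z) / 2)\<^sup>2 \<partial>lb V)"
    proof (rule Bochner_Integration.integral_cong[OF refl])
      fix z
      have e: "on_arc (f2 \<epsilon> s) z - on_arc (f2 \<epsilon> N) z
          = - (\<rho> (\<pi> z) + \<epsilon>\<^sup>2 * e w2d z + e phi2 z / 2 + \<epsilon> * (e jplus z + e jminus z) / 2)"
        by (cases z) (simp add: f2_def on_arc_def \<rho>_def e_def \<pi>_def jplus_def jminus_def field_simps)
      show "(on_arc (f2 \<epsilon> s) z - on_arc (f2 \<epsilon> N) z)\<^sup>2
          = (\<rho> (\<pi> z) + \<epsilon>\<^sup>2 * e w2d z + e phi2 z / 2 + \<epsilon> * (e jplus z + e jminus z) / 2)\<^sup>2"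
        unfolding e by (rule power2_minus)
    qed
    finally show ?thesis .
  qed
  have up: "R_total2 T a b c d \<epsilon> s N \<le> 96 * (T + 1) ^ 3 * (pi + 4) * (I1 + I2 + P1 + P2) + 24 * (T + 1) * (B1 + B2)"
  proof -
    have "3 * \<beta> = 24 * (T + 1) * (B1 + B2)" by (simp add: \<beta>_def)
    then show ?thesis using est unfolding total I2eq P1_def P2_def I1_def by (simp add: add.assoc)
  qed

  define L where "L = (b - a) * (d - c)"
  define l where "l = 2 * (b - a) + 2 * (d - c)"
  have L0: "0 < L" "0 < l" using ab cd by (simp_all add: L_def l_def)
  have mX: "measure lborel X = L"
    unfolding X_def Xh_def Yv_def L_def using ab cd by (simp add: measure_lborel_Times)
  have mU: "measure lborel U = T * L"
    using dom mX T by (simp add: U_def measure_lborel_Times I_def)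
  have rV: "(LINT t:I|lborel. LINT x:X|lborel. arc_integral (\<lambda>v. (g \<epsilon> N t x v)\<^sup>2)) = (\<integral>z. (f z)\<^sup>2 \<partial>lb V)"
    if "sqint (lb V) f" "\<And>z. f z = g \<epsilon> N (fst z) (fst (snd z)) (arc (snd (snd z)))" for f g
    using integral_iterated3(1)[OF dom(1,2) dom(9,10) pi2, of "\<lambda>z. (f z)\<^sup>2"] sqi[OF that(1)]
    by (simp add: arc_integral_def V_def A_def that(2))
  have residual: "R_residual2 T a b c d \<epsilon> N = P1 / (T * L) + P2 / (T * L * (pi / 2))"
  proof -
    have 1: "(LINT t:I|lborel. LINT x:X|lborel. (res2_1 N t x)\<^sup>2) = P1"
      using integral_iterated2(1)[OF dom(1,9), of "\<lambda>b. (r1 b)\<^sup>2"] sqi[OF sr(1)]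
      by (simp add: P1_def U_def r1_def)
    show ?thesis
      unfolding R_residual2_def rect I_def[symmetric] U_def[symmetric] 1 mU
      using rV[of r2 res2_2, OF sr(2) r2_def] rV[of r3 res2_3, OF sr(3) r3_def]
        rV[of r4 res2_4, OF sr(4) r4_def] rV[of r5 res2_5, OF sr(5) r5_def]
      by (simp add: P2_def add.assoc)
  qed
  have initial: "R_initial2 a b c d lam1 lam2 \<epsilon> ic N = lam1 / L * I1 + lam2 / (L * (pi / 2)) * I2"
  proof -
    have h0: "(LINT x:X|lborel. arc_integral (\<lambda>v.
          \<epsilon>^4 * (w2d N (0, x, v) - w2d_IC ic (x, v))\<^sup>2
        + (phi2 N (0, x, v) - phi2_IC ic (x, v))\<^sup>2
        + \<epsilon>^2 * ((j1 N (0, x, v) + j2 N (0, x, v)) - (j1_IC ic (x, v) + j2_IC ic (x, v)))\<^sup>2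
        + \<epsilon>^2 * ((j2 N (0, x, v) - j1 N (0, x, v)) - (j2_IC ic (x, v) - j1_IC ic (x, v)))\<^sup>2))
      = (LINT x:X|lborel. LINT \<alpha>:A|lborel. h0 (x, \<alpha>))"
      by (simp add: arc_integral_def A_def h0_def w0_def \<phi>0_def p0_def m0_def on_arc_def jplus_def jminus_def)
    show ?thesis
      unfolding R_initial2_def rect mX h0 integral_iterated2(1)[OF dom(9,7) ih0] I2_def[symmetric]
      by (simp add: I1_def \<rho>0_def set_integral_lb[OF dom(9)])
  qed
  have boundary: "R_boundary2 T a b c d lam3 lam4 bc N = lam3 / (T * l) * B1 + lam4 / (T * l * (pi / 2)) * B2"
  proof -
    \<comment> \<open>Moving the time integral inside the sums over the sides requires integrability
      of every summand, supplied below by Fubini's theorem.\<close>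
    have sum2: "(LINT t:I|lborel. (\<Sum>y\<in>{c, d}. f y t) + (\<Sum>x\<in>{a, b}. g x t))
        = (\<Sum>y\<in>{c, d}. LINT t:I|lborel. f y t) + (\<Sum>x\<in>{a, b}. LINT t:I|lborel. g x t)"
      if "\<And>y. y \<in> {c, d} \<Longrightarrow> integrable (lb I) (f y)" "\<And>x. x \<in> {a, b} \<Longrightarrow> integrable (lb I) (g x)"
      for f g :: "real \<Rightarrow> real \<Rightarrow> real"
      unfolding set_integral_lb[OF dom(1)] using that
      by (subst Bochner_Integration.integral_add) (auto intro!: Bochner_Integration.integrable_sum
          simp: Bochner_Integration.integral_sum simp del: sum.insert)
    have iBX: "integrable (lb (I \<times> Yv)) (\<lambda>q. (\<rho>b (fst q, (x, snd q)))\<^sup>2)" if "x \<in> {a, b}" for x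
      by (rule sqi[OF trV_sqint(3)[OF tr\<rho>x[OF that]]])
    have iBY: "integrable (lb (I \<times> Xh)) (\<lambda>q. (\<rho>b (fst q, (snd q, y)))\<^sup>2)" if "y \<in> {c, d}" for y
      by (rule sqi[OF trV_sqint(3)[OF tr\<rho>y[OF that]]])
    have 1: "(LINT t:I|lborel. rect_boundary_integral a b c d (\<lambda>x. (rho2 N (t, x) - rho2 bc (t, x))\<^sup>2)) = B1"
    proof -
      have "(LINT t:I|lborel. rect_boundary_integral a b c d (\<lambda>x. (rho2 N (t, x) - rho2 bc (t, x))\<^sup>2))
        = (LINT t:I|lborel. (\<Sum>y\<in>{c, d}. LINT x:Xh|lborel. (\<rho>b (t, (x, y)))\<^sup>2) + (\<Sum>x\<in>{a, b}. LINT y:Yv|lborel. (\<rho>b (t, (x, y)))\<^sup>2))"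
        by (simp only: rect_boundary_integral_def Xh_def Yv_def \<rho>b_def)
      also have "\<dots> = (\<Sum>y\<in>{c, d}. LINT t:I|lborel. LINT x:Xh|lborel. (\<rho>b (t, (x, y)))\<^sup>2)
          + (\<Sum>x\<in>{a, b}. LINT t:I|lborel. LINT y:Yv|lborel. (\<rho>b (t, (x, y)))\<^sup>2)"
        using integral_iterated2(2)[OF dom(1,3) iBY] integral_iterated2(2)[OF dom(1,5) iBX]
        by (intro sum2) simp_all
      also have "\<dots> = B1" unfolding B1_def bX_def bY_def
        using integral_iterated2(1)[OF dom(1,3) iBY] integral_iterated2(1)[OF dom(1,5) iBX]
        by (intro arg_cong2[where f="(+)"] sum.cong refl) simp_all
      finally show ?thesis .
    qed
    have fx: "face_x (x, t, y, \<alpha>) = (t, (x, y), \<alpha>)" and fy: "face_y (y, t, x, \<alpha>) = (t, (x, y), \<alpha>)" for t x y \<alpha>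
      by (simp_all add: face_x_def face_y_def)
    have 2: "(LINT t:I|lborel. rect_boundary_integral a b c d (\<lambda>x. arc_integral (\<lambda>v.
          (w2d N (t, x, v) - w2d bc (t, x, v))\<^sup>2
        + (phi2 N (t, x, v) - phi2 bc (t, x, v))\<^sup>2
        + (jplus N (t, x, v) - jplus bc (t, x, v))\<^sup>2
        + (jminus N (t, x, v) - jminus bc (t, x, v))\<^sup>2))) = B2" (is "?l = _")
    proof -
      have "?l = (LINT t:I|lborel. (\<Sum>y\<in>{c, d}. LINT x:Xh|lborel. LINT \<alpha>:A|lborel. gY y (t, x, \<alpha>))
          + (\<Sum>x\<in>{a, b}. LINT y:Yv|lborel. LINT \<alpha>:A|lborel. gX x (t, y, \<alpha>)))"
        by (simp only: rect_boundary_integral_def arc_integral_def Xh_def Yv_def A_def gX_def gY_def fx fy eb_def on_arc_def split)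
      also have "\<dots> = (\<Sum>y\<in>{c, d}. LINT t:I|lborel. LINT x:Xh|lborel. LINT \<alpha>:A|lborel. gY y (t, x, \<alpha>))
          + (\<Sum>x\<in>{a, b}. LINT t:I|lborel. LINT y:Yv|lborel. LINT \<alpha>:A|lborel. gX x (t, y, \<alpha>))"
        using integral_iterated3(2)[OF dom(1-4) pi2, folded A_def, folded SY_def, OF iY]
          integral_iterated3(2)[OF dom(1,2) dom(5,6) pi2, folded A_def, folded SX_def, OF iX]
        by (intro sum2)
      also have "\<dots> = B2" unfolding B2_def cX_def cY_def
        using integral_iterated3(1)[OF dom(1-4) pi2, folded A_def, folded SY_def, OF iY]
          integral_iterated3(1)[OF dom(1,2) dom(5,6) pi2, folded A_def, folded SX_def, OF iX]
        by (intro arg_cong2[where f="(+)"] sum.cong refl)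
      finally show ?thesis .
    qed
    show ?thesis
      unfolding R_boundary2_def I_def[symmetric] 1 2 l_def[symmetric] using T by (simp add: I_def)
  qed
  define R where "R = R_APNN2 T a b c d lam1 lam2 lam3 lam4 \<epsilon> ic bc N"
  have R: "R = P1 / (T * L) + P2 / (T * L * (pi / 2)) + lam1 / L * I1 + lam2 / (L * (pi / 2)) * I2
      + lam3 / (T * l) * B1 + lam4 / (T * l * (pi / 2)) * B2"
    unfolding R_def R_APNN2_def residual initial boundary by simp
  have nonneg: "0 \<le> P1 / (T * L)" "0 \<le> P2 / (T * L * (pi / 2))" "0 \<le> lam1 / L * I1" "0 \<le> lam2 / (L * (pi / 2)) * I2"
    "0 \<le> lam3 / (T * l) * B1" "0 \<le> lam4 / (T * l * (pi / 2)) * B2"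
    using nn lam T L0 by auto
  show "0 \<le> R_APNN2 T a b c d lam1 lam2 lam3 lam4 \<epsilon> ic bc N"
    using nonneg R unfolding R_def by linarith
  \<comment> \<open>As all contributions are nonnegative, the loss bounds each of them
    separately.\<close>
  have "P1 / (T * L) \<le> R" "P2 / (T * L * (pi / 2)) \<le> R" "lam1 / L * I1 \<le> R" "lam2 / (L * (pi / 2)) * I2 \<le> R"
    "lam3 / (T * l) * B1 \<le> R" "lam4 / (T * l * (pi / 2)) * B2 \<le> R"
    using nonneg R by linarith+
  then have "P1 \<le> T * L * R" "P2 \<le> T * L * (pi / 2) * R" "I1 \<le> L / lam1 * R" "I2 \<le> L * (pi / 2) / lam2 * R"
    "B1 \<le> T * l / lam3 * R" "B2 \<le> T * l * (pi / 2) / lam4 * R"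
    using lam T L0 by (simp_all add: field_simps)
  then have "96 * (T + 1) ^ 3 * (pi + 4) * (I1 + I2 + P1 + P2) + 24 * (T + 1) * (B1 + B2)
     \<le> 96 * (T + 1) ^ 3 * (pi + 4) * (L / lam1 * R + L * (pi / 2) / lam2 * R + T * L * R + T * L * (pi / 2) * R)
       + 24 * (T + 1) * (T * l / lam3 * R + T * l * (pi / 2) / lam4 * R)"
    using T by (intro add_mono mult_left_mono) auto
  also have "\<dots> = rate2 T L l lam1 lam2 lam3 lam4 * R"
    by (simp only: rate2_def distrib_left distrib_right mult.assoc)
  finally show "R_total2 T a b c d \<epsilon> s N
      \<le> rate2 T ((b - a) * (d - c)) (2 * (b - a) + 2 * (d - c)) lam1 lam2 lam3 lam4
        * R_APNN2 T a b c d lam1 lam2 lam3 lam4 \<epsilon> ic bc N"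
    using up unfolding R_def L_def l_def by linarith
qed

section \<open>The main theorem\<close>

text \<open>For R in [0, 1] one has R^3 \<le> R^2, and the cube root is monotone. Here the smallness
  of the loss enters.\<close>

lemma le_root3_square:
  assumes "0 \<le> R" "R \<le> 1" shows "R \<le> root 3 (R\<^sup>2)"
proof -
  have "R ^ 3 \<le> R\<^sup>2" using assms by (intro power_decreasing) auto
  then have "root 3 (R ^ 3) \<le> root 3 (R\<^sup>2)" by simp
  then show ?thesis by (simp add: odd_real_root_power_cancel)
qed

text \<open>The factor \<open>\<bar>K\<bar> + 1\<close> is positive whatever \<open>K\<close> is, as
  the constant in the final statement has to be.\<close>

lemma linear_bound_imp_root3_bound:
  assumes "0 \<le> R" "R \<le> 1" "t \<le> K * R" shows "t \<le> (\<bar>K\<bar> + 1) * root 3 (R\<^sup>2)"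
proof -
  have "t \<le> (\<bar>K\<bar> + 1) * R"
    using assms by (intro order_trans[OF assms(3)] mult_right_mono) auto
  also have "\<dots> \<le> (\<bar>K\<bar> + 1) * root 3 (R\<^sup>2)"
    using le_root3_square[OF assms(1,2)] by (intro mult_left_mono) auto
  finally show ?thesis .
qed

theorem theorem1p2:
  fixes T lam1 lam2 lam3 lam4 :: real
    and xL xR :: real
    and s1 :: "real \<Rightarrow> state1" and ic1 :: "real \<Rightarrow> init1" and bc1 :: "real \<Rightarrow> state1"
    and N1 :: "real \<Rightarrow> 'p \<Rightarrow> state1"
    and a b c d :: real
    and s2 :: "real \<Rightarrow> state2" and ic2 :: "real \<Rightarrow> init2" and bc2 :: "real \<Rightarrow> state2"
    and N2 :: "real \<Rightarrow> 'q \<Rightarrow> state2"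
  assumes "0 < T" and "0 < lam1" and "0 < lam2" and "0 < lam3" and "0 < lam4"
  shows
    "(xL < xR \<and>
      (\<forall>\<epsilon>\<in>{0<..1}. exact_solution1 T xL xR \<epsilon> (s1 \<epsilon>) (ic1 \<epsilon>) (bc1 \<epsilon>)) \<and>
      (\<forall>\<epsilon>\<in>{0<..1}. \<forall>\<theta>. network1 (N1 \<epsilon> \<theta>))
      \<longrightarrow>
      (\<exists>C>0. \<exists>\<delta>>0. \<forall>\<epsilon>\<in>{0<..1}. \<forall>\<theta>.
         R_APNN1 T xL xR lam1 lam2 lam3 lam4 \<epsilon> (ic1 \<epsilon>) (bc1 \<epsilon>) (N1 \<epsilon> \<theta>) \<le> \<delta> \<longrightarrow>
         R_total1 T xL xR \<epsilon> (s1 \<epsilon>) (N1 \<epsilon> \<theta>)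
           \<le> C * root 3 ((R_APNN1 T xL xR lam1 lam2 lam3 lam4 \<epsilon> (ic1 \<epsilon>) (bc1 \<epsilon>) (N1 \<epsilon> \<theta>))\<^sup>2)))
     \<and>
     (a < b \<and> c < d \<and>
      (\<forall>\<epsilon>\<in>{0<..1}. exact_solution2 T a b c d \<epsilon> (s2 \<epsilon>) (ic2 \<epsilon>) (bc2 \<epsilon>)) \<and>
      (\<forall>\<epsilon>\<in>{0<..1}. \<forall>\<theta>. network2 (N2 \<epsilon> \<theta>))
      \<longrightarrow>
      (\<exists>C>0. \<exists>\<delta>>0. \<forall>\<epsilon>\<in>{0<..1}. \<forall>\<theta>.
         R_APNN2 T a b c d lam1 lam2 lam3 lam4 \<epsilon> (ic2 \<epsilon>) (bc2 \<epsilon>) (N2 \<epsilon> \<theta>) \<le> \<delta> \<longrightarrow>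
         R_total2 T a b c d \<epsilon> (s2 \<epsilon>) (N2 \<epsilon> \<theta>)
           \<le> C * root 3 ((R_APNN2 T a b c d lam1 lam2 lam3 lam4 \<epsilon> (ic2 \<epsilon>) (bc2 \<epsilon>) (N2 \<epsilon> \<theta>))\<^sup>2)))"
proof (intro conjI impI)
  \<comment> \<open>This serves as C, with \<delta> = 1. It depends only on T, the length of the
    interval and the penalty weights, which is the uniformity in \<epsilon> and in the network
    parameters.\<close>
  let ?K1 = "\<bar>rate1 T (xR - xL) lam1 lam2 lam3 lam4\<bar> + 1"
  assume hyp: "xL < xR \<and>
      (\<forall>\<epsilon>\<in>{0<..1}. exact_solution1 T xL xR \<epsilon> (s1 \<epsilon>) (ic1 \<epsilon>) (bc1 \<epsilon>)) \<and>
      (\<forall>\<epsilon>\<in>{0<..1}. \<forall>\<theta>. network1 (N1 \<epsilon> \<theta>))"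
  have "\<forall>\<epsilon>\<in>{0<..1}. \<forall>\<theta>.
      R_APNN1 T xL xR lam1 lam2 lam3 lam4 \<epsilon> (ic1 \<epsilon>) (bc1 \<epsilon>) (N1 \<epsilon> \<theta>) \<le> 1 \<longrightarrow>
      R_total1 T xL xR \<epsilon> (s1 \<epsilon>) (N1 \<epsilon> \<theta>)
        \<le> ?K1 * root 3 ((R_APNN1 T xL xR lam1 lam2 lam3 lam4 \<epsilon> (ic1 \<epsilon>) (bc1 \<epsilon>) (N1 \<epsilon> \<theta>))\<^sup>2)"
  proof (intro ballI allI impI)
    fix \<epsilon> \<theta> assume "\<epsilon> \<in> {0<..1}"
      and le: "R_APNN1 T xL xR lam1 lam2 lam3 lam4 \<epsilon> (ic1 \<epsilon>) (bc1 \<epsilon>) (N1 \<epsilon> \<theta>) \<le> 1"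
    then have h: "xL < xR" "0 < \<epsilon>" "\<epsilon> \<le> 1"
      "exact_solution1 T xL xR \<epsilon> (s1 \<epsilon>) (ic1 \<epsilon>) (bc1 \<epsilon>)" "network1 (N1 \<epsilon> \<theta>)"
      using hyp by auto
    show "R_total1 T xL xR \<epsilon> (s1 \<epsilon>) (N1 \<epsilon> \<theta>)
        \<le> ?K1 * root 3 ((R_APNN1 T xL xR lam1 lam2 lam3 lam4 \<epsilon> (ic1 \<epsilon>) (bc1 \<epsilon>) (N1 \<epsilon> \<theta>))\<^sup>2)"
      by (rule linear_bound_imp_root3_bound[OF error_bound1(1)[OF assms h] le error_bound1(2)[OF assms h]])
  qed
  moreover have "0 < ?K1" by simp
  ultimately show "\<exists>C>0. \<exists>\<delta>>0. \<forall>\<epsilon>\<in>{0<..1}. \<forall>\<theta>.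
      R_APNN1 T xL xR lam1 lam2 lam3 lam4 \<epsilon> (ic1 \<epsilon>) (bc1 \<epsilon>) (N1 \<epsilon> \<theta>) \<le> \<delta> \<longrightarrow>
      R_total1 T xL xR \<epsilon> (s1 \<epsilon>) (N1 \<epsilon> \<theta>)
        \<le> C * root 3 ((R_APNN1 T xL xR lam1 lam2 lam3 lam4 \<epsilon> (ic1 \<epsilon>) (bc1 \<epsilon>) (N1 \<epsilon> \<theta>))\<^sup>2)"
    using zero_less_one by blast
next
  \<comment> \<open>The arguments of the rate are the area and the perimeter of the rectangle; again
    neither \<epsilon> nor the network parameters occur, and \<delta> = 1.\<close>
  let ?K2 = "\<bar>rate2 T ((b - a) * (d - c)) (2 * (b - a) + 2 * (d - c)) lam1 lam2 lam3 lam4\<bar> + 1"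
  assume hyp: "a < b \<and> c < d \<and>
      (\<forall>\<epsilon>\<in>{0<..1}. exact_solution2 T a b c d \<epsilon> (s2 \<epsilon>) (ic2 \<epsilon>) (bc2 \<epsilon>)) \<and>
      (\<forall>\<epsilon>\<in>{0<..1}. \<forall>\<theta>. network2 (N2 \<epsilon> \<theta>))"
  have "\<forall>\<epsilon>\<in>{0<..1}. \<forall>\<theta>.
      R_APNN2 T a b c d lam1 lam2 lam3 lam4 \<epsilon> (ic2 \<epsilon>) (bc2 \<epsilon>) (N2 \<epsilon> \<theta>) \<le> 1 \<longrightarrow>
      R_total2 T a b c d \<epsilon> (s2 \<epsilon>) (N2 \<epsilon> \<theta>)
        \<le> ?K2 * root 3 ((R_APNN2 T a b c d lam1 lam2 lam3 lam4 \<epsilon> (ic2 \<epsilon>) (bc2 \<epsilon>) (N2 \<epsilon> \<theta>))\<^sup>2)"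
  proof (intro ballI allI impI)
    fix \<epsilon> \<theta> assume "\<epsilon> \<in> {0<..1}"
      and le: "R_APNN2 T a b c d lam1 lam2 lam3 lam4 \<epsilon> (ic2 \<epsilon>) (bc2 \<epsilon>) (N2 \<epsilon> \<theta>) \<le> 1"
    then have h: "a < b" "c < d" "0 < \<epsilon>" "\<epsilon> \<le> 1"
      "exact_solution2 T a b c d \<epsilon> (s2 \<epsilon>) (ic2 \<epsilon>) (bc2 \<epsilon>)" "network2 (N2 \<epsilon> \<theta>)"
      using hyp by auto
    show "R_total2 T a b c d \<epsilon> (s2 \<epsilon>) (N2 \<epsilon> \<theta>)
        \<le> ?K2 * root 3 ((R_APNN2 T a b c d lam1 lam2 lam3 lam4 \<epsilon> (ic2 \<epsilon>) (bc2 \<epsilon>) (N2 \<epsilon> \<theta>))\<^sup>2)"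
      by (rule linear_bound_imp_root3_bound[OF error_bound2(1)[OF assms h] le error_bound2(2)[OF assms h]])
  qed
  moreover have "0 < ?K2" by simp
  ultimately show "\<exists>C>0. \<exists>\<delta>>0. \<forall>\<epsilon>\<in>{0<..1}. \<forall>\<theta>.
      R_APNN2 T a b c d lam1 lam2 lam3 lam4 \<epsilon> (ic2 \<epsilon>) (bc2 \<epsilon>) (N2 \<epsilon> \<theta>) \<le> \<delta> \<longrightarrow>
      R_total2 T a b c d \<epsilon> (s2 \<epsilon>) (N2 \<epsilon> \<theta>)
        \<le> C * root 3 ((R_APNN2 T a b c d lam1 lam2 lam3 lam4 \<epsilon> (ic2 \<epsilon>) (bc2 \<epsilon>) (N2 \<epsilon> \<theta>))\<^sup>2)"
    using zero_less_one by blast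
qed

end
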